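(* Let $Q$ be a quiver, $\kappa$ an infinite cardinal, $\mathcal{C}$ an $AB3^{*}(\kappa)$ abelian category and $(\mathcal{A},\mathcal{B})$ a cotorsion pair in $\mathcal{C}$. Then: (a) Let $g_i:\mathcal{C}\to\mathrm{Rep}(Q,\mathcal{C})$ be exact for all $i\in Q_0$ and $\kappa\geq\mathrm{lccn}(Q)$. Then ${}^{\perp_1}g_*(\mathcal{B})=\mathrm{Rep}(Q,\mathcal{A})$ and $g_*(\mathcal{B})\subseteq s_*(\mathcal{A})^{\perp_1}$. (b) Let $\mathcal{A}$ be a generating class in $\mathcal{C}$ and $\kappa\geq\mathrm{rmcn}(Q)$. Then $\Psi(\mathcal{B})=s_*(\mathcal{A})^{\perp_1}$. (c) Let $Q$ be right-rooted and $\kappa\geq\mathrm{rmcn}(Q)$. Then $\Psi(\mathcal{B})\subseteq\mathrm{Rep}(Q,\mathcal{B})$ and $\mathrm{Rep}(Q,\mathcal{A})\subseteq{}^{\perp_1}\Psi(\mathcal{B})$. (d) If $g_i:\mathcal{C}\to\mathrm{Rep}(Q,\mathcal{C})$ is exact for all $i\in Q_0$, $\kappa\geq\max\{\mathrm{lccn}(Q),\mathrm{rmcn}(Q)\}$, $Q$ is right-rooted and $\mathcal{A}$ is a generating class in $\mathcal{C}$, then $\mathrm{Rep}(Q,\mathcal{A})={}^{\perp_1}\Psi(\mathcal{B})$.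
   Context: A quiver $Q$ consists of (possibly infinite) sets $Q_0$ of vertices and $Q_1$ of arrows with source and target maps $s,t$. $Q(i,j)$ is the set of paths from $i$ to $j$ (including the trivial path if $i=j$). $Q_1^{i\to*}:=\{\alpha\in Q_1: s(\alpha)=i\}$. $Q$ is right-rooted if there is no infinite sequence $\bullet\to\bullet\to\bullet\to\cdots$ of (not necessarily different) composable arrows in $Q$. $\mathrm{Rep}(Q,\mathcal{C})$ is the abelian category of $\mathcal{C}$-valued representations of $Q$; for $\mathcal{X}\subseteq\mathcal{C}$, $\mathrm{Rep}(Q,\mathcal{X})$ is the class of representations $F$ with $F_i\in\mathcal{X}$ for all $i\in Q_0$. For a set $X$ of cardinals, $\mathrm{size}(X):=\sup X$ if $x<\sup X$ for all $x\in X$, and $\mathrm{size}(X):=(\sup X)^+$ otherwise. $\mathrm{lccn}(Q):=\sup_{i}\mathrm{size}(\{|Q(j,i)|\}_{j\in Q_0})$, $\mathrm{rmcn}(Q):=\mathrm{size}(\{|Q_1^{i\to*}|\}_{i\in Q_0})$. $AB3^*(\kappa)$: products of families indexed by sets of cardinality $<\kappa$ exist. $g_i:\mathcal{C}\to\mathrm{Rep}(Q,\mathcal{C})$: $(g_i(C))_j:=C^{Q(j,i)}$ with projections $\pi_\rho^C$, and $\pi^C_\rho\circ(g_i(C))_\alpha=\pi^C_{\rho\alpha}$ for arrows $\alpha:k\to l$ and $\rho\in Q(l,i)$ (defined when $\kappa\geq\mathrm{lccn}(Q)$). $s_i:\mathcal{C}\to\mathrm{Rep}(Q,\mathcal{C})$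 is the stalk functor: $(s_i(C))_i=C$, $(s_i(C))_j=0$ for $j\neq i$, all arrows act by $0$. For $\mathcal{S}\subseteq\mathcal{C}$, $g_*(\mathcal{S})=\{g_i(S):i\in Q_0,S\in\mathcal{S}\}$, and similarly $s_*(\mathcal{S})$. For $\kappa\geq\mathrm{rmcn}(Q)$, $\psi_i^F:F_i\to\prod_{\alpha\in Q_1^{i\to*}}F_{t(\alpha)}$ is the morphism induced by the $F_\alpha$, and $\Psi(\mathcal{X})$ is the class of representations $F$ such that, for all $i\in Q_0$, $\psi_i^F$ is an epimorphism and $\mathrm{Ker}(\psi_i^F)\in\mathcal{X}$. For a class $\mathcal{X}$ in an abelian category, with Yoneda Ext, $\mathcal{X}^{\perp_1}=\{Y:\mathrm{Ext}^1(X,Y)=0\ \forall X\in\mathcal{X}\}$ and ${}^{\perp_1}\mathcal{X}=\{Y:\mathrm{Ext}^1(Y,X)=0\ \forall X\in\mathcal{X}\}$. A pair $(\mathcal{A},\mathcal{B})$ is a cotorsion pair if $\mathcal{A}={}^{\perp_1}\mathcal{B}$ and $\mathcal{B}=\mathcal{A}^{\perp_1}$. A class is generating if every object is a quotient of an object of the class. *)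

theory Defs
  imports "HOL-Algebra.Group" "HOL-Library.FuncSet" "Graph_Theory.Arc_Walk"
begin

unbundle cardinal_syntax

section \<open>Abelian categories\<close>

text \<open>
  Morphisms do not carry their domain and codomain, and hom-sets need not be disjoint; instead
  every notion below mentions the objects explicitly.  Every category with pairwise disjoint
  hom-sets has this form.  \<open>Comp C g f\<close> is the composite ``first f, then g''.
\<close>

record ('o, 'm) precat =
  Obj :: "'o set"
  Hom :: "'o \<Rightarrow> 'o \<Rightarrow> 'm set"
  Ide :: "'o \<Rightarrow> 'm"
  Comp :: "'m \<Rightarrow> 'm \<Rightarrow> 'm"  (infixl \<open>\<cdot>\<index>\<close> 70)
  Add :: "'m \<Rightarrow> 'm \<Rightarrow> 'm"
  Zero :: "'o \<Rightarrow> 'o \<Rightarrow> 'm"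

definition hom_group :: "('o, 'm) precat \<Rightarrow> 'o \<Rightarrow> 'o \<Rightarrow> 'm monoid" where
  "hom_group C A B = \<lparr>carrier = Hom C A B, monoid.mult = Add C, one = Zero C A B\<rparr>"

locale preadditive_category =
  fixes C :: "('o, 'm) precat" (structure)
  assumes Ide_in_Hom: "A \<in> Obj C \<Longrightarrow> Ide C A \<in> Hom C A A"
    and Comp_in_Hom: "\<lbrakk>A \<in> Obj C; B \<in> Obj C; D \<in> Obj C; f \<in> Hom C A B; g \<in> Hom C B D\<rbrakk>
          \<Longrightarrow> g \<cdot> f \<in> Hom C A D"
    and Comp_Ide: "\<lbrakk>A \<in> Obj C; B \<in> Obj C; f \<in> Hom C A B\<rbrakk> \<Longrightarrow> f \<cdot> Ide C A = f"
    and Ide_Comp: "\<lbrakk>A \<in> Obj C; B \<in> Obj C; f \<in> Hom C A B\<rbrakk> \<Longrightarrow> Ide C B \<cdot> f = f"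
    and Comp_assoc: "\<lbrakk>A \<in> Obj C; B \<in> Obj C; D \<in> Obj C; E \<in> Obj C;
          f \<in> Hom C A B; g \<in> Hom C B D; h \<in> Hom C D E\<rbrakk> \<Longrightarrow> (h \<cdot> g) \<cdot> f = h \<cdot> (g \<cdot> f)"
    and comm_group_hom: "\<lbrakk>A \<in> Obj C; B \<in> Obj C\<rbrakk> \<Longrightarrow> comm_group (hom_group C A B)"
    and Comp_Add: "\<lbrakk>A \<in> Obj C; B \<in> Obj C; D \<in> Obj C;
          f \<in> Hom C A B; f' \<in> Hom C A B; g \<in> Hom C B D\<rbrakk>
          \<Longrightarrow> g \<cdot> (Add C f f') = Add C (g \<cdot> f) (g \<cdot> f')"
    and Add_Comp: "\<lbrakk>A \<in> Obj C; B \<in> Obj C; D \<in> Obj C;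
          f \<in> Hom C A B; g \<in> Hom C B D; g' \<in> Hom C B D\<rbrakk>
          \<Longrightarrow> (Add C g g') \<cdot> f = Add C (g \<cdot> f) (g' \<cdot> f)"

definition is_zero_object :: "('o, 'm) precat \<Rightarrow> 'o \<Rightarrow> bool" where
  "is_zero_object C Z \<longleftrightarrow> Z \<in> Obj C \<and>
     (\<forall>T\<in>Obj C. (\<exists>!f. f \<in> Hom C T Z) \<and> (\<exists>!f. f \<in> Hom C Z T))"

definition is_mono :: "('o, 'm) precat \<Rightarrow> 'o \<Rightarrow> 'o \<Rightarrow> 'm \<Rightarrow> bool" where
  "is_mono C A B f \<longleftrightarrow> f \<in> Hom C A B \<and>
     (\<forall>T\<in>Obj C. \<forall>g\<in>Hom C T A. \<forall>h\<in>Hom C T A. f \<cdot>\<^bsub>C\<^esub> g = f \<cdot>\<^bsub>C\<^esub> h \<longrightarrow> g = h)"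

definition is_epi :: "('o, 'm) precat \<Rightarrow> 'o \<Rightarrow> 'o \<Rightarrow> 'm \<Rightarrow> bool" where
  "is_epi C A B f \<longleftrightarrow> f \<in> Hom C A B \<and>
     (\<forall>T\<in>Obj C. \<forall>g\<in>Hom C B T. \<forall>h\<in>Hom C B T. g \<cdot>\<^bsub>C\<^esub> f = h \<cdot>\<^bsub>C\<^esub> f \<longrightarrow> g = h)"

definition is_iso :: "('o, 'm) precat \<Rightarrow> 'o \<Rightarrow> 'o \<Rightarrow> 'm \<Rightarrow> bool" where
  "is_iso C A B f \<longleftrightarrow> f \<in> Hom C A B \<and>
     (\<exists>g\<in>Hom C B A. g \<cdot>\<^bsub>C\<^esub> f = Ide C A \<and> f \<cdot>\<^bsub>C\<^esub> g = Ide C B)"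

text \<open>\<open>is_kernel C A B f K k\<close>: the morphism \<open>k : K \<rightarrow> A\<close> is a kernel of \<open>f : A \<rightarrow> B\<close>.
  \<open>is_cokernel C A B f Q q\<close>: the morphism \<open>q : B \<rightarrow> Q\<close> is a cokernel of \<open>f : A \<rightarrow> B\<close>.\<close>

definition is_kernel :: "('o, 'm) precat \<Rightarrow> 'o \<Rightarrow> 'o \<Rightarrow> 'm \<Rightarrow> 'o \<Rightarrow> 'm \<Rightarrow> bool" where
  "is_kernel C A B f K k \<longleftrightarrow> f \<in> Hom C A B \<and> K \<in> Obj C \<and> k \<in> Hom C K A \<and>
     f \<cdot>\<^bsub>C\<^esub> k = Zero C K B \<and>
     (\<forall>T\<in>Obj C. \<forall>t\<in>Hom C T A. f \<cdot>\<^bsub>C\<^esub> t = Zero C T B \<longrightarrow>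
        (\<exists>!u. u \<in> Hom C T K \<and> k \<cdot>\<^bsub>C\<^esub> u = t))"

definition is_cokernel :: "('o, 'm) precat \<Rightarrow> 'o \<Rightarrow> 'o \<Rightarrow> 'm \<Rightarrow> 'o \<Rightarrow> 'm \<Rightarrow> bool" where
  "is_cokernel C A B f Q q \<longleftrightarrow> f \<in> Hom C A B \<and> Q \<in> Obj C \<and> q \<in> Hom C B Q \<and>
     q \<cdot>\<^bsub>C\<^esub> f = Zero C A Q \<and>
     (\<forall>T\<in>Obj C. \<forall>t\<in>Hom C B T. t \<cdot>\<^bsub>C\<^esub> f = Zero C A T \<longrightarrow>
        (\<exists>!u. u \<in> Hom C Q T \<and> u \<cdot>\<^bsub>C\<^esub> q = t))"

definition has_biproduct :: "('o, 'm) precat \<Rightarrow> 'o \<Rightarrow> 'o \<Rightarrow> bool" where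
  "has_biproduct C A B \<longleftrightarrow>
     (\<exists>P\<in>Obj C. \<exists>i\<in>Hom C A P. \<exists>j\<in>Hom C B P. \<exists>p\<in>Hom C P A. \<exists>q\<in>Hom C P B.
        p \<cdot>\<^bsub>C\<^esub> i = Ide C A \<and> q \<cdot>\<^bsub>C\<^esub> j = Ide C B \<and>
        p \<cdot>\<^bsub>C\<^esub> j = Zero C B A \<and> q \<cdot>\<^bsub>C\<^esub> i = Zero C A B \<and>
        Add C (i \<cdot>\<^bsub>C\<^esub> p) (j \<cdot>\<^bsub>C\<^esub> q) = Ide C P)"

locale abelian_category = preadditive_category +
  assumes ex_zero_object: "\<exists>Z. is_zero_object C Z"
    and ex_biproduct: "\<lbrakk>A \<in> Obj C; B \<in> Obj C\<rbrakk> \<Longrightarrow> has_biproduct C A B"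
    and ex_kernel: "\<lbrakk>A \<in> Obj C; B \<in> Obj C; f \<in> Hom C A B\<rbrakk> \<Longrightarrow> \<exists>K k. is_kernel C A B f K k"
    and ex_cokernel: "\<lbrakk>A \<in> Obj C; B \<in> Obj C; f \<in> Hom C A B\<rbrakk> \<Longrightarrow> \<exists>Q q. is_cokernel C A B f Q q"
    and mono_normal: "\<lbrakk>A \<in> Obj C; B \<in> Obj C; is_mono C A B f\<rbrakk>
          \<Longrightarrow> \<exists>D g. D \<in> Obj C \<and> is_kernel C B D g A f"
    and epi_normal: "\<lbrakk>A \<in> Obj C; B \<in> Obj C; is_epi C A B f\<rbrakk>
          \<Longrightarrow> \<exists>D g. D \<in> Obj C \<and> is_cokernel C D A g B f"

text \<open>Zero objects, kernel objects and products are only determined up to isomorphism; a fixed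
  choice is made once and for all, as is implicit in treating the constructions below as functors.\<close>

definition zero_obj :: "('o, 'm) precat \<Rightarrow> 'o" where
  "zero_obj C = (SOME Z. is_zero_object C Z)"

definition Ker :: "('o, 'm) precat \<Rightarrow> 'o \<Rightarrow> 'o \<Rightarrow> 'm \<Rightarrow> 'o" where
  "Ker C A B f = (SOME K. \<exists>k. is_kernel C A B f K k)"


section \<open>Products\<close>

definition is_product ::
    "('o, 'm) precat \<Rightarrow> 'i set \<Rightarrow> ('i \<Rightarrow> 'o) \<Rightarrow> 'o \<Rightarrow> ('i \<Rightarrow> 'm) \<Rightarrow> bool" where
  "is_product C I X P p \<longleftrightarrow> P \<in> Obj C \<and> (\<forall>i\<in>I. p i \<in> Hom C P (X i)) \<and>
     (\<forall>T\<in>Obj C. \<forall>f. (\<forall>i\<in>I. f i \<in> Hom C T (X i)) \<longrightarrow>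
        (\<exists>!h. h \<in> Hom C T P \<and> (\<forall>i\<in>I. p i \<cdot>\<^bsub>C\<^esub> h = f i)))"

text \<open>Every set of cardinality less than \<open>\<kappa>\<close> is in bijection with a subset of \<open>Field \<kappa>\<close>, so it
  suffices to consider such index sets.\<close>

definition AB3star :: "('o, 'm) precat \<Rightarrow> 'k rel \<Rightarrow> bool" where
  "AB3star C \<kappa> \<longleftrightarrow>
     (\<forall>I X. I \<subseteq> Field \<kappa> \<longrightarrow> |I| <o \<kappa> \<longrightarrow> X \<in> I \<rightarrow> Obj C \<longrightarrow> (\<exists>P p. is_product C I X P p))"

definition product_cone :: "('o, 'm) precat \<Rightarrow> 'i set \<Rightarrow> ('i \<Rightarrow> 'o) \<Rightarrow> 'o \<times> ('i \<Rightarrow> 'm)" where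
  "product_cone C I X = (SOME (P, p). is_product C I X P p)"

definition Prod :: "('o, 'm) precat \<Rightarrow> 'i set \<Rightarrow> ('i \<Rightarrow> 'o) \<Rightarrow> 'o" where
  "Prod C I X = fst (product_cone C I X)"

definition proj :: "('o, 'm) precat \<Rightarrow> 'i set \<Rightarrow> ('i \<Rightarrow> 'o) \<Rightarrow> 'i \<Rightarrow> 'm" where
  "proj C I X = snd (product_cone C I X)"

text \<open>The morphism \<open>T \<rightarrow> Prod C I X\<close> with components \<open>f i : T \<rightarrow> X i\<close>.\<close>

definition tuple :: "('o, 'm) precat \<Rightarrow> 'i set \<Rightarrow> ('i \<Rightarrow> 'o) \<Rightarrow> 'o \<Rightarrow> ('i \<Rightarrow> 'm) \<Rightarrow> 'm" where
  "tuple C I X T f =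
     (THE h. h \<in> Hom C T (Prod C I X) \<and> (\<forall>i\<in>I. proj C I X i \<cdot>\<^bsub>C\<^esub> h = f i))"


section \<open>Exactness, Yoneda Ext and cotorsion pairs\<close>

definition short_exact ::
    "('o, 'm) precat \<Rightarrow> 'o \<Rightarrow> 'o \<Rightarrow> 'o \<Rightarrow> 'm \<Rightarrow> 'm \<Rightarrow> bool" where
  "short_exact C A B D f g \<longleftrightarrow> A \<in> Obj C \<and> B \<in> Obj C \<and> D \<in> Obj C \<and>
     is_kernel C B D g A f \<and> is_cokernel C A B f D g"

definition is_functor ::
    "('o, 'm) precat \<Rightarrow> ('p, 'n) precat \<Rightarrow> ('o \<Rightarrow> 'p) \<Rightarrow> ('o \<Rightarrow> 'o \<Rightarrow> 'm \<Rightarrow> 'n) \<Rightarrow> bool" where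
  "is_functor C D Fo Fm \<longleftrightarrow>
     (\<forall>A\<in>Obj C. Fo A \<in> Obj D \<and> Fm A A (Ide C A) = Ide D (Fo A)) \<and>
     (\<forall>A\<in>Obj C. \<forall>B\<in>Obj C. \<forall>f\<in>Hom C A B. Fm A B f \<in> Hom D (Fo A) (Fo B)) \<and>
     (\<forall>A\<in>Obj C. \<forall>B\<in>Obj C. \<forall>E\<in>Obj C. \<forall>f\<in>Hom C A B. \<forall>g\<in>Hom C B E.
        Fm A E (g \<cdot>\<^bsub>C\<^esub> f) = Fm B E g \<cdot>\<^bsub>D\<^esub> Fm A B f)"

definition exact_functor ::
    "('o, 'm) precat \<Rightarrow> ('p, 'n) precat \<Rightarrow> ('o \<Rightarrow> 'p) \<Rightarrow> ('o \<Rightarrow> 'o \<Rightarrow> 'm \<Rightarrow> 'n) \<Rightarrow> bool" where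
  "exact_functor C D Fo Fm \<longleftrightarrow> is_functor C D Fo Fm \<and>
     (\<forall>A B E f g. short_exact C A B E f g \<longrightarrow>
        short_exact D (Fo A) (Fo B) (Fo E) (Fm A B f) (Fm B E g))"

text \<open>\<open>extensions C X Y\<close> consists of the short exact sequences \<open>0 \<rightarrow> Y \<rightarrow> E \<rightarrow> X \<rightarrow> 0\<close>.\<close>

definition extensions :: "('o, 'm) precat \<Rightarrow> 'o \<Rightarrow> 'o \<Rightarrow> ('o \<times> 'm \<times> 'm) set" where
  "extensions C X Y = {(E, f, g). short_exact C Y E X f g}"

definition ext_equiv ::
    "('o, 'm) precat \<Rightarrow> 'o \<Rightarrow> 'o \<Rightarrow> (('o \<times> 'm \<times> 'm) \<times> ('o \<times> 'm \<times> 'm)) set" where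
  "ext_equiv C X Y = {((E, f, g), (E', f', g')).
     (E, f, g) \<in> extensions C X Y \<and> (E', f', g') \<in> extensions C X Y \<and>
     (\<exists>h. is_iso C E E' h \<and> h \<cdot>\<^bsub>C\<^esub> f = f' \<and> g' \<cdot>\<^bsub>C\<^esub> h = g)}"

definition Ext1 :: "('o, 'm) precat \<Rightarrow> 'o \<Rightarrow> 'o \<Rightarrow> ('o \<times> 'm \<times> 'm) set set" where
  "Ext1 C X Y = extensions C X Y // ext_equiv C X Y"

text \<open>The neutral element for the Baer sum on \<open>Ext1 C X Y\<close> is the class of split extensions.\<close>

definition Ext1_zero :: "('o, 'm) precat \<Rightarrow> 'o \<Rightarrow> 'o \<Rightarrow> ('o \<times> 'm \<times> 'm) set" where
  "Ext1_zero C X Y =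
     {(E, f, g) \<in> extensions C X Y. \<exists>s\<in>Hom C X E. g \<cdot>\<^bsub>C\<^esub> s = Ide C X}"

definition right_perp :: "('o, 'm) precat \<Rightarrow> 'o set \<Rightarrow> 'o set" where
  "right_perp C \<X> = {Y \<in> Obj C. \<forall>X\<in>\<X>. Ext1 C X Y = {Ext1_zero C X Y}}"

definition left_perp :: "('o, 'm) precat \<Rightarrow> 'o set \<Rightarrow> 'o set" where
  "left_perp C \<X> = {Y \<in> Obj C. \<forall>X\<in>\<X>. Ext1 C Y X = {Ext1_zero C Y X}}"

definition cotorsion_pair :: "('o, 'm) precat \<Rightarrow> 'o set \<Rightarrow> 'o set \<Rightarrow> bool" where
  "cotorsion_pair C \<A> \<B> \<longleftrightarrow> \<A> = left_perp C \<B> \<and> \<B> = right_perp C \<A>"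

definition generating :: "('o, 'm) precat \<Rightarrow> 'o set \<Rightarrow> bool" where
  "generating C \<A> \<longleftrightarrow> (\<forall>X\<in>Obj C. \<exists>A\<in>\<A>. \<exists>f. is_epi C A X f)"


section \<open>Cardinal invariants of quivers\<close>

text \<open>A quiver is a \<open>wf_digraph\<close>: loops and multiple arrows are allowed, and neither the vertices
  nor the arrows need be finite.\<close>

definition paths :: "('v, 'a) pre_digraph \<Rightarrow> 'v \<Rightarrow> 'v \<Rightarrow> 'a list set" where
  "paths Q i j = {p. pre_digraph.awalk Q i p j}"

definition right_rooted :: "('v, 'a) pre_digraph \<Rightarrow> bool" where
  "right_rooted Q \<longleftrightarrow>
     \<not> (\<exists>f :: nat \<Rightarrow> 'a. \<forall>n. f n \<in> arcs Q \<and> head Q (f n) = tail Q (f (Suc n)))"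

text \<open>Cardinals are represented by cardinal orders.  The supremum of a set of cardinal orders on
  subsets of \<open>'c\<close> is bounded by the cardinality of \<open>'c\<close>, hence is again represented on \<open>'c\<close>.\<close>

definition csup :: "'c rel set \<Rightarrow> 'c rel" where
  "csup R = (SOME s. Card_order s \<and> (\<forall>r\<in>R. r \<le>o s) \<and>
     (\<forall>s' :: 'c rel. Card_order s' \<longrightarrow> (\<forall>r\<in>R. r \<le>o s') \<longrightarrow> s \<le>o s'))"

text \<open>Since \<open>cardSuc\<close> lives on \<open>'c set\<close>, in the first case \<open>csup R\<close> is transported there along the
  injection sending \<open>x\<close> to \<open>{x}\<close>.\<close>

definition csize :: "'c rel set \<Rightarrow> 'c set rel" where
  "csize R = (if \<forall>r\<in>R. r <o csup R then |(\<lambda>x. {x}) ` Field (csup R)| else cardSuc (csup R))"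

definition lccn :: "('v, 'a) pre_digraph \<Rightarrow> 'a list set rel" where
  "lccn Q = csup ((\<lambda>i. csize ((\<lambda>j. |paths Q j i| ) ` verts Q)) ` verts Q)"

definition rmcn :: "('v, 'a) pre_digraph \<Rightarrow> 'a set rel" where
  "rmcn Q = csize ((\<lambda>i. |out_arcs Q i| ) ` verts Q)"

lemma csup_is_lub:
  fixes R :: "'c rel set"
  assumes R: "\<forall>r\<in>R. Card_order r"
  shows "Card_order (csup R)" "r \<in> R \<Longrightarrow> r \<le>o csup R"
    and "\<lbrakk>Card_order (k :: 'k rel); \<forall>r\<in>R. r \<le>o k\<rbrakk> \<Longrightarrow> csup R \<le>o k"
proof -
  let ?U = "{s :: 'c rel. Card_order s \<and> (\<forall>r\<in>R. r \<le>o s)}"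
  have bounded: "r \<le>o |UNIV :: 'c set|" if "Card_order r" for r :: "'c rel"
    using that card_of_Field_ordIso card_of_mono1[of "Field r" UNIV]
    by (meson ordIso_ordLeq_trans ordIso_symmetric subset_UNIV)
  then have "|UNIV :: 'c set| \<in> ?U"
    using R card_of_Card_order by blast
  then have "\<exists>s\<in>?U. \<forall>s'\<in>?U. s \<le>o s'"
    by (intro exists_minim_Card_order) blast+
  then have ex: "\<exists>s :: 'c rel. Card_order s \<and> (\<forall>r\<in>R. r \<le>o s) \<and>
      (\<forall>s' :: 'c rel. Card_order s' \<longrightarrow> (\<forall>r\<in>R. r \<le>o s') \<longrightarrow> s \<le>o s')"
    by blast
  note lub = someI_ex[OF ex, folded csup_def]
  show card: "Card_order (csup R)" and "r \<in> R \<Longrightarrow> r \<le>o csup R"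
    using lub by auto
  show "csup R \<le>o k" if k: "Card_order (k :: 'k rel)" "\<forall>r\<in>R. r \<le>o k"
  proof (rule ccontr)
    assume "\<not> csup R \<le>o k"
    then have less: "k <o csup R"
      using card k by (meson card_order_on_well_order_on not_ordLeq_iff_ordLess)
    then have "|Field k| \<le>o |UNIV :: 'c set|"
      using bounded[OF card] k(1) card_of_Field_ordIso
      by (meson ordIso_ordLeq_trans ordLeq_transitive ordLess_imp_ordLeq)
    then obtain f :: "'k \<Rightarrow> 'c" where "inj_on f (Field k)"
      using card_of_ordLeq[of "Field k" "UNIV :: 'c set"] by blast
    then have "|Field k| =o |f ` Field k|"
      using card_of_ordIso inj_on_imp_bij_betw by blast
    then have iso: "k =o |f ` Field k|"
      using k(1) card_of_Field_ordIso by (meson ordIso_symmetric ordIso_transitive)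
    then have "\<forall>r\<in>R. r \<le>o |f ` Field k|"
      using k(2) by (meson ordLeq_ordIso_trans)
    then have "csup R \<le>o |f ` Field k|"
      using lub card_of_Card_order by blast
    then have "csup R \<le>o k"
      using iso by (meson ordIso_symmetric ordLeq_ordIso_trans)
    with less show False
      by (meson not_ordLess_ordLeq)
  qed
qed

lemma csize_ordLeq_iff:
  fixes R :: "'c rel set" and k :: "'k rel"
  assumes R: "\<forall>r\<in>R. Card_order r" and k: "Card_order k"
  shows "csize R \<le>o k \<longleftrightarrow> (\<forall>r\<in>R. r <o k)"
proof (cases "\<forall>r\<in>R. r <o csup R")
  case True
  have "bij_betw (\<lambda>x. {x}) (Field (csup R)) ((\<lambda>x. {x}) ` Field (csup R))"
    by (simp add: inj_on_imp_bij_betw)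
  then have "|Field (csup R)| =o csize R"
    using True card_of_ordIso by (auto simp: csize_def)
  then have iso: "csup R =o csize R"
    using csup_is_lub(1)[OF R] card_of_Field_ordIso by (meson ordIso_symmetric ordIso_transitive)
  then have "csize R \<le>o k \<longleftrightarrow> csup R \<le>o k"
    by (meson ordIso_ordLeq_trans ordIso_symmetric)
  also have "\<dots> \<longleftrightarrow> (\<forall>r\<in>R. r <o k)"
    using True csup_is_lub(3)[OF R k] by (meson ordLess_imp_ordLeq ordLess_ordLeq_trans)
  finally show ?thesis .
next
  case False
  then obtain r where r: "r \<in> R" "\<not> r <o csup R"
    by blast
  then have "csup R \<le>o r"
    using R csup_is_lub(1)[OF R] by (meson card_order_on_well_order_on not_ordLess_iff_ordLeq)
  have "csize R \<le>o k \<longleftrightarrow> csup R <o k"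
    using False cardSuc_ordLess_ordLeq[OF csup_is_lub(1)[OF R] k] by (auto simp: csize_def)
  also have "\<dots> \<longleftrightarrow> (\<forall>r\<in>R. r <o k)"
    using r(1) \<open>csup R \<le>o r\<close> csup_is_lub(2)[OF R] by (meson ordLeq_ordLess_trans)
  finally show ?thesis .
qed


section \<open>Representations of quivers\<close>

record ('v, 'a, 'o, 'm) rep =
  at_vertex :: "'v \<Rightarrow> 'o"
  at_arrow :: "'a \<Rightarrow> 'm"

text \<open>Representations and their morphisms are extensional functions on the vertices and arrows of
  the quiver, so that equality in HOL is equality of representations and of morphisms.\<close>

definition Rep ::
    "('v, 'a) pre_digraph \<Rightarrow> ('o, 'm) precat \<Rightarrow> (('v, 'a, 'o, 'm) rep, 'v \<Rightarrow> 'm) precat" where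
  "Rep Q C = \<lparr>
     Obj = {F. at_vertex F \<in> verts Q \<rightarrow>\<^sub>E Obj C \<and>
               at_arrow F \<in> (\<Pi>\<^sub>E a\<in>arcs Q.
                 Hom C (at_vertex F (tail Q a)) (at_vertex F (head Q a)))},
     Hom = (\<lambda>F G. {\<eta> \<in> (\<Pi>\<^sub>E i\<in>verts Q. Hom C (at_vertex F i) (at_vertex G i)).
               \<forall>a\<in>arcs Q. \<eta> (head Q a) \<cdot>\<^bsub>C\<^esub> at_arrow F a = at_arrow G a \<cdot>\<^bsub>C\<^esub> \<eta> (tail Q a)}),
     Ide = (\<lambda>F. \<lambda>i\<in>verts Q. Ide C (at_vertex F i)),
     Comp = (\<lambda>\<theta> \<eta>. \<lambda>i\<in>verts Q. \<theta> i \<cdot>\<^bsub>C\<^esub> \<eta> i),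
     Add = (\<lambda>\<theta> \<eta>. \<lambda>i\<in>verts Q. Add C (\<theta> i) (\<eta> i)),
     Zero = (\<lambda>F G. \<lambda>i\<in>verts Q. Zero C (at_vertex F i) (at_vertex G i))\<rparr>"

definition Rep_in ::
    "('v, 'a) pre_digraph \<Rightarrow> ('o, 'm) precat \<Rightarrow> 'o set \<Rightarrow> ('v, 'a, 'o, 'm) rep set" where
  "Rep_in Q C \<X> = {F \<in> Obj (Rep Q C). \<forall>i\<in>verts Q. at_vertex F i \<in> \<X>}"

text \<open>Paths are lists of arrows in order of traversal, so the path written \<open>\<rho>\<alpha>\<close> in functional
  notation (first \<open>\<alpha>\<close>, then \<open>\<rho>\<close>) is the list \<open>\<alpha> # \<rho>\<close>.\<close>

definition g_obj ::
    "('v, 'a) pre_digraph \<Rightarrow> ('o, 'm) precat \<Rightarrow> 'v \<Rightarrow> 'o \<Rightarrow> ('v, 'a, 'o, 'm) rep" where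
  "g_obj Q C i X = \<lparr>
     at_vertex = (\<lambda>j\<in>verts Q. Prod C (paths Q j i) (\<lambda>_. X)),
     at_arrow = (\<lambda>\<alpha>\<in>arcs Q.
       tuple C (paths Q (head Q \<alpha>) i) (\<lambda>_. X) (Prod C (paths Q (tail Q \<alpha>) i) (\<lambda>_. X))
         (\<lambda>\<rho>. proj C (paths Q (tail Q \<alpha>) i) (\<lambda>_. X) (\<alpha> # \<rho>)))\<rparr>"

definition g_mor ::
    "('v, 'a) pre_digraph \<Rightarrow> ('o, 'm) precat \<Rightarrow> 'v \<Rightarrow> 'o \<Rightarrow> 'o \<Rightarrow> 'm \<Rightarrow> 'v \<Rightarrow> 'm" where
  "g_mor Q C i X Y f = (\<lambda>j\<in>verts Q.
     tuple C (paths Q j i) (\<lambda>_. Y) (Prod C (paths Q j i) (\<lambda>_. X))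
       (\<lambda>\<rho>. f \<cdot>\<^bsub>C\<^esub> proj C (paths Q j i) (\<lambda>_. X) \<rho>))"

definition g_star ::
    "('v, 'a) pre_digraph \<Rightarrow> ('o, 'm) precat \<Rightarrow> 'o set \<Rightarrow> ('v, 'a, 'o, 'm) rep set" where
  "g_star Q C \<S> = {g_obj Q C i S |i S. i \<in> verts Q \<and> S \<in> \<S>}"

definition s_obj ::
    "('v, 'a) pre_digraph \<Rightarrow> ('o, 'm) precat \<Rightarrow> 'v \<Rightarrow> 'o \<Rightarrow> ('v, 'a, 'o, 'm) rep" where
  "s_obj Q C i X = (let S = (\<lambda>j. if j = i then X else zero_obj C) in \<lparr>
     at_vertex = (\<lambda>j\<in>verts Q. S j),
     at_arrow = (\<lambda>\<alpha>\<in>arcs Q. Zero C (S (tail Q \<alpha>)) (S (head Q \<alpha>)))\<rparr>)"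

definition s_star ::
    "('v, 'a) pre_digraph \<Rightarrow> ('o, 'm) precat \<Rightarrow> 'o set \<Rightarrow> ('v, 'a, 'o, 'm) rep set" where
  "s_star Q C \<S> = {s_obj Q C i S |i S. i \<in> verts Q \<and> S \<in> \<S>}"

definition psi ::
    "('v, 'a) pre_digraph \<Rightarrow> ('o, 'm) precat \<Rightarrow> ('v, 'a, 'o, 'm) rep \<Rightarrow> 'v \<Rightarrow> 'm" where
  "psi Q C F i =
     tuple C (out_arcs Q i) (\<lambda>\<alpha>. at_vertex F (head Q \<alpha>)) (at_vertex F i) (at_arrow F)"

definition Psi ::
    "('v, 'a) pre_digraph \<Rightarrow> ('o, 'm) precat \<Rightarrow> 'o set \<Rightarrow> ('v, 'a, 'o, 'm) rep set" where
  "Psi Q C \<X> = {F \<in> Obj (Rep Q C). \<forall>i\<in>verts Q.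
     let P = Prod C (out_arcs Q i) (\<lambda>\<alpha>. at_vertex F (head Q \<alpha>))
     in is_epi C (at_vertex F i) P (psi Q C F i) \<and> Ker C (at_vertex F i) P (psi Q C F i) \<in> \<X>}"

end

theory Submission
  imports Defs
begin

text \<open>
  Evaluation at \<open>i\<close> is left adjoint to \<open>g\<^sub>i\<close>.  An extension of \<open>F\<close> by \<open>g\<^sub>i(B)\<close> therefore splits as
  soon as the projection of \<open>g\<^sub>i(B)\<^sub>i\<close> onto its trivial-path factor \<open>B\<close> extends to the middle term,
  which pushout along that projection reduces to \<open>Ext\<^sup>1(F\<^sub>i, B) = 0\<close>.  Conversely, if \<open>g\<^sub>i\<close> is exact,
  lifting the unit \<open>F \<rightarrow> g\<^sub>i(F\<^sub>i)\<close> along the image under \<open>g\<^sub>i\<close> of an extension of \<open>F\<^sub>i\<close> by \<open>B\<close> yields a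
  splitting of the latter.

  An extension of \<open>s\<^sub>i(A)\<close> by \<open>F\<close> is the same thing as an extension \<open>0 \<rightarrow> F\<^sub>i \<rightarrow> M \<rightarrow> A \<rightarrow> 0\<close> with a
  morphism from \<open>M\<close> to the codomain \<open>P\<^sub>i\<close> of \<open>\<psi>\<^sub>i\<close> restricting to \<open>\<psi>\<^sub>i\<close>, and it splits iff \<open>M \<rightarrow> A\<close> has a section killed
  by that morphism.  If \<open>\<psi>\<^sub>i\<close> is epi with kernel \<open>K\<close>, such sections are the splittings of an extension
  of \<open>A\<close> by \<open>K\<close>.  Conversely, taking \<open>M = F\<^sub>i \<oplus> A\<close> lifts every \<open>A \<rightarrow> P\<^sub>i\<close> through \<open>\<psi>\<^sub>i\<close>, and
  pushing out extensions of \<open>A\<close> by \<open>K\<close> along \<open>K \<rightarrow> F\<^sub>i\<close> shows \<open>Ext\<^sup>1(A, K) = 0\<close>.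

  If \<open>Q\<close> is right-rooted, the sections over the successors of a vertex determine a correction term
  in \<open>P\<^sub>i\<close>, which lifts along \<open>\<psi>\<^sub>i\<close>; so splittings are built by well-founded recursion.
\<close>

section \<open>Calculus of typed arrows\<close>

text \<open>Sending F to the kernel of \<psi>_i is right adjoint to the stalk functor s_i, but in
  general this functor is only left exact. Requiring \<psi>_i to be epi is what lets Ext against a
  stalk be computed on that kernel. Infinite products need not be exact in \<open>C\<close>, so they
  are handled through their universal property, and no long exact sequence is invoked. Vanishing of
  Ext^1 is used in two working forms, extension of morphisms along a mono and lifting along an epi;
  \<open>section_into_kernel\<close> takes the place of exactness at a middle term. In the converse
  half of (b) only extensions of stalks are controlled, so an extension in \<open>C\<close> has to
  be turned into a representation vertex by vertex. Loops at \<open>i\<close> are the delicate case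
  there; they are met by letting every arrow of the new representation factor through F.\<close>

text \<open>Hom-sets may overlap, so typing of a composite involves an object that does not occur in it.
  Tagging morphisms with their domain and codomain makes all side conditions rewritable.\<close>

datatype ('o, 'm) arr = Arr (Dom: 'o) (mor: 'm) (Cod: 'o)

context preadditive_category
begin

definition arrow :: "('o, 'm) arr \<Rightarrow> bool" where
  "arrow f \<longleftrightarrow> Dom f \<in> Obj C \<and> Cod f \<in> Obj C \<and> mor f \<in> Hom C (Dom f) (Cod f)"

definition comp :: "('o, 'm) arr \<Rightarrow> ('o, 'm) arr \<Rightarrow> ('o, 'm) arr"  (infixr \<open>\<odot>\<close> 75) where
  "g \<odot> f = Arr (Dom f) (mor g \<cdot> mor f) (Cod g)"

definition plus :: "('o, 'm) arr \<Rightarrow> ('o, 'm) arr \<Rightarrow> ('o, 'm) arr"  (infixl \<open>\<oplus>\<close> 70) where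
  "f \<oplus> g = Arr (Dom f) (Add C (mor f) (mor g)) (Cod f)"

definition neg :: "('o, 'm) arr \<Rightarrow> ('o, 'm) arr"  (\<open>\<ominus>_\<close> [80] 80) where
  "neg f = Arr (Dom f) (m_inv (hom_group C (Dom f) (Cod f)) (mor f)) (Cod f)"

definition nul :: "'o \<Rightarrow> 'o \<Rightarrow> ('o, 'm) arr" where "nul A B = Arr A (Zero C A B) B"
definition idn :: "'o \<Rightarrow> ('o, 'm) arr" where "idn A = Arr A (Ide C A) A"

section \<open>Additive calculus of typed morphisms\<close>

lemmas arr_defs = arrow_def comp_def plus_def neg_def nul_def idn_def

lemma Zero_in_Hom: "\<lbrakk>A \<in> Obj C; B \<in> Obj C\<rbrakk> \<Longrightarrow> Zero C A B \<in> Hom C A B"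
  using monoid.one_closed[OF group.is_monoid[OF comm_group.axioms(2)[OF comm_group_hom]], of A B]
  by (simp add: hom_group_def)

lemma Add_in_Hom:
  "\<lbrakk>A \<in> Obj C; B \<in> Obj C; f \<in> Hom C A B; g \<in> Hom C A B\<rbrakk> \<Longrightarrow> Add C f g \<in> Hom C A B"
  using monoid.m_closed[OF group.is_monoid[OF comm_group.axioms(2)[OF comm_group_hom]], of A B]
  by (simp add: hom_group_def)

lemma Add_assoc:
  "\<lbrakk>A \<in> Obj C; B \<in> Obj C; f \<in> Hom C A B; g \<in> Hom C A B; h \<in> Hom C A B\<rbrakk>
    \<Longrightarrow> Add C (Add C f g) h = Add C f (Add C g h)"
  using monoid.m_assoc[OF group.is_monoid[OF comm_group.axioms(2)[OF comm_group_hom]], of A B]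
  by (simp add: hom_group_def)

lemma Add_commute:
  "\<lbrakk>A \<in> Obj C; B \<in> Obj C; f \<in> Hom C A B; g \<in> Hom C A B\<rbrakk> \<Longrightarrow> Add C f g = Add C g f"
  using comm_monoid.m_comm[OF comm_group.axioms(1)[OF comm_group_hom], of A B]
  by (simp add: hom_group_def)

lemma Zero_Add: "\<lbrakk>A \<in> Obj C; B \<in> Obj C; f \<in> Hom C A B\<rbrakk> \<Longrightarrow> Add C (Zero C A B) f = f"
  using monoid.l_one[OF group.is_monoid[OF comm_group.axioms(2)[OF comm_group_hom]], of A B]
  by (simp add: hom_group_def)

lemma inv_in_Hom:
  "\<lbrakk>A \<in> Obj C; B \<in> Obj C; f \<in> Hom C A B\<rbrakk> \<Longrightarrow> m_inv (hom_group C A B) f \<in> Hom C A B"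
  using group.inv_closed[OF comm_group.axioms(2)[OF comm_group_hom], of A B]
  by (simp add: hom_group_def)

lemma Add_inv:
  "\<lbrakk>A \<in> Obj C; B \<in> Obj C; f \<in> Hom C A B\<rbrakk> \<Longrightarrow> Add C f (m_inv (hom_group C A B) f) = Zero C A B"
  using group.r_inv[OF comm_group.axioms(2)[OF comm_group_hom], of A B f]
  by (simp add: hom_group_def)

lemma arr_typing [simp]:
  "arrow (Arr A f' B) \<longleftrightarrow> A \<in> Obj C \<and> B \<in> Obj C \<and> f' \<in> Hom C A B"
  "arrow f \<Longrightarrow> Dom f \<in> Obj C" "arrow f \<Longrightarrow> Cod f \<in> Obj C"
  "Dom (g \<odot> f) = Dom f" "Cod (g \<odot> f) = Cod g"
  "Dom (f \<oplus> g) = Dom f" "Cod (f \<oplus> g) = Cod f"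
  "Dom (\<ominus>f) = Dom f" "Cod (\<ominus>f) = Cod f"
  "Dom (nul A B) = A" "Cod (nul A B) = B" "Dom (idn A) = A" "Cod (idn A) = A"
  "\<lbrakk>arrow f; arrow g; Cod f = Dom g\<rbrakk> \<Longrightarrow> arrow (g \<odot> f)"
  "\<lbrakk>arrow f; arrow g; Dom f = Dom g; Cod f = Cod g\<rbrakk> \<Longrightarrow> arrow (f \<oplus> g)"
  "arrow f \<Longrightarrow> arrow (\<ominus>f)"
  "A \<in> Obj C \<Longrightarrow> B \<in> Obj C \<Longrightarrow> arrow (nul A B)"
  "A \<in> Obj C \<Longrightarrow> arrow (idn A)"
  by (auto simp: arr_defs Comp_in_Hom Add_in_Hom inv_in_Hom Zero_in_Hom Ide_in_Hom)

lemma comp_assoc [simp]: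
  "\<lbrakk>arrow f; arrow g; arrow h; Cod f = Dom g; Cod g = Dom h\<rbrakk> \<Longrightarrow> (h \<odot> g) \<odot> f = h \<odot> g \<odot> f"
  by (cases f, cases g, cases h) (auto simp: arr_defs Comp_assoc)

lemma comp_idn [simp]: "\<lbrakk>arrow f; Dom f = A\<rbrakk> \<Longrightarrow> f \<odot> idn A = f"
  by (cases f) (auto simp add: arr_defs Comp_Ide)

lemma idn_comp [simp]: "\<lbrakk>arrow f; Cod f = A\<rbrakk> \<Longrightarrow> idn A \<odot> f = f"
  by (cases f) (auto simp add: arr_defs Ide_Comp)

lemma comp_plus [simp]:
  "\<lbrakk>arrow f; arrow f'; arrow g; Dom f = Dom f'; Cod f = Cod f'; Cod f' = Dom g\<rbrakk>
    \<Longrightarrow> g \<odot> (f \<oplus> f') = g \<odot> f \<oplus> g \<odot> f'"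
  by (cases f, cases f', cases g) (auto simp: arr_defs Comp_Add)

lemma plus_comp [simp]:
  "\<lbrakk>arrow f; arrow g; arrow g'; Dom g = Dom g'; Cod g = Cod g'; Cod f = Dom g'\<rbrakk>
    \<Longrightarrow> (g \<oplus> g') \<odot> f = g \<odot> f \<oplus> g' \<odot> f"
  by (cases f, cases g, cases g') (auto simp: arr_defs Add_Comp)

lemma plus_assoc:
  "\<lbrakk>arrow f; arrow g; arrow h; Dom f = Dom g; Cod f = Cod g; Dom g = Dom h; Cod g = Cod h\<rbrakk>
    \<Longrightarrow> (f \<oplus> g) \<oplus> h = f \<oplus> (g \<oplus> h)"
  by (cases f, cases g, cases h) (auto simp: arr_defs Add_assoc)

lemma plus_commute:
  "\<lbrakk>arrow f; arrow g; Dom f = Dom g; Cod f = Cod g\<rbrakk> \<Longrightarrow> f \<oplus> g = g \<oplus> f"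
  by (cases f, cases g) (auto simp: arr_defs Add_commute)

lemma nul_plus [simp]: "\<lbrakk>arrow f; Dom f = A; Cod f = B\<rbrakk> \<Longrightarrow> nul A B \<oplus> f = f"
  by (cases f) (auto simp add: arr_defs Zero_Add)

lemma plus_nul [simp]: "\<lbrakk>arrow f; Dom f = A; Cod f = B\<rbrakk> \<Longrightarrow> f \<oplus> nul A B = f"
  by (subst plus_commute) auto

lemma plus_neg [simp]: "arrow f \<Longrightarrow> f \<oplus> \<ominus>f = nul (Dom f) (Cod f)"
  by (cases f) (auto simp: arr_defs Add_inv)

lemma neg_plus [simp]: "arrow f \<Longrightarrow> \<ominus>f \<oplus> f = nul (Dom f) (Cod f)"
  by (subst plus_commute) auto

lemma plus_left_cancel:
  assumes "arrow f" "arrow g" "arrow h" "Dom f = Dom g" "Cod f = Cod g" "Dom g = Dom h"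
    "Cod g = Cod h" "f \<oplus> g = f \<oplus> h"
  shows "g = h"
proof -
  have "\<ominus>f \<oplus> f \<oplus> g = \<ominus>f \<oplus> f \<oplus> h"
    using assms by (subst (1 2) plus_assoc) simp_all
  then show ?thesis using assms by simp
qed

lemma plus_self_imp_nul:
  assumes "arrow f" "f \<oplus> f = f" shows "f = nul (Dom f) (Cod f)"
  using assms by (intro plus_left_cancel[of f f "nul (Dom f) (Cod f)"]) auto

lemma neg_unique:
  assumes "arrow f" "arrow g" "Dom f = Dom g" "Cod f = Cod g" "f \<oplus> g = nul (Dom f) (Cod f)"
  shows "g = \<ominus>f"
  using assms by (intro plus_left_cancel[of f g "\<ominus>f"]) auto

text \<open>By bilinearity the composite equals its own double, and only zero does.\<close>

lemma comp_nul [simp]: "\<lbrakk>arrow g; Dom g = B; A \<in> Obj C\<rbrakk> \<Longrightarrow> g \<odot> nul A B = nul A (Cod g)"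
  using plus_self_imp_nul[of "g \<odot> nul A B"] comp_plus[of "nul A B" "nul A B" g, symmetric]
  by auto

lemma nul_comp [simp]: "\<lbrakk>arrow f; Cod f = A; B \<in> Obj C\<rbrakk> \<Longrightarrow> nul A B \<odot> f = nul (Dom f) B"
  using plus_self_imp_nul[of "nul A B \<odot> f"] plus_comp[of f "nul A B" "nul A B", symmetric]
  by auto

lemma comp_neg [simp]: "\<lbrakk>arrow g; arrow f; Cod f = Dom g\<rbrakk> \<Longrightarrow> g \<odot> \<ominus>f = \<ominus>(g \<odot> f)"
  using comp_plus[of f "\<ominus>f" g] by (intro neg_unique) (auto simp del: comp_plus)

lemma neg_comp [simp]: "\<lbrakk>arrow g; arrow f; Cod f = Dom g\<rbrakk> \<Longrightarrow> (\<ominus>g) \<odot> f = \<ominus>(g \<odot> f)"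
  using plus_comp[of f g "\<ominus>g"] by (intro neg_unique) (auto simp del: plus_comp)

lemma neg_nul [simp]: "A \<in> Obj C \<Longrightarrow> B \<in> Obj C \<Longrightarrow> \<ominus>(nul A B) = nul A B"
  by (rule neg_unique[symmetric]) auto

lemma neg_neg [simp]: "arrow f \<Longrightarrow> \<ominus>(\<ominus>f) = f"
  by (rule neg_unique[symmetric]) auto

lemma neg_eq_nul_iff [simp]:
  assumes "arrow f" "Dom f = A" "Cod f = B"
  shows "\<ominus>f = nul A B \<longleftrightarrow> f = nul A B"
  using assms by (metis arr_typing(2,3) neg_neg neg_nul)

lemma eq_neg_iff:
  assumes "arrow f" "arrow g" "Dom f = Dom g" "Cod f = Cod g"
  shows "f \<oplus> \<ominus>g = nul (Dom f) (Cod f) \<longleftrightarrow> f = g"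
  using assms neg_unique[of f "\<ominus>g"] neg_neg by (metis arr_typing(8,9,16) plus_neg)

text \<open>Simplification nests composites to the right, which hides \<open>g \<odot> f\<close>
  inside \<open>g \<odot> f \<odot> x\<close>. Applied with \<open>THEN\<close>, this turns an
  equation for a composite into a rewrite rule that fires there.\<close>

lemma reassoc:
  assumes "g \<odot> f = k" "arrow g" "arrow f" "arrow x" "Cod f = Dom g" "Cod x = Dom f"
  shows "g \<odot> f \<odot> x = k \<odot> x"
  using assms comp_assoc[of x f g] by simp

text \<open>Cancellation is encoded as having trivial kernel, which is what gets checked in
  practice; \<open>mono_cancel\<close> recovers the usual form by subtraction. The same goes for
  \<open>epi\<close>.\<close>

definition mono :: "('o, 'm) arr \<Rightarrow> bool" where
  "mono f \<longleftrightarrow> arrow f \<and> (\<forall>x. arrow x \<and> Cod x = Dom f \<and> f \<odot> x = nul (Dom x) (Cod f)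
     \<longrightarrow> x = nul (Dom x) (Dom f))"

definition epi :: "('o, 'm) arr \<Rightarrow> bool" where
  "epi f \<longleftrightarrow> arrow f \<and> (\<forall>x. arrow x \<and> Dom x = Cod f \<and> x \<odot> f = nul (Dom f) (Cod x)
     \<longrightarrow> x = nul (Cod f) (Cod x))"

lemma monoD: "\<lbrakk>mono f; arrow x; Cod x = Dom f; f \<odot> x = nul (Dom x) (Cod f)\<rbrakk>
    \<Longrightarrow> x = nul (Dom x) (Dom f)"
  unfolding mono_def by blast

lemma epiD: "\<lbrakk>epi f; arrow x; Dom x = Cod f; x \<odot> f = nul (Dom f) (Cod x)\<rbrakk>
    \<Longrightarrow> x = nul (Cod f) (Cod x)"
  unfolding epi_def by blast

lemma mono_cancel:
  assumes "mono f" "arrow x" "arrow y" "Cod x = Dom f" "Cod y = Dom f" "Dom x = Dom y"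
    "f \<odot> x = f \<odot> y"
  shows "x = y"
proof -
  have "x \<oplus> \<ominus>y = nul (Dom x) (Dom f)"
    using assms monoD[of f "x \<oplus> \<ominus>y"] by (auto simp: mono_def)
  then show ?thesis using assms eq_neg_iff[of x y] by auto
qed

lemma epi_cancel:
  assumes "epi f" "arrow x" "arrow y" "Dom x = Cod f" "Dom y = Cod f" "Cod x = Cod y"
    "x \<odot> f = y \<odot> f"
  shows "x = y"
proof -
  have "x \<oplus> \<ominus>y = nul (Cod f) (Cod x)"
    using assms epiD[of f "x \<oplus> \<ominus>y"] by (auto simp: epi_def)
  then show ?thesis using assms eq_neg_iff[of x y] by auto
qed

lemma is_mono_iff: "\<lbrakk>A \<in> Obj C; B \<in> Obj C\<rbrakk> \<Longrightarrow> is_mono C A B f \<longleftrightarrow> mono (Arr A f B)"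
proof
  assume AB: "A \<in> Obj C" "B \<in> Obj C" and m: "is_mono C A B f"
  show "mono (Arr A f B)" unfolding mono_def
  proof (intro conjI allI impI)
    show "arrow (Arr A f B)" using m AB by (simp add: is_mono_def)
    fix x assume x: "arrow x \<and> Cod x = Dom (Arr A f B) \<and> (Arr A f B) \<odot> x = nul (Dom x) (Cod (Arr A f B))"
    obtain T x' S where [simp]: "x = (Arr T x' S)" by (cases x)
    have T: "T \<in> Obj C" "x' \<in> Hom C T A" "S = A" and e: "f \<cdot> x' = Zero C T B"
      using x by (auto simp: comp_def nul_def)
    have "(Arr A f B) \<odot> nul T A = nul T B" using AB T m by (auto simp: is_mono_def)
    then have "f \<cdot> Zero C T A = Zero C T B" by (simp add: comp_def nul_def)
    then have "x' = Zero C T A" using m T AB e Zero_in_Hom unfolding is_mono_def by metis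
    then show "x = nul (Dom x) (Dom (Arr A f B))" using T by (simp add: nul_def)
  qed
next
  assume AB: "A \<in> Obj C" "B \<in> Obj C" and m: "mono (Arr A f B)"
  show "is_mono C A B f" unfolding is_mono_def
  proof (intro conjI ballI impI)
    show "f \<in> Hom C A B" using m by (simp add: mono_def)
    fix T g h assume gh: "T \<in> Obj C" "g \<in> Hom C T A" "h \<in> Hom C T A" "f \<cdot> g = f \<cdot> h"
    have "(Arr T g A) = (Arr T h A)"
      by (rule mono_cancel[OF m]) (use AB gh in \<open>simp_all add: comp_def\<close>)
    then show "g = h" by simp
  qed
qed

lemma is_epi_iff: "\<lbrakk>A \<in> Obj C; B \<in> Obj C\<rbrakk> \<Longrightarrow> is_epi C A B f \<longleftrightarrow> epi (Arr A f B)"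
proof
  assume AB: "A \<in> Obj C" "B \<in> Obj C" and m: "is_epi C A B f"
  show "epi (Arr A f B)" unfolding epi_def
  proof (intro conjI allI impI)
    show "arrow (Arr A f B)" using m AB by (simp add: is_epi_def)
    fix x assume x: "arrow x \<and> Dom x = Cod (Arr A f B) \<and> x \<odot> (Arr A f B) = nul (Dom (Arr A f B)) (Cod x)"
    obtain S x' T where [simp]: "x = (Arr S x' T)" by (cases x)
    have T: "T \<in> Obj C" "x' \<in> Hom C B T" "S = B" and e: "x' \<cdot> f = Zero C A T"
      using x by (auto simp: comp_def nul_def)
    have "nul B T \<odot> (Arr A f B) = nul A T" using AB T m by (auto simp: is_epi_def)
    then have "Zero C B T \<cdot> f = Zero C A T" by (simp add: comp_def nul_def)
    then have "x' = Zero C B T" using m T AB e Zero_in_Hom unfolding is_epi_def by metis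
    then show "x = nul (Cod (Arr A f B)) (Cod x)" using T by (simp add: nul_def)
  qed
next
  assume AB: "A \<in> Obj C" "B \<in> Obj C" and m: "epi (Arr A f B)"
  show "is_epi C A B f" unfolding is_epi_def
  proof (intro conjI ballI impI)
    show "f \<in> Hom C A B" using m by (simp add: epi_def)
    fix T g h assume gh: "T \<in> Obj C" "g \<in> Hom C B T" "h \<in> Hom C B T" "g \<cdot> f = h \<cdot> f"
    have "(Arr B g T) = (Arr B h T)"
      by (rule epi_cancel[OF m]) (use AB gh in \<open>simp_all add: comp_def\<close>)
    then show "g = h" by simp
  qed
qed

text \<open>Uniqueness of the factorization is carried by \<open>mono k\<close>, so only its
  existence is demanded.\<close>

definition kernel :: "('o, 'm) arr \<Rightarrow> ('o, 'm) arr \<Rightarrow> bool" where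
  "kernel f k \<longleftrightarrow> arrow f \<and> mono k \<and> Cod k = Dom f \<and> f \<odot> k = nul (Dom k) (Cod f) \<and>
     (\<forall>t. arrow t \<and> Cod t = Dom f \<and> f \<odot> t = nul (Dom t) (Cod f) \<longrightarrow>
       (\<exists>u. arrow u \<and> Dom u = Dom t \<and> Cod u = Dom k \<and> k \<odot> u = t))"

definition cokernel :: "('o, 'm) arr \<Rightarrow> ('o, 'm) arr \<Rightarrow> bool" where
  "cokernel f q \<longleftrightarrow> arrow f \<and> epi q \<and> Dom q = Cod f \<and> q \<odot> f = nul (Dom f) (Cod q) \<and>
     (\<forall>t. arrow t \<and> Dom t = Cod f \<and> t \<odot> f = nul (Dom f) (Cod t) \<longrightarrow>
       (\<exists>u. arrow u \<and> Dom u = Cod q \<and> Cod u = Cod t \<and> u \<odot> q = t))"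

definition ses :: "('o, 'm) arr \<Rightarrow> ('o, 'm) arr \<Rightarrow> bool" where
  "ses f g \<longleftrightarrow> kernel g f \<and> cokernel f g"

lemma kernelD:
  assumes "kernel f k"
  shows "arrow f" "arrow k" "mono k" "Cod k = Dom f" "f \<odot> k = nul (Dom k) (Cod f)"
  using assms by (auto simp: kernel_def mono_def)

lemma kernel_lift:
  assumes "kernel f k" "arrow t" "Cod t = Dom f" "f \<odot> t = nul (Dom t) (Cod f)"
  obtains u where "arrow u" "Dom u = Dom t" "Cod u = Dom k" "k \<odot> u = t"
  using assms unfolding kernel_def by blast

lemma cokernelD:
  assumes "cokernel f q"
  shows "arrow f" "arrow q" "epi q" "Dom q = Cod f" "q \<odot> f = nul (Dom f) (Cod q)"
  using assms by (auto simp: cokernel_def epi_def)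

lemma cokernel_lift:
  assumes "cokernel f q" "arrow t" "Dom t = Cod f" "t \<odot> f = nul (Dom f) (Cod t)"
  obtains u where "arrow u" "Dom u = Cod q" "Cod u = Cod t" "u \<odot> q = t"
  using assms unfolding cokernel_def by blast

text \<open>Two morphisms with the same composite with \<open>k\<close> are both the unique
  factorization of that composite; this is how the universal property makes \<open>k\<close>
  mono.\<close>

lemma is_kernel_iff:
  assumes AB: "A \<in> Obj C" "B \<in> Obj C"
  shows "is_kernel C A B f K k \<longleftrightarrow> kernel (Arr A f B) (Arr K k A)"
proof
  assume k: "is_kernel C A B f K k"
  then have ty: "f \<in> Hom C A B" "K \<in> Obj C" "k \<in> Hom C K A" "f \<cdot> k = Zero C K B"
    by (auto simp: is_kernel_def)
  have fk: "(Arr A f B) \<odot> (Arr K k A) = nul K B" using ty by (simp add: comp_def nul_def)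
  have "is_mono C K A k" unfolding is_mono_def
  proof (intro conjI ballI impI)
    fix T g h assume g: "T \<in> Obj C" "g \<in> Hom C T K" "h \<in> Hom C T K" "k \<cdot> g = k \<cdot> h"
    have "(Arr A f B) \<odot> (Arr K k A) \<odot> (Arr T g K) = nul T B"
      using reassoc[OF fk, of "(Arr T g K)"] g AB ty by simp
    then have "f \<cdot> (k \<cdot> g) = Zero C T B" by (simp add: comp_def nul_def)
    moreover have "k \<cdot> g \<in> Hom C T A" using AB g ty Comp_in_Hom by blast
    ultimately show "g = h" using k g unfolding is_kernel_def by metis
  qed (fact ty)
  then have "mono (Arr K k A)" using is_mono_iff AB ty by simp
  moreover have "\<exists>u. arrow u \<and> Dom u = Dom t \<and> Cod u = K \<and> (Arr K k A) \<odot> u = t"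
    if t: "arrow t" "Cod t = A" "(Arr A f B) \<odot> t = nul (Dom t) B" for t
  proof -
    obtain T t' where [simp]: "t = (Arr T t' A)" using t(2) by (cases t) auto
    have "f \<cdot> t' = Zero C T B" using t by (simp add: comp_def nul_def)
    then obtain u where "u \<in> Hom C T K" "k \<cdot> u = t'" using k t unfolding is_kernel_def by simp metis
    then show ?thesis using t ty by (intro exI[of _ "(Arr T u K)"]) (auto simp: comp_def)
  qed
  ultimately show "kernel (Arr A f B) (Arr K k A)" using ty AB fk by (auto simp: kernel_def)
next
  assume k: "kernel (Arr A f B) (Arr K k A)"
  have ty: "K \<in> Obj C" "k \<in> Hom C K A" "f \<in> Hom C A B" "f \<cdot> k = Zero C K B"
    using kernelD[OF k] by (auto simp: comp_def nul_def)
  have "\<exists>!u. u \<in> Hom C T K \<and> k \<cdot> u = t"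
    if t: "T \<in> Obj C" "t \<in> Hom C T A" "f \<cdot> t = Zero C T B" for T t
  proof -
    obtain u where u: "arrow u" "Dom u = T" "Cod u = K" "(Arr K k A) \<odot> u = (Arr T t A)"
      using kernel_lift[OF k, of "(Arr T t A)"] t AB by (auto simp: comp_def nul_def)
    obtain u' where [simp]: "u = (Arr T u' K)" using u by (cases u) auto
    have "is_mono C K A k" using kernelD(3)[OF k] is_mono_iff ty AB by simp
    then show ?thesis using u t unfolding is_mono_def
      by (intro ex1I[of _ u']) (auto simp: comp_def)
  qed
  then show "is_kernel C A B f K k" using ty by (simp add: is_kernel_def)
qed

lemma is_cokernel_iff:
  assumes AB: "A \<in> Obj C" "B \<in> Obj C"
  shows "is_cokernel C A B f K k \<longleftrightarrow> cokernel (Arr A f B) (Arr B k K)"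
proof
  assume k: "is_cokernel C A B f K k"
  then have ty: "f \<in> Hom C A B" "K \<in> Obj C" "k \<in> Hom C B K" "k \<cdot> f = Zero C A K"
    by (auto simp: is_cokernel_def)
  have fk: "(Arr B k K) \<odot> (Arr A f B) = nul A K" using ty by (simp add: comp_def nul_def)
  have "is_epi C B K k" unfolding is_epi_def
  proof (intro conjI ballI impI)
    fix T g h assume g: "T \<in> Obj C" "g \<in> Hom C K T" "h \<in> Hom C K T" "g \<cdot> k = h \<cdot> k"
    have "((Arr K g T) \<odot> (Arr B k K)) \<odot> (Arr A f B) = nul A T"
      using fk g AB ty by simp
    then have "(g \<cdot> k) \<cdot> f = Zero C A T" by (simp add: comp_def nul_def)
    moreover have "g \<cdot> k \<in> Hom C B T" using AB g ty Comp_in_Hom by blast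
    ultimately show "g = h" using k g unfolding is_cokernel_def by metis
  qed (fact ty)
  then have "epi (Arr B k K)" using is_epi_iff AB ty by simp
  moreover have "\<exists>u. arrow u \<and> Dom u = K \<and> Cod u = Cod t \<and> u \<odot> (Arr B k K) = t"
    if t: "arrow t" "Dom t = B" "t \<odot> (Arr A f B) = nul A (Cod t)" for t
  proof -
    obtain T t' where [simp]: "t = (Arr B t' T)" using t(2) by (cases t) auto
    have "t' \<cdot> f = Zero C A T" using t by (simp add: comp_def nul_def)
    then obtain u where "u \<in> Hom C K T" "u \<cdot> k = t'" using k t unfolding is_cokernel_def by simp metis
    then show ?thesis using t ty by (intro exI[of _ "(Arr K u T)"]) (auto simp: comp_def)
  qed
  ultimately show "cokernel (Arr A f B) (Arr B k K)" using ty AB fk by (auto simp: cokernel_def)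
next
  assume k: "cokernel (Arr A f B) (Arr B k K)"
  have ty: "K \<in> Obj C" "k \<in> Hom C B K" "f \<in> Hom C A B" "k \<cdot> f = Zero C A K"
    using cokernelD[OF k] by (auto simp: comp_def nul_def)
  have "\<exists>!u. u \<in> Hom C K T \<and> u \<cdot> k = t"
    if t: "T \<in> Obj C" "t \<in> Hom C B T" "t \<cdot> f = Zero C A T" for T t
  proof -
    obtain u where u: "arrow u" "Dom u = K" "Cod u = T" "u \<odot> (Arr B k K) = (Arr B t T)"
      using cokernel_lift[OF k, of "(Arr B t T)"] t AB by (auto simp: comp_def nul_def)
    obtain u' where [simp]: "u = (Arr K u' T)" using u by (cases u) auto
    have "is_epi C B K k" using cokernelD(3)[OF k] is_epi_iff ty AB by simp
    then show ?thesis using u t unfolding is_epi_def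
      by (intro ex1I[of _ u']) (auto simp: comp_def)
  qed
  then show "is_cokernel C A B f K k" using ty by (simp add: is_cokernel_def)
qed

lemma short_exact_iff:
  "short_exact C A B D f g \<longleftrightarrow> ses (Arr A f B) (Arr B g D)"
  using is_kernel_iff[of B D g A f] is_cokernel_iff[of A B f D g] kernelD[of "(Arr B g D)" "(Arr A f B)"]
  by (auto simp: short_exact_def ses_def)

end

section \<open>Short exact sequences and vanishing of Ext\<close>

text \<open>Only \<open>Hom\<close>, \<open>Comp\<close> and \<open>Zero\<close> swap arguments.
  Objects and raw morphisms stay the same, so a result about the opposite category reads back by
  simplification.\<close>

definition opposite :: "('o, 'm) precat \<Rightarrow> ('o, 'm) precat" where
  "opposite C = \<lparr>Obj = Obj C, Hom = (\<lambda>A B. Hom C B A), Ide = Ide C, Comp = (\<lambda>g f. f \<cdot>\<^bsub>C\<^esub> g),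
     Add = Add C, Zero = (\<lambda>A B. Zero C B A)\<rparr>"

lemma op_simps [simp]:
  "Obj (opposite C) = Obj C" "Hom (opposite C) A B = Hom C B A" "Ide (opposite C) = Ide C"
  "g \<cdot>\<^bsub>opposite C\<^esub> f = f \<cdot>\<^bsub>C\<^esub> g" "Add (opposite C) = Add C" "Zero (opposite C) A B = Zero C B A"
  by (simp_all add: opposite_def)

lemma op_dual [simp]:
  "is_zero_object (opposite C) Z = is_zero_object C Z"
  "is_mono (opposite C) A B f = is_epi C B A f"
  "is_epi (opposite C) A B f = is_mono C B A f"
  "is_kernel (opposite C) A B f K k = is_cokernel C B A f K k"
  "is_cokernel (opposite C) A B f K k = is_kernel C B A f K k"
  by (auto simp: is_zero_object_def is_mono_def is_epi_def is_kernel_def is_cokernel_def)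

lemma short_exact_op [simp]: "short_exact (opposite C) A B D f g = short_exact C D B A g f"
  by (auto simp: short_exact_def)

lemma has_biproduct_op: "has_biproduct (opposite C) A B = has_biproduct C A B"
  unfolding has_biproduct_def op_simps by blast

lemma (in preadditive_category) preadditive_op: "preadditive_category (opposite C)"
proof -
  have "hom_group (opposite C) A B = hom_group C B A" for A B
    by (simp add: hom_group_def)
  then show ?thesis
    by (intro preadditive_category.intro)
      (auto simp: Ide_in_Hom Comp_in_Hom Comp_Ide Ide_Comp Comp_assoc comm_group_hom Comp_Add Add_Comp)
qed

lemma (in abelian_category) abelian_op: "abelian_category (opposite C)"
proof -
  interpret opp: preadditive_category "opposite C" by (rule preadditive_op)
  show ?thesis
  proof
    show "\<exists>Z. is_zero_object (opposite C) Z" using ex_zero_object by simp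
    fix A B f assume A: "A \<in> Obj (opposite C)" "B \<in> Obj (opposite C)"
    show "has_biproduct (opposite C) A B" using A ex_biproduct by (simp add: has_biproduct_op)
    show "\<exists>K k. is_kernel (opposite C) A B f K k" if "f \<in> Hom (opposite C) A B"
      using A that ex_cokernel by simp
    show "\<exists>K k. is_cokernel (opposite C) A B f K k" if "f \<in> Hom (opposite C) A B"
      using A that ex_kernel by simp
    show "\<exists>D g. D \<in> Obj (opposite C) \<and> is_kernel (opposite C) B D g A f" if "is_mono (opposite C) A B f"
      using A that epi_normal by simp
    show "\<exists>D g. D \<in> Obj (opposite C) \<and> is_cokernel (opposite C) D A g B f" if "is_epi (opposite C) A B f"
      using A that mono_normal by simp
  qed
qed

text \<open>The form in which Ext is handled throughout, free of the quotient by equivalence of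
  extensions; \<open>Ext1_trivial_iff\<close> links it to \<open>Ext1\<close>.\<close>

definition ext_vanishes :: "('o, 'm) precat \<Rightarrow> 'o \<Rightarrow> 'o \<Rightarrow> bool" where
  "ext_vanishes C X Y \<longleftrightarrow>
     (\<forall>E f g. short_exact C Y E X f g \<longrightarrow> (\<exists>s\<in>Hom C X E. g \<cdot>\<^bsub>C\<^esub> s = Ide C X))"

context abelian_category
begin

lemma kernel_exists:
  assumes "arrow f" obtains k where "kernel f k"
proof -
  obtain A f' B where [simp]: "f = (Arr A f' B)" by (cases f)
  show thesis using ex_kernel[of A B f'] assms that by (auto simp: is_kernel_iff)
qed

lemma cokernel_exists:
  assumes "arrow f" obtains q where "cokernel f q"
proof -
  obtain A f' B where [simp]: "f = (Arr A f' B)" by (cases f)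
  show thesis using ex_cokernel[of A B f'] assms that by (auto simp: is_cokernel_iff)
qed

lemma mono_imp_kernel:
  assumes "mono f" obtains g where "kernel g f"
proof -
  obtain A f' B where [simp]: "f = (Arr A f' B)" by (cases f)
  have "A \<in> Obj C" "B \<in> Obj C" using assms by (auto simp: mono_def)
  then show thesis using mono_normal[of A B f'] assms that by (auto simp: is_kernel_iff is_mono_iff)
qed

lemma epi_imp_cokernel:
  assumes "epi f" obtains g where "cokernel g f"
proof -
  obtain A f' B where [simp]: "f = (Arr A f' B)" by (cases f)
  have "A \<in> Obj C" "B \<in> Obj C" using assms by (auto simp: epi_def)
  then show thesis using epi_normal[of A B f'] assms that by (auto simp: is_cokernel_iff is_epi_iff)
qed

text \<open>An epi is the cokernel of some \<open>g\<close>, and \<open>g\<close> factors through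
  the kernel \<open>k\<close>. Hence whatever kills \<open>k\<close> also kills \<open>g\<close> and
  descends along \<open>f\<close>.\<close>

lemma epi_kernel_ses:
  assumes f: "epi f" and k: "kernel f k"
  shows "ses k f"
proof -
  obtain g where g: "cokernel g f" using epi_imp_cokernel[OF f] .
  note [simp] = kernelD(1,2,4,5)[OF k] cokernelD(1,4,5)[OF g]
  obtain u where u [simp]: "arrow u" "Dom u = Dom g" "Cod u = Dom k" "k \<odot> u = g"
    using kernel_lift[OF k, of g] by auto
  have "\<exists>v. arrow v \<and> Dom v = Cod f \<and> Cod v = Cod t \<and> v \<odot> f = t"
    if t: "arrow t" "Dom t = Dom f" "t \<odot> k = nul (Dom k) (Cod t)" for t
  proof -
    have "t \<odot> k \<odot> u = nul (Dom g) (Cod t)"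
      using reassoc[OF t(3), of u] t by (simp del: u(4))
    then show ?thesis using cokernel_lift[OF g, of t] t by (metis cokernelD(4) g u(4))
  qed
  then show ?thesis using f k by (simp add: ses_def cokernel_def)
qed

lemma mono_cokernel_ses:
  assumes f: "mono f" and q: "cokernel f q"
  shows "ses f q"
proof -
  obtain g where g: "kernel g f" using mono_imp_kernel[OF f] .
  note [simp] = cokernelD(1,2,4,5)[OF q] kernelD(1,4,5)[OF g]
  obtain u where u [simp]: "arrow u" "Dom u = Cod q" "Cod u = Cod g" "u \<odot> q = g"
    using cokernel_lift[OF q, of g] by auto
  have "\<exists>v. arrow v \<and> Dom v = Dom t \<and> Cod v = Dom f \<and> f \<odot> v = t"
    if t: "arrow t" "Cod t = Cod f" "q \<odot> t = nul (Dom t) (Cod q)" for t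
  proof -
    have "g \<odot> t = nul (Dom t) (Cod g)"
      using reassoc[OF u(4), of t] t by simp
    then show ?thesis using kernel_lift[OF g, of t] t by (metis kernelD(4) g)
  qed
  then show ?thesis using f q by (simp add: ses_def kernel_def)
qed

lemma sesD:
  assumes "ses f g"
  shows "arrow f" "arrow g" "Dom g = Cod f" "g \<odot> f = nul (Dom f) (Cod g)"
    "mono f" "epi g" "kernel g f" "cokernel f g"
  using assms kernelD[of g f] cokernelD[of f g] by (auto simp: ses_def)

definition biproduct where
  "biproduct A B P i j p q \<longleftrightarrow> P \<in> Obj C \<and> arrow i \<and> arrow j \<and> arrow p \<and> arrow q \<and>
     Dom i = A \<and> Cod i = P \<and> Dom j = B \<and> Cod j = P \<and> Dom p = P \<and> Cod p = A \<and> Dom q = P \<and> Cod q = B \<and>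
     p \<odot> i = idn A \<and> q \<odot> j = idn B \<and> p \<odot> j = nul B A \<and> q \<odot> i = nul A B \<and>
     i \<odot> p \<oplus> j \<odot> q = idn P"

lemma biproductD:
  assumes "biproduct A B P i j p q"
  shows "P \<in> Obj C" "arrow i" "arrow j" "arrow p" "arrow q"
    "Dom i = A" "Cod i = P" "Dom j = B" "Cod j = P" "Dom p = P" "Cod p = A" "Dom q = P" "Cod q = B"
    "p \<odot> i = idn A" "q \<odot> j = idn B" "p \<odot> j = nul B A" "q \<odot> i = nul A B"
    "i \<odot> p \<oplus> j \<odot> q = idn P"
  using assms unfolding biproduct_def by blast+

lemma biproduct_exists:
  assumes "A \<in> Obj C" "B \<in> Obj C"
  shows "\<exists>P i j p q. biproduct A B P i j p q"
proof -
  obtain P i j p q where "P\<in>Obj C" "i\<in>Hom C A P" "j\<in>Hom C B P" "p\<in>Hom C P A" "q\<in>Hom C P B"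
    "p \<cdot> i = Ide C A" "q \<cdot> j = Ide C B" "p \<cdot> j = Zero C B A" "q \<cdot> i = Zero C A B"
    "Add C (i \<cdot> p) (j \<cdot> q) = Ide C P"
    using ex_biproduct[OF assms] unfolding has_biproduct_def by blast
  then have "biproduct A B P (Arr A i P) (Arr B j P) (Arr P p A) (Arr P q B)"
    using assms by (simp add: biproduct_def comp_def nul_def idn_def plus_def)
  then show ?thesis by blast
qed

lemma biproduct_ses:
  assumes "biproduct A B P i j p q"
  shows "ses i q"
proof -
  note bp [simp] = biproductD[OF assms]
  have i: "mono i" unfolding mono_def
  proof (intro conjI allI impI)
    fix x assume x: "arrow x \<and> Cod x = Dom i \<and> i \<odot> x = nul (Dom x) (Cod i)"
    then have "(p \<odot> i) \<odot> x = nul (Dom x) A" by (simp del: bp(14))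
    then show "x = nul (Dom x) (Dom i)" using x by simp
  qed simp
  have "epi q" unfolding epi_def
  proof (intro conjI allI impI)
    fix x assume x: "arrow x \<and> Dom x = Cod q \<and> x \<odot> q = nul (Dom q) (Cod x)"
    then have "x \<odot> q \<odot> j = nul B (Cod x)" using reassoc[OF conjunct2[OF conjunct2[OF x]], of j] by simp
    then show "x = nul (Cod q) (Cod x)" using x by simp
  qed simp
  moreover have "kernel q i" unfolding kernel_def
  proof (intro conjI allI impI)
    fix t assume t: "arrow t \<and> Cod t = Dom q \<and> q \<odot> t = nul (Dom t) (Cod q)"
    have "(i \<odot> p \<oplus> j \<odot> q) \<odot> t = t" using t by simp
    then have "i \<odot> p \<odot> t = t" using t by (simp del: bp(18))
    then show "\<exists>u. arrow u \<and> Dom u = Dom t \<and> Cod u = Dom i \<and> i \<odot> u = t"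
      using t by (intro exI[of _ "p \<odot> t"]) simp
  qed (use i in simp_all)
  ultimately show ?thesis by (rule epi_kernel_ses)
qed

text \<open>That the pushed out sequence is again exact on the left rests on \<open>f\<close> being
  mono. The last clause is the existence half of the universal property of the pushout.\<close>

lemma pushout_ses:
  assumes fg: "ses f g" and a: "arrow a" "Dom a = Dom f"
  obtains y h b where "ses y h" "Dom y = Cod a" "Cod h = Cod g"
    "arrow b" "Dom b = Cod f" "Cod b = Cod y" "h \<odot> b = g" "b \<odot> f = y \<odot> a"
    "\<And>v w. \<lbrakk>arrow v; arrow w; Dom v = Cod a; Dom w = Cod f; Cod v = Cod w; v \<odot> a = w \<odot> f\<rbrakk>
       \<Longrightarrow> \<exists>u. arrow u \<and> Dom u = Cod y \<and> Cod u = Cod v \<and> u \<odot> y = v \<and> u \<odot> b = w"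
proof -
  note f [simp] = sesD(1-4)[OF fg] a
  obtain P i j p q where "biproduct (Cod a) (Cod f) P i j p q"
    using biproduct_exists[of "Cod a" "Cod f"] f arr_typing(3) by blast
  note bp [simp] = biproductD(1-17)[OF this] and bp_sum = biproductD(18)[OF this]
  note [simp] = bp(14-17)[THEN reassoc]
  \<comment> \<open>The pushout is the cokernel of \<open>m = (a, -f)\<close> into the
    biproduct.\<close>
  define m where "m = i \<odot> a \<oplus> \<ominus>(j \<odot> f)"
  have m [simp]: "arrow m" "Dom m = Dom f" "Cod m = P" by (simp_all add: m_def)
  have pm: "p \<odot> m = a" and qm: "q \<odot> m = \<ominus>f" by (simp_all add: m_def)
  obtain c where c: "cokernel m c" using cokernel_exists[OF m(1)] .
  define M where "M = Cod c"
  have c' [simp]: "arrow c" "Dom c = P" "Cod c = M" "M \<in> Obj C" "epi c"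
    "c \<odot> m = nul (Dom f) M"
    using cokernelD[OF c] by (auto simp: M_def)
  have cij: "c \<odot> i \<odot> a = c \<odot> j \<odot> f"
    using c'(6) eq_neg_iff[of "c \<odot> i \<odot> a" "c \<odot> j \<odot> f"] by (simp add: m_def)
  have factor: "\<exists>u. arrow u \<and> Dom u = M \<and> Cod u = Cod t \<and> u \<odot> c = t"
    if t: "arrow t" "Dom t = P" "t \<odot> i \<odot> a = t \<odot> j \<odot> f" for t
  proof -
    have "t \<odot> m = nul (Dom f) (Cod t)" using t by (simp add: m_def)
    then show ?thesis using cokernel_lift[OF c, of t] t by (metis c'(3) m(2,3))
  qed
  obtain h where h [simp]: "arrow h" "Dom h = M" "Cod h = Cod g" and hc: "h \<odot> c = g \<odot> q"
    using factor[of "g \<odot> q"] by auto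
  note hc' [simp] = hc reassoc[OF hc]
  \<comment> \<open>The second component of \<open>m\<close> is \<open>-f\<close>, already mono.
    Hence \<open>m\<close> is the kernel of its cokernel \<open>c\<close>.\<close>
  have "mono m" unfolding mono_def
  proof (intro conjI allI impI)
    fix x assume x: "arrow x \<and> Cod x = Dom m \<and> m \<odot> x = nul (Dom x) (Cod m)"
    then have "q \<odot> m \<odot> x = nul (Dom x) (Cod f)" by simp
    then have "\<ominus>(f \<odot> x) = nul (Dom x) (Cod f)" using reassoc[OF qm, of x] x by simp
    then have "f \<odot> x = nul (Dom x) (Cod f)" using x by simp
    then show "x = nul (Dom x) (Dom m)" using monoD[OF sesD(5)[OF fg], of x] x by simp
  qed simp
  then have mc: "kernel c m" using mono_cokernel_ses[OF _ c] sesD(7) by blast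
  \<comment> \<open>If \<open>c \<odot> i\<close> kills \<open>x\<close>, then
    \<open>i \<odot> x\<close> comes from some \<open>z\<close> through \<open>m\<close>. The second
    component forces \<open>f \<odot> z\<close> to vanish, so \<open>z\<close> vanishes, and with it
    \<open>x\<close>.\<close>
  have y: "mono (c \<odot> i)" unfolding mono_def
  proof (intro conjI allI impI)
    fix x assume x: "arrow x \<and> Cod x = Dom (c \<odot> i) \<and> (c \<odot> i) \<odot> x = nul (Dom x) (Cod (c \<odot> i))"
    then obtain z where z: "arrow z" "Dom z = Dom x" "Cod z = Dom f" and mz: "m \<odot> z = i \<odot> x"
      using kernel_lift[OF mc, of "i \<odot> x"] by auto blast
    have "q \<odot> m \<odot> z = nul (Dom x) (Cod f)" using z x by (simp add: mz)
    then have "\<ominus>(f \<odot> z) = nul (Dom z) (Cod f)" using reassoc[OF qm, of z] z x by simp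
    then have "f \<odot> z = nul (Dom z) (Cod f)" using z x by simp
    then have z0: "z = nul (Dom x) (Dom f)" using monoD[OF sesD(5)[OF fg], of z] z x by simp
    have "x = p \<odot> i \<odot> x" using x by simp
    also have "\<dots> = p \<odot> m \<odot> z" by (simp only: mz)
    also have "\<dots> = nul (Dom x) (Cod a)" using x by (simp add: z0)
    finally show "x = nul (Dom x) (Dom (c \<odot> i))" by simp
  qed simp
  have "epi h" unfolding epi_def
  proof (intro conjI allI impI)
    fix x assume x: "arrow x \<and> Dom x = Cod h \<and> x \<odot> h = nul (Dom h) (Cod x)"
    then have "x \<odot> h \<odot> c \<odot> j = nul (Cod f) (Cod x)" using reassoc[OF conjunct2[OF conjunct2[OF x]], of "c \<odot> j"] by simp
    then have "x \<odot> g = nul (Cod f) (Cod x)" using x by simp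
    then show "x = nul (Cod h) (Cod x)" using epiD[OF sesD(6)[OF fg], of x] x by simp
  qed simp
  \<comment> \<open>A morphism killing \<open>c \<odot> i\<close> is determined by its restriction
    along \<open>c \<odot> j\<close>; that restriction kills \<open>f\<close> and so descends along
    \<open>g\<close>.\<close>
  then have coker: "cokernel (c \<odot> i) h" unfolding cokernel_def
  proof (intro conjI allI impI)
    fix t assume "arrow t \<and> Dom t = Cod (c \<odot> i) \<and> t \<odot> c \<odot> i = nul (Dom (c \<odot> i)) (Cod t)"
    then have t: "arrow t" "Dom t = M" and tci: "t \<odot> c \<odot> i = nul (Cod a) (Cod t)" by auto
    have "t \<odot> c \<odot> j \<odot> f = (t \<odot> c \<odot> i) \<odot> a"
      using t cij by (simp del: cij add: cij[symmetric])
    then have "(t \<odot> c \<odot> j) \<odot> f = nul (Dom f) (Cod t)" using t by (simp add: tci)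
    then obtain v where v: "arrow v" "Dom v = Cod g" "Cod v = Cod t" "v \<odot> g = t \<odot> c \<odot> j"
      using cokernel_lift[OF sesD(8)[OF fg], of "t \<odot> c \<odot> j"] t by auto
    have "t \<odot> c = (t \<odot> c) \<odot> (i \<odot> p \<oplus> j \<odot> q)" using t by (simp add: bp_sum)
    also have "\<dots> = (t \<odot> c \<odot> i) \<odot> p \<oplus> (t \<odot> c \<odot> j) \<odot> q" using t by simp
    also have "\<dots> = v \<odot> g \<odot> q" using t v reassoc[OF v(4), of q] by (simp add: tci)
    also have "\<dots> = (v \<odot> h) \<odot> c" using v by simp
    finally have tc: "t \<odot> c = (v \<odot> h) \<odot> c" .
    have "v \<odot> h = t" by (rule epi_cancel[OF c'(5)]) (use t v tc in simp_all)
    then show "\<exists>u. arrow u \<and> Dom u = Cod h \<and> Cod u = Cod t \<and> u \<odot> h = t" using v by auto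
  qed simp_all
  show thesis
  proof (rule that)
    show "ses (c \<odot> i) h" by (rule mono_cokernel_ses[OF y coker])
    show "h \<odot> (c \<odot> j) = g" by simp
    show "(c \<odot> j) \<odot> f = (c \<odot> i) \<odot> a" by (simp add: cij)
    fix v w assume vw: "arrow v" "arrow w" "Dom v = Cod a" "Dom w = Cod f" "Cod v = Cod w"
      "v \<odot> a = w \<odot> f"
    obtain u where u: "arrow u" "Dom u = M" "Cod u = Cod v" and uc: "u \<odot> c = v \<odot> p \<oplus> w \<odot> q"
      using factor[of "v \<odot> p \<oplus> w \<odot> q"] vw by auto
    then show "\<exists>u. arrow u \<and> Dom u = Cod (c \<odot> i) \<and> Cod u = Cod v \<and> u \<odot> (c \<odot> i) = v \<and> u \<odot> (c \<odot> j) = w"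
      using vw by (intro exI[of _ u]) (simp add: reassoc[OF uc])
  qed simp_all
qed

text \<open>The complement of the idempotent \<open>s \<odot> g\<close> is killed by
  \<open>g\<close>, so it factors through \<open>f\<close>; the factor is the retraction.\<close>

lemma retraction_of_section:
  assumes fg: "ses f g" and s: "arrow s" "Dom s = Cod g" "Cod s = Cod f" "g \<odot> s = idn (Cod g)"
  obtains r where "arrow r" "Dom r = Cod f" "Cod r = Dom f" "r \<odot> f = idn (Dom f)"
    "r \<odot> s = nul (Cod g) (Dom f)" "f \<odot> r \<oplus> s \<odot> g = idn (Cod f)"
proof -
  note [simp] = sesD(1-4)[OF fg] sesD(4)[OF fg, THEN reassoc] s s(4)[THEN reassoc]
  define e where "e = idn (Cod f) \<oplus> \<ominus>(s \<odot> g)"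
  have e [simp]: "arrow e" "Dom e = Cod f" "Cod e = Cod f" "g \<odot> e = nul (Cod f) (Cod g)"
    by (simp_all add: e_def)
  obtain r where r [simp]: "arrow r" "Dom r = Cod f" "Cod r = Dom f" and fr: "f \<odot> r = e"
    using kernel_lift[OF sesD(7)[OF fg], of e] by auto
  note [simp] = fr reassoc[OF fr]
  show thesis
  proof (rule that)
    show "r \<odot> f = idn (Dom f)"
      by (rule mono_cancel[OF sesD(5)[OF fg]]) (simp_all add: e_def)
    show "r \<odot> s = nul (Cod g) (Dom f)"
      by (rule mono_cancel[OF sesD(5)[OF fg]]) (simp_all add: e_def)
    show "f \<odot> r \<oplus> s \<odot> g = idn (Cod f)"
      by (simp add: e_def plus_assoc)
  qed simp_all
qed

lemma ext_vanishesD: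
  assumes "ext_vanishes C X Y" "ses f g" "Dom f = Y" "Cod g = X"
  obtains s where "arrow s" "Dom s = Cod g" "Cod s = Cod f" "g \<odot> s = idn (Cod g)"
proof -
  note ses = sesD(1-3)[OF assms(2)]
  obtain f' E where [simp]: "f = (Arr Y f' E)" using assms(3) by (cases f) auto
  obtain g' where [simp]: "g = (Arr E g' X)" using assms(4) ses by (cases g) auto
  obtain s where "s\<in>Hom C X E" "g' \<cdot> s = Ide C X"
    using assms(1,2) unfolding ext_vanishes_def short_exact_iff by auto blast
  then show thesis using ses by (intro that[of "(Arr X s E)"]) (auto simp: comp_def idn_def)
qed

text \<open>The pushout of the sequence along \<open>a\<close> splits, and its retraction composed
  with \<open>b\<close> restricts to \<open>a\<close>.\<close>

lemma extend_along_mono: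
  assumes fg: "ses f g" and a: "arrow a" "Dom a = Dom f" and ext: "ext_vanishes C (Cod g) (Cod a)"
  obtains r where "arrow r" "Dom r = Cod f" "Cod r = Cod a" "r \<odot> f = a"
proof -
  obtain y h b where yh: "ses y h" "Dom y = Cod a" "Cod h = Cod g"
    "arrow b" "Dom b = Cod f" "Cod b = Cod y" "b \<odot> f = y \<odot> a"
    using pushout_ses[OF fg a] by metis
  obtain s where s: "arrow s" "Dom s = Cod h" "Cod s = Cod y" "h \<odot> s = idn (Cod h)"
    using ext_vanishesD[OF ext yh(1-3)] .
  obtain r where r: "arrow r" "Dom r = Cod y" "Cod r = Dom y" "r \<odot> y = idn (Dom y)"
    using retraction_of_section[OF yh(1) s] .
  show thesis
  proof (rule that)
    show "(r \<odot> b) \<odot> f = a"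
      using r yh a sesD[OF fg] sesD[OF yh(1)] by (simp add: reassoc[OF r(4)])
  qed (use r yh in simp_all)
qed

text \<open>A section of the reversed sequence is a retraction of the original one, supplied by
  \<open>retraction_of_section\<close>.\<close>

lemma ext_vanishes_op: 
  assumes ext: "ext_vanishes C X Y" shows "ext_vanishes (opposite C) Y X"
  unfolding ext_vanishes_def
proof (intro allI impI)
  fix E f g assume "short_exact (opposite C) X E Y f g"
  then have gf: "ses (Arr Y g E) (Arr E f X)" by (simp add: short_exact_iff)
  obtain s where s: "arrow s" "Dom s = X" "Cod s = E" "(Arr E f X) \<odot> s = idn X"
    using ext_vanishesD[OF ext gf] by auto
  obtain r where r: "arrow r" "Dom r = E" "Cod r = Y" "r \<odot> (Arr Y g E) = idn Y"
    using retraction_of_section[OF gf, of s] s unfolding arr.sel(1,3) by metis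
  obtain r' where [simp]: "r = (Arr E r' Y)" using r by (cases r) auto
  show "\<exists>s\<in>Hom (opposite C) Y E. g \<cdot>\<^bsub>opposite C\<^esub> s = Ide (opposite C) Y"
    using r by (intro bexI[of _ r']) (simp_all add: comp_def idn_def)
qed

text \<open>Phrased with raw morphisms, because these are shared with the opposite category, whereas
  \<open>Dom\<close> and \<open>Cod\<close> of a typed morphism are exchanged there. This is what
  allows \<open>lift_Hom\<close> to follow by duality.\<close>

lemma extend_Hom:
  assumes "short_exact C A E X f g" "Y \<in> Obj C" "a \<in> Hom C A Y" "ext_vanishes C X Y"
  obtains r where "r \<in> Hom C E Y" "r \<cdot> f = a"
proof -
  have fg: "ses (Arr A f E) (Arr E g X)" and "A \<in> Obj C"
    using assms(1) by (simp_all add: short_exact_iff[symmetric]) (simp add: short_exact_def)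
  then obtain r where "arrow r" "Dom r = E" "Cod r = Y" "r \<odot> (Arr A f E) = (Arr A a Y)"
    using extend_along_mono[OF fg, of "(Arr A a Y)"] assms by auto
  then show thesis by (cases r) (auto simp: comp_def intro: that)
qed

lemma lift_Hom:
  assumes "short_exact C Y E A f g" "X \<in> Obj C" "a \<in> Hom C X A" "ext_vanishes C X Y"
  obtains r where "r \<in> Hom C X E" "g \<cdot> r = a"
proof -
  interpret opp: abelian_category "opposite C" by (rule abelian_op)
  show thesis
    using opp.extend_Hom[of A E Y g f X a] assms ext_vanishes_op that by auto
qed

lemma lift_along_epi:
  assumes fg: "ses f g" and a: "arrow a" "Cod a = Cod g" and ext: "ext_vanishes C (Dom a) (Dom f)"
  obtains r where "arrow r" "Dom r = Dom a" "Cod r = Dom g" "g \<odot> r = a"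
proof -
  obtain Y f' E where f: "f = (Arr Y f' E)" by (cases f)
  obtain g' A where g: "g = (Arr E g' A)" using sesD(3)[OF fg] f by (cases g) auto
  obtain X a' where a': "a = (Arr X a' A)" using a g by (cases a) auto
  obtain r where "r \<in> Hom C X E" "g' \<cdot> r = a'"
    using lift_Hom[of Y E A f' g' X a'] fg ext a unfolding short_exact_iff f g a' by auto
  then show thesis using a sesD[OF fg] by (intro that[of "(Arr X r E)"]) (simp_all add: f g a' comp_def)
qed

text \<open>Given \<open>0 \<rightarrow> F \<rightarrow> E \<rightarrow> A \<rightarrow> 0\<close> and \<open>u : E \<rightarrow> P\<close> restricting to an epimorphism on \<open>F\<close>, the
  kernel of \<open>u\<close> is an extension of \<open>A\<close> by the kernel of this restriction.\<close>

lemma section_into_kernel: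
  assumes fg: "ses f g" and u: "arrow u" "Dom u = Cod f" and uf: "ses k (u \<odot> f)"
    and ext: "ext_vanishes C (Cod g) (Dom k)"
  obtains s where "arrow s" "Dom s = Cod g" "Cod s = Cod f" "g \<odot> s = idn (Cod g)"
    "u \<odot> s = nul (Cod g) (Cod u)"
proof -
  note [simp] = sesD(1-4)[OF fg] u 
  have k [simp]: "arrow k" "Cod k = Dom f" "u \<odot> f \<odot> k = nul (Dom k) (Cod u)"
    using sesD(1-4)[OF uf] by auto
  have "epi u" unfolding epi_def
  proof (intro conjI allI impI)
    fix x assume x: "arrow x \<and> Dom x = Cod u \<and> x \<odot> u = nul (Dom u) (Cod x)"
    then have "x \<odot> (u \<odot> f) = nul (Dom f) (Cod x)" using reassoc[OF conjunct2[OF conjunct2[OF x]], of f] by simp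
    then show "x = nul (Cod u) (Cod x)" using epiD[OF sesD(6)[OF uf], of x] x by simp
  qed simp
  obtain l where l: "kernel u l" using kernel_exists[OF u(1)] .
  have ul: "ses l u" by (rule epi_kernel_ses[OF \<open>epi u\<close> l])
  have [simp]: "arrow l" "Cod l = Cod f" and ul0 [simp]: "u \<odot> l = nul (Dom l) (Cod u)"
    using sesD(1-4)[OF ul] by auto
  \<comment> \<open>If \<open>t\<close> kills \<open>g \<odot> l\<close>, then
    \<open>t \<odot> g\<close> factors through \<open>u\<close> as \<open>v \<odot> u\<close>. As
    \<open>v\<close> kills the epi \<open>u \<odot> f\<close>, it vanishes, hence so does
    \<open>t\<close>.\<close>
  have epi: "epi (g \<odot> l)" unfolding epi_def
  proof (intro conjI allI impI)
    fix t assume t: "arrow t \<and> Dom t = Cod (g \<odot> l) \<and> t \<odot> (g \<odot> l) = nul (Dom (g \<odot> l)) (Cod t)"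
    then obtain v where v: "arrow v" "Dom v = Cod u" "Cod v = Cod t" "v \<odot> u = t \<odot> g"
      using cokernel_lift[OF sesD(8)[OF ul], of "t \<odot> g"] by auto
    have "v \<odot> (u \<odot> f) = nul (Dom f) (Cod v)" using reassoc[OF v(4), of f] v t by simp
    then have "v = nul (Cod u) (Cod v)" using epiD[OF sesD(6)[OF uf], of v] v by simp
    then have "t \<odot> g = nul (Dom g) (Cod t)" using v t nul_comp[of u "Cod u" "Cod v"] by simp
    then show "t = nul (Cod (g \<odot> l)) (Cod t)" using epiD[OF sesD(6)[OF fg], of t] t by simp
  qed simp
  obtain k' where k' [simp]: "arrow k'" "Dom k' = Dom k" "Cod k' = Dom l" and lk': "l \<odot> k' = f \<odot> k"
    using kernel_lift[OF l, of "f \<odot> k"] by auto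
  have k'k: "l \<odot> k' \<odot> x = f \<odot> k \<odot> x" if "arrow x" "Cod x = Dom k" for x
    using reassoc[OF lk', of x] that by simp
  \<comment> \<open>If \<open>g \<odot> l\<close> kills \<open>x\<close>, then
    \<open>l \<odot> x\<close> has the form \<open>f \<odot> w\<close>. Since \<open>u\<close> kills
    \<open>l\<close>, the morphism \<open>w\<close> factors through the kernel \<open>k\<close> of
    \<open>u \<odot> f\<close>.\<close>
  have "kernel (g \<odot> l) k'" unfolding kernel_def
  proof (intro conjI allI impI)
    show "(g \<odot> l) \<odot> k' = nul (Dom k') (Cod (g \<odot> l))"
      using reassoc[OF sesD(4)[OF fg], of k] by (simp add: lk')
    show "mono k'" unfolding mono_def
    proof (intro conjI allI impI)
      fix x assume x: "arrow x \<and> Cod x = Dom k' \<and> k' \<odot> x = nul (Dom x) (Cod k')"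
      then have "f \<odot> k \<odot> x = nul (Dom x) (Cod f)" using k'k[of x] by simp
      then have "k \<odot> x = nul (Dom x) (Cod k)" using monoD[OF sesD(5)[OF fg], of "k \<odot> x"] x by simp
      then show "x = nul (Dom x) (Dom k')" using monoD[OF sesD(5)[OF uf], of x] x by simp
    qed simp
    fix x assume x: "arrow x \<and> Cod x = Dom (g \<odot> l) \<and> (g \<odot> l) \<odot> x = nul (Dom x) (Cod (g \<odot> l))"
    then obtain w where w: "arrow w" "Dom w = Dom x" "Cod w = Dom f" "f \<odot> w = l \<odot> x"
      using kernel_lift[OF sesD(7)[OF fg], of "l \<odot> x"] by auto blast
    have "(u \<odot> f) \<odot> w = nul (Dom x) (Cod u)"
      using w x reassoc[OF ul0, of x] by simp
    then obtain z where z: "arrow z" "Dom z = Dom x" "Cod z = Dom k" "k \<odot> z = w"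
      using kernel_lift[OF sesD(7)[OF uf], of w] w by auto
    have "k' \<odot> z = x"
      by (rule mono_cancel[OF kernelD(3)[OF l]]) (use z w x k'k in simp_all)
    then show "\<exists>u. arrow u \<and> Dom u = Dom x \<and> Cod u = Dom k' \<and> k' \<odot> u = x" using z by auto
  qed simp_all
  then have "ses k' (g \<odot> l)" by (rule epi_kernel_ses[OF epi])
  then obtain s where s: "arrow s" "Dom s = Cod g" "Cod s = Dom l" "g \<odot> l \<odot> s = idn (Cod g)"
    using ext_vanishesD[OF ext, of k' "g \<odot> l"] by auto
  show thesis
    by (rule that[of "l \<odot> s"]) (use s reassoc[of u l _ s] in simp_all)
qed

text \<open>If the split class is the only one, each extension splits, since it lies in its own
  class. Conversely, split extensions are all equivalent to each other, so there is only one
  class.\<close>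

lemma Ext1_trivial_iff:
  assumes X: "X \<in> Obj C" and Y: "Y \<in> Obj C"
  shows "Ext1 C X Y = {Ext1_zero C X Y} \<longleftrightarrow> ext_vanishes C X Y"
proof
  assume E: "Ext1 C X Y = {Ext1_zero C X Y}"
  show "ext_vanishes C X Y" unfolding ext_vanishes_def
  proof (intro allI impI)
    fix E f g assume e: "short_exact C Y E X f g"
    then have "E \<in> Obj C" "f \<in> Hom C Y E" "g \<in> Hom C E X"
      by (auto simp: short_exact_def is_kernel_def)
    then have "((E, f, g), (E, f, g)) \<in> ext_equiv C X Y"
      using e X Y by (auto simp: ext_equiv_def extensions_def is_iso_def Ide_in_Hom Ide_Comp Comp_Ide
          intro!: bexI[of _ "Ide C E"] exI[of _ "Ide C E"])
    moreover have "ext_equiv C X Y `` {(E, f, g)} \<in> {Ext1_zero C X Y}"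
      unfolding E[symmetric] using e by (auto simp: Ext1_def extensions_def intro: quotientI)
    ultimately have "(E, f, g) \<in> Ext1_zero C X Y" by (metis ImageI singletonI singletonD)
    then show "\<exists>s\<in>Hom C X E. g \<cdot> s = Ide C X" by (auto simp: Ext1_zero_def)
  qed
next
  assume ext: "ext_vanishes C X Y"
  have equiv: "(e, e') \<in> ext_equiv C X Y" if e: "e \<in> extensions C X Y" "e' \<in> extensions C X Y" for e e'
  proof -
    obtain E f g E' f' g' where [simp]: "e = (E, f, g)" "e' = (E', f', g')"
      by (cases e, cases e')
    define F G F' G' where d: "F = (Arr Y f E)" "G = (Arr E g X)" "F' = (Arr Y f' E')" "G' = (Arr E' g' X)"
    have fg: "ses F G" "ses F' G'" using e by (auto simp: extensions_def short_exact_iff d)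
    have dc [simp]: "Dom F = Y" "Cod F = E" "Cod G = X" "Dom F' = Y" "Cod F' = E'" "Cod G' = X"
      by (simp_all add: d)
    have [simp]: "E \<in> Obj C" "E' \<in> Obj C"
      using e by (auto simp: extensions_def short_exact_def)
    note [simp] = sesD(1-4)[OF fg(1)] sesD(1-4)[OF fg(2)] X Y
      sesD(4)[OF fg(1), THEN reassoc] sesD(4)[OF fg(2), THEN reassoc]
    obtain s where s [simp]: "arrow s" "Dom s = X" "Cod s = E" "G \<odot> s = idn X"
      using ext_vanishesD[OF ext fg(1)] by auto
    obtain r where r [simp]: "arrow r" "Dom r = E" "Cod r = Y" "r \<odot> F = idn Y" "r \<odot> s = nul X Y"
      and sum: "F \<odot> r \<oplus> s \<odot> G = idn E"
      using retraction_of_section[OF fg(1), of s] by auto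
    obtain s' where s' [simp]: "arrow s'" "Dom s' = X" "Cod s' = E'" "G' \<odot> s' = idn X"
      using ext_vanishesD[OF ext fg(2)] by auto
    obtain r' where r' [simp]: "arrow r'" "Dom r' = E'" "Cod r' = Y" "r' \<odot> F' = idn Y" "r' \<odot> s' = nul X Y"
      and sum': "F' \<odot> r' \<oplus> s' \<odot> G' = idn E'"
      using retraction_of_section[OF fg(2), of s'] by auto
    note [simp] = s(4)[THEN reassoc] s'(4)[THEN reassoc] r(4,5)[THEN reassoc] r'(4,5)[THEN reassoc]
    \<comment> \<open>Both middle terms decompose into the summands \<open>Y\<close> and
      \<open>X\<close>; \<open>h\<close> and \<open>h'\<close> match these summands.\<close>
    define h where "h = F' \<odot> r \<oplus> s' \<odot> G"
    define h' where "h' = F \<odot> r' \<oplus> s \<odot> G'"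
    have h: "arrow h" "Dom h = E" "Cod h = E'" "h \<odot> F = F'" "G' \<odot> h = G" "h' \<odot> h = idn E"
      by (simp_all add: h_def h'_def sum)
    have h': "arrow h'" "Dom h' = E'" "Cod h' = E" "h \<odot> h' = idn E'"
      by (simp_all add: h_def h'_def sum')
    obtain a where a: "h = (Arr E a E')" using h by (cases h) auto
    obtain a' where a': "h' = (Arr E' a' E)" using h' by (cases h') auto
    have "is_iso C E E' a" using h h' by (auto simp: is_iso_def a a' comp_def idn_def)
    moreover have "a \<cdot> f = f'" "g' \<cdot> a = g" using h(4,5) by (auto simp: a d comp_def)
    ultimately show ?thesis using e by (auto simp: ext_equiv_def)
  qed
  have zero: "Ext1_zero C X Y = extensions C X Y"
    using ext by (auto simp: Ext1_zero_def extensions_def ext_vanishes_def)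
  \<comment> \<open>Some extension has to exist: the quotient of an empty set would be empty and not
    a singleton.\<close>
  obtain P i j p q where bp: "biproduct Y X P i j p q"
    using biproduct_exists[OF Y X] by blast
  obtain i' q' where "i = (Arr Y i' P)" "q = (Arr P q' X)" using biproductD[OF bp] by (cases i, cases q) auto
  then have "(P, i', q') \<in> extensions C X Y"
    using biproduct_ses[OF bp] by (simp add: extensions_def short_exact_iff)
  moreover have "ext_equiv C X Y `` {e} = extensions C X Y" if "e \<in> extensions C X Y" for e
    using equiv that by (auto simp: ext_equiv_def)
  ultimately show "Ext1 C X Y = {Ext1_zero C X Y}"
    by (auto simp: Ext1_def quotient_def zero)
qed

lemma right_perp_iff:
  assumes "\<X> \<subseteq> Obj C"
  shows "Y \<in> right_perp C \<X> \<longleftrightarrow> Y \<in> Obj C \<and> (\<forall>X\<in>\<X>. ext_vanishes C X Y)"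
proof -
  have "Ext1 C X Y = {Ext1_zero C X Y} \<longleftrightarrow> ext_vanishes C X Y" if "X \<in> \<X>" "Y \<in> Obj C" for X
    using Ext1_trivial_iff assms that by blast
  then show ?thesis by (simp add: right_perp_def cong: conj_cong ball_cong)
qed

lemma left_perp_iff:
  assumes "\<X> \<subseteq> Obj C"
  shows "Y \<in> left_perp C \<X> \<longleftrightarrow> Y \<in> Obj C \<and> (\<forall>X\<in>\<X>. ext_vanishes C Y X)"
proof -
  have "Ext1 C Y X = {Ext1_zero C Y X} \<longleftrightarrow> ext_vanishes C Y X" if "X \<in> \<X>" "Y \<in> Obj C" for X
    using Ext1_trivial_iff assms that by blast
  then show ?thesis by (simp add: left_perp_def cong: conj_cong ball_cong)
qed

end

section \<open>Representations form an abelian category\<close>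

definition rev_quiver :: "('v, 'a) pre_digraph \<Rightarrow> ('v, 'a) pre_digraph" where
  "rev_quiver Q = \<lparr>verts = verts Q, arcs = arcs Q, tail = head Q, head = tail Q\<rparr>"

lemma rev_quiver_simps [simp]:
  "verts (rev_quiver Q) = verts Q" "arcs (rev_quiver Q) = arcs Q"
  "tail (rev_quiver Q) = head Q" "head (rev_quiver Q) = tail Q"
  by (simp_all add: rev_quiver_def)

text \<open>Reversing the morphisms of \<open>C\<close> reverses the maps attached to arrows, which
  then represent the reversed quiver. Through this equality cokernel statements become kernel
  statements.\<close>

lemma op_Rep: "opposite (Rep Q C) = Rep (rev_quiver Q) (opposite C)"
  unfolding opposite_def[of "Rep Q C"] Rep_def[of "rev_quiver Q"]
  by (auto simp: Rep_def intro!: ext)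

locale quiver_rep = abelian_category C + wf_digraph Q
  for C :: "('o, 'm) precat" (structure) and Q :: "('v, 'a) pre_digraph"
begin

abbreviation R where "R \<equiv> Rep Q C"

lemma Rep_sel:
  "Hom R F G = {\<eta> \<in> (\<Pi>\<^sub>E i\<in>verts Q. Hom C (at_vertex F i) (at_vertex G i)).
     \<forall>a\<in>arcs Q. \<eta> (head Q a) \<cdot> at_arrow F a = at_arrow G a \<cdot> \<eta> (tail Q a)}"
  "Ide R F = (\<lambda>i\<in>verts Q. Ide C (at_vertex F i))"
  "\<theta> \<cdot>\<^bsub>R\<^esub> \<eta> = (\<lambda>i\<in>verts Q. \<theta> i \<cdot> \<eta> i)"
  "Add R \<theta> \<eta> = (\<lambda>i\<in>verts Q. Add C (\<theta> i) (\<eta> i))"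
  "Zero R F G = (\<lambda>i\<in>verts Q. Zero C (at_vertex F i) (at_vertex G i))"
  by (simp_all add: Rep_def)

definition act :: "('v, 'a, 'o, 'm) rep \<Rightarrow> 'a \<Rightarrow> ('o, 'm) arr" where
  "act F a = Arr (at_vertex F (tail Q a)) (at_arrow F a) (at_vertex F (head Q a))"

definition cmp :: "('v, 'a, 'o, 'm) rep \<Rightarrow> ('v, 'a, 'o, 'm) rep \<Rightarrow> ('v \<Rightarrow> 'm) \<Rightarrow> 'v \<Rightarrow> ('o, 'm) arr" where
  "cmp F G \<eta> i = Arr (at_vertex F i) (\<eta> i) (at_vertex G i)"

lemma act_sel [simp]: "Dom (act F a) = at_vertex F (tail Q a)" "Cod (act F a) = at_vertex F (head Q a)"
  by (simp_all add: act_def)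

lemma cmp_sel [simp]: "Dom (cmp F G \<eta> i) = at_vertex F i" "Cod (cmp F G \<eta> i) = at_vertex G i"
  "mor (cmp F G \<eta> i) = \<eta> i"
  by (simp_all add: cmp_def)

lemma Rep_Obj_iff:
  "F \<in> Obj R \<longleftrightarrow> at_vertex F \<in> extensional (verts Q) \<and> at_arrow F \<in> extensional (arcs Q) \<and>
     (\<forall>i\<in>verts Q. at_vertex F i \<in> Obj C) \<and> (\<forall>a\<in>arcs Q. arrow (act F a))"
  by (auto simp: Rep_def act_def PiE_def Pi_def)

lemma Rep_ObjD [simp]:
  "\<lbrakk>F \<in> Obj R; i \<in> verts Q\<rbrakk> \<Longrightarrow> at_vertex F i \<in> Obj C"
  "\<lbrakk>F \<in> Obj R; a \<in> arcs Q\<rbrakk> \<Longrightarrow> arrow (act F a)"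
  by (auto simp: Rep_Obj_iff)

lemma Rep_Hom_iff:
  assumes "F \<in> Obj R" "G \<in> Obj R"
  shows "\<eta> \<in> Hom R F G \<longleftrightarrow> \<eta> \<in> extensional (verts Q) \<and> (\<forall>i\<in>verts Q. arrow (cmp F G \<eta> i)) \<and>
     (\<forall>a\<in>arcs Q. cmp F G \<eta> (head Q a) \<odot> act F a = act G a \<odot> cmp F G \<eta> (tail Q a))"
  using assms by (auto simp: Rep_sel cmp_def act_def PiE_def Pi_def comp_def)

lemma Rep_HomD:
  assumes "\<eta> \<in> Hom R F G" "F \<in> Obj R" "G \<in> Obj R"
  shows "i \<in> verts Q \<Longrightarrow> arrow (cmp F G \<eta> i)"
    "a \<in> arcs Q \<Longrightarrow> cmp F G \<eta> (head Q a) \<odot> act F a = act G a \<odot> cmp F G \<eta> (tail Q a)"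
    "\<lbrakk>a \<in> arcs Q; arrow x; Cod x = at_vertex F (tail Q a)\<rbrakk> \<Longrightarrow>
      cmp F G \<eta> (head Q a) \<odot> act F a \<odot> x = act G a \<odot> cmp F G \<eta> (tail Q a) \<odot> x"
proof -
  show A: "i \<in> verts Q \<Longrightarrow> arrow (cmp F G \<eta> i)" for i using assms Rep_Hom_iff by blast
  show B: "a \<in> arcs Q \<Longrightarrow> cmp F G \<eta> (head Q a) \<odot> act F a = act G a \<odot> cmp F G \<eta> (tail Q a)"
    using assms Rep_Hom_iff by blast
  show "\<lbrakk>a \<in> arcs Q; arrow x; Cod x = at_vertex F (tail Q a)\<rbrakk> \<Longrightarrow>
      cmp F G \<eta> (head Q a) \<odot> act F a \<odot> x = act G a \<odot> cmp F G \<eta> (tail Q a) \<odot> x"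
    using reassoc[OF B, of x] A assms by simp
qed

lemma Rep_Hom_eqI:
  assumes "\<eta> \<in> Hom R F G" "\<theta> \<in> Hom R F G" "\<And>i. i \<in> verts Q \<Longrightarrow> cmp F G \<eta> i = cmp F G \<theta> i"
  shows "\<eta> = \<theta>"
  using assms by (intro extensionalityI[of _ "verts Q"]) (auto simp: Rep_sel PiE_def cmp_def)

text \<open>The middle object \<open>G\<close> is absent from the left side, so each use has to name
  it.\<close>

lemma cmp_comp: "i \<in> verts Q \<Longrightarrow> cmp F H (\<theta> \<cdot>\<^bsub>R\<^esub> \<eta>) i = cmp G H \<theta> i \<odot> cmp F G \<eta> i"
  by (simp add: Rep_sel cmp_def comp_def)

lemma cmp_Ide [simp]: "i \<in> verts Q \<Longrightarrow> cmp F F (Ide R F) i = idn (at_vertex F i)"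
  by (simp add: Rep_sel cmp_def idn_def)

lemma cmp_Zero [simp]: "i \<in> verts Q \<Longrightarrow> cmp F G (Zero R F G) i = nul (at_vertex F i) (at_vertex G i)"
  by (simp add: Rep_sel cmp_def nul_def)

lemma cmp_Add [simp]: "i \<in> verts Q \<Longrightarrow> cmp F G (Add R \<eta> \<theta>) i = cmp F G \<eta> i \<oplus> cmp F G \<theta> i"
  by (simp add: Rep_sel cmp_def plus_def)

definition mk_hom :: "('v \<Rightarrow> ('o, 'm) arr) \<Rightarrow> 'v \<Rightarrow> 'm" where
  "mk_hom h = (\<lambda>i\<in>verts Q. mor (h i))"

lemma cmp_mk_hom:
  "\<lbrakk>i \<in> verts Q; Dom (h i) = at_vertex F i; Cod (h i) = at_vertex G i\<rbrakk> \<Longrightarrow> cmp F G (mk_hom h) i = h i"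
  by (cases "h i") (simp add: cmp_def mk_hom_def)

lemma mk_hom_in_Hom:
  assumes "F \<in> Obj R" "G \<in> Obj R"
    "\<And>i. i \<in> verts Q \<Longrightarrow> arrow (h i) \<and> Dom (h i) = at_vertex F i \<and> Cod (h i) = at_vertex G i"
    "\<And>a. a \<in> arcs Q \<Longrightarrow> h (head Q a) \<odot> act F a = act G a \<odot> h (tail Q a)"
  shows "mk_hom h \<in> Hom R F G"
  unfolding Rep_Hom_iff[OF assms(1,2)] using assms
  by (auto simp: cmp_mk_hom) (simp add: mk_hom_def)

definition mk_rep :: "('v \<Rightarrow> 'o) \<Rightarrow> ('a \<Rightarrow> ('o, 'm) arr) \<Rightarrow> ('v, 'a, 'o, 'm) rep" where
  "mk_rep V h = \<lparr>at_vertex = (\<lambda>i\<in>verts Q. V i), at_arrow = (\<lambda>a\<in>arcs Q. mor (h a))\<rparr>"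

lemma at_vertex_mk_rep [simp]: "i \<in> verts Q \<Longrightarrow> at_vertex (mk_rep V h) i = V i"
  by (simp add: mk_rep_def)

lemma act_mk_rep:
  "\<lbrakk>a \<in> arcs Q; Dom (h a) = V (tail Q a); Cod (h a) = V (head Q a)\<rbrakk> \<Longrightarrow> act (mk_rep V h) a = h a"
  by (cases "h a") (simp add: mk_rep_def act_def)

lemma mk_rep_in_Obj:
  assumes "\<And>i. i \<in> verts Q \<Longrightarrow> V i \<in> Obj C"
    "\<And>a. a \<in> arcs Q \<Longrightarrow> arrow (h a) \<and> Dom (h a) = V (tail Q a) \<and> Cod (h a) = V (head Q a)"
  shows "mk_rep V h \<in> Obj R"
  unfolding Rep_Obj_iff using assms by (auto simp: act_mk_rep) (simp_all add: mk_rep_def)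

section \<open>Vertexwise additive structure and kernels of representations\<close>

lemma preadditive_Rep: "preadditive_category R"
proof -
  have Zero: "Zero R F G \<in> Hom R F G" if "F \<in> Obj R" "G \<in> Obj R" for F G
    unfolding Rep_Hom_iff[OF that] using that by (auto) (simp add: Rep_sel)
  have Add: "Add R \<eta> \<theta> \<in> Hom R F G"
    if "F \<in> Obj R" "G \<in> Obj R" "\<eta> \<in> Hom R F G" "\<theta> \<in> Hom R F G" for F G \<eta> \<theta>
    unfolding Rep_Hom_iff[OF that(1,2)] using that
    by (auto simp: Rep_HomD) (simp add: Rep_sel)
  have Comp: "\<theta> \<cdot>\<^bsub>R\<^esub> \<eta> \<in> Hom R F H"
    if "F \<in> Obj R" "G \<in> Obj R" "H \<in> Obj R" "\<eta> \<in> Hom R F G" "\<theta> \<in> Hom R G H" for F G H \<eta> \<theta>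
    unfolding Rep_Hom_iff[OF that(1,3)] using that
    by (auto simp: Rep_HomD cmp_comp[of _ F H \<theta> \<eta> G]) (simp add: Rep_sel)
  have Ide: "Ide R F \<in> Hom R F F" if "F \<in> Obj R" for F
    unfolding Rep_Hom_iff[OF that that] using that by (auto) (simp add: Rep_sel)
  show ?thesis
  proof (rule preadditive_category.intro)
    fix F G assume FG: "F \<in> Obj R" "G \<in> Obj R"
    show "comm_group (hom_group R F G)"
    proof (rule comm_groupI; unfold hom_group_def, simp)
      show "Add R \<eta> \<theta> \<in> Hom R F G" if "\<eta> \<in> Hom R F G" "\<theta> \<in> Hom R F G" for \<eta> \<theta>
        using Add FG that .
      show "Zero R F G \<in> Hom R F G" using Zero FG .
      show "Add R (Add R \<eta> \<theta>) \<zeta> = Add R \<eta> (Add R \<theta> \<zeta>)"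
        if "\<eta> \<in> Hom R F G" "\<theta> \<in> Hom R F G" "\<zeta> \<in> Hom R F G" for \<eta> \<theta> \<zeta>
        using FG that by (intro Rep_Hom_eqI[of _ F G]) (simp_all add: Add plus_assoc Rep_HomD)
      show "Add R \<eta> \<theta> = Add R \<theta> \<eta>" if "\<eta> \<in> Hom R F G" "\<theta> \<in> Hom R F G" for \<eta> \<theta>
        using FG that by (intro Rep_Hom_eqI[of _ F G]) (simp_all add: Add plus_commute Rep_HomD)
      show "Add R (Zero R F G) \<eta> = \<eta>" if "\<eta> \<in> Hom R F G" for \<eta>
        using FG that by (intro Rep_Hom_eqI[of _ F G]) (simp_all add: Add Zero Rep_HomD)
      show "\<exists>\<theta>\<in>Hom R F G. Add R \<theta> \<eta> = Zero R F G" if \<eta>: "\<eta> \<in> Hom R F G" for \<eta>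
      proof
        let ?n = "mk_hom (\<lambda>i. \<ominus>(cmp F G \<eta> i))"
        show n: "?n \<in> Hom R F G"
          using FG \<eta> by (intro mk_hom_in_Hom) (simp_all add: Rep_HomD)
        show "Add R ?n \<eta> = Zero R F G"
          using FG \<eta> n by (intro Rep_Hom_eqI[of _ F G]) (simp_all add: Add Zero cmp_mk_hom Rep_HomD)
      qed
    qed
  next
    fix F G H E \<eta> \<theta> \<zeta> assume h: "F \<in> Obj R" "G \<in> Obj R" "H \<in> Obj R" "E \<in> Obj R"
      "\<eta> \<in> Hom R F G" "\<theta> \<in> Hom R G H" "\<zeta> \<in> Hom R H E"
    show "(\<zeta> \<cdot>\<^bsub>R\<^esub> \<theta>) \<cdot>\<^bsub>R\<^esub> \<eta> = \<zeta> \<cdot>\<^bsub>R\<^esub> (\<theta> \<cdot>\<^bsub>R\<^esub> \<eta>)"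
      using h Comp by (intro Rep_Hom_eqI[of _ F E])
        (simp_all add: cmp_comp[of _ F E "\<zeta> \<cdot>\<^bsub>R\<^esub> \<theta>" \<eta> G]
          cmp_comp[of _ G E \<zeta> \<theta> H] cmp_comp[of _ F E \<zeta> "\<theta> \<cdot>\<^bsub>R\<^esub> \<eta>" H]
          cmp_comp[of _ F H \<theta> \<eta> G] Rep_HomD)
  next
    fix F G \<eta> assume h: "F \<in> Obj R" "G \<in> Obj R" "\<eta> \<in> Hom R F G"
    show "\<eta> \<cdot>\<^bsub>R\<^esub> Ide R F = \<eta>"
      using h Comp Ide by (intro Rep_Hom_eqI[of _ F G]) (simp_all add: cmp_comp[of _ F G _ _ F] Rep_HomD)
    show "Ide R G \<cdot>\<^bsub>R\<^esub> \<eta> = \<eta>"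
      using h Comp Ide by (intro Rep_Hom_eqI[of _ F G]) (simp_all add: cmp_comp[of _ F G _ _ G] Rep_HomD)
  next
    fix F G H \<eta> \<eta>' \<theta> assume h: "F \<in> Obj R" "G \<in> Obj R" "H \<in> Obj R"
      "\<eta> \<in> Hom R F G" "\<eta>' \<in> Hom R F G" "\<theta> \<in> Hom R G H"
    show "\<theta> \<cdot>\<^bsub>R\<^esub> Add R \<eta> \<eta>' = Add R (\<theta> \<cdot>\<^bsub>R\<^esub> \<eta>) (\<theta> \<cdot>\<^bsub>R\<^esub> \<eta>')"
      using h Comp Add by (intro Rep_Hom_eqI[of _ F H]) (simp_all add: cmp_comp[of _ F H _ _ G] Rep_HomD)
  next
    fix F G H \<eta> \<theta> \<theta>' assume h: "F \<in> Obj R" "G \<in> Obj R" "H \<in> Obj R"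
      "\<eta> \<in> Hom R F G" "\<theta> \<in> Hom R G H" "\<theta>' \<in> Hom R G H"
    show "Add R \<theta> \<theta>' \<cdot>\<^bsub>R\<^esub> \<eta> = Add R (\<theta> \<cdot>\<^bsub>R\<^esub> \<eta>) (\<theta>' \<cdot>\<^bsub>R\<^esub> \<eta>)"
      using h Comp Add by (intro Rep_Hom_eqI[of _ F H]) (simp_all add: cmp_comp[of _ F H _ _ G] Rep_HomD)
  qed (use Ide Comp in auto)
qed

lemma pointwise_kernel_iff:
  assumes "F \<in> Obj R" "G \<in> Obj R" "i \<in> verts Q"
  shows "is_kernel C (at_vertex F i) (at_vertex G i) (\<eta> i) (at_vertex K i) (\<kappa> i)
    \<longleftrightarrow> kernel (cmp F G \<eta> i) (cmp K F \<kappa> i)"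
  using assms by (simp add: is_kernel_iff cmp_def)

lemma pointwise_cokernel_iff:
  assumes "F \<in> Obj R" "G \<in> Obj R" "i \<in> verts Q"
  shows "is_cokernel C (at_vertex F i) (at_vertex G i) (\<eta> i) (at_vertex K i) (\<kappa> i)
    \<longleftrightarrow> cokernel (cmp F G \<eta> i) (cmp G K \<kappa> i)"
  using assms by (simp add: is_cokernel_iff cmp_def)

text \<open>The vertexwise factorizations form a morphism of representations: naturality along an
  arrow may be tested after composing with the mono \<open>\<kappa>\<close> at its head.\<close>

lemma Rep_kernelI:
  assumes FG [simp]: "F \<in> Obj R" "G \<in> Obj R" "K \<in> Obj R"
    and \<eta>: "\<eta> \<in> Hom R F G" and \<kappa>: "\<kappa> \<in> Hom R K F"
    and pker: "\<And>i. i \<in> verts Q \<Longrightarrow>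
      is_kernel C (at_vertex F i) (at_vertex G i) (\<eta> i) (at_vertex K i) (\<kappa> i)"
  shows "is_kernel R F G \<eta> K \<kappa>"
proof -
  interpret R: preadditive_category R by (rule preadditive_Rep)
  have ker: "kernel (cmp F G \<eta> i) (cmp K F \<kappa> i)" if "i \<in> verts Q" for i
    using pker[OF that] pointwise_kernel_iff[OF FG(1,2) that] by simp
  have "\<eta> \<cdot>\<^bsub>R\<^esub> \<kappa> = Zero R K G"
    using ker[THEN kernelD(5)] \<eta> \<kappa>
    by (intro Rep_Hom_eqI[of _ K G]) (simp_all add: cmp_comp[of _ K G _ _ F] R.Comp_in_Hom[of K F G] R.Zero_in_Hom)
  moreover have "\<exists>!\<upsilon>. \<upsilon> \<in> Hom R T K \<and> \<kappa> \<cdot>\<^bsub>R\<^esub> \<upsilon> = \<tau>"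
    if T [simp]: "T \<in> Obj R" and \<tau>: "\<tau> \<in> Hom R T F" and z: "\<eta> \<cdot>\<^bsub>R\<^esub> \<tau> = Zero R T G" for T \<tau>
  proof -
    have "\<exists>u. arrow u \<and> Dom u = at_vertex T i \<and> Cod u = at_vertex K i \<and> cmp K F \<kappa> i \<odot> u = cmp T F \<tau> i"
      if i: "i \<in> verts Q" for i
    proof -
      have "cmp F G \<eta> i \<odot> cmp T F \<tau> i = nul (at_vertex T i) (at_vertex G i)"
        using cmp_comp[of i T G \<eta> \<tau> F] z i by simp
      then show ?thesis
        using kernel_lift[OF ker[OF i], of "cmp T F \<tau> i"] i \<tau> by (auto simp: Rep_HomD)
    qed
    then obtain u where u: "\<And>i. i \<in> verts Q \<Longrightarrow> arrow (u i) \<and> Dom (u i) = at_vertex T i \<and>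
        Cod (u i) = at_vertex K i \<and> cmp K F \<kappa> i \<odot> u i = cmp T F \<tau> i"
      by metis
    note [simp] = u[THEN conjunct1] u[THEN conjunct2, THEN conjunct1]
      u[THEN conjunct2, THEN conjunct2, THEN conjunct1] u[THEN conjunct2, THEN conjunct2, THEN conjunct2]
      reassoc[OF u[THEN conjunct2, THEN conjunct2, THEN conjunct2]]
      Rep_HomD[OF \<kappa>] Rep_HomD[OF \<tau>]
    have nat: "u (head Q a) \<odot> act T a = act K a \<odot> u (tail Q a)" if a: "a \<in> arcs Q" for a
      by (rule mono_cancel[OF kernelD(3)[OF ker[of "head Q a"]]]) (use a in simp_all)
    have hom: "mk_hom u \<in> Hom R T K"
      by (intro mk_hom_in_Hom) (simp_all add: nat)
    moreover have "\<kappa> \<cdot>\<^bsub>R\<^esub> mk_hom u = \<tau>"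
      using hom \<kappa> \<tau> by (intro Rep_Hom_eqI[of _ T F])
        (simp_all add: R.Comp_in_Hom[of T K F] cmp_comp[of _ T F _ _ K] cmp_mk_hom)
    moreover have "\<upsilon> = mk_hom u" if \<upsilon>: "\<upsilon> \<in> Hom R T K" "\<kappa> \<cdot>\<^bsub>R\<^esub> \<upsilon> = \<tau>" for \<upsilon>
    proof (rule Rep_Hom_eqI[OF \<upsilon>(1) hom])
      fix i assume i: "i \<in> verts Q"
      show "cmp T K \<upsilon> i = cmp T K (mk_hom u) i"
        by (rule mono_cancel[OF kernelD(3)[OF ker[OF i]]])
          (use i \<upsilon> cmp_comp[of i T F \<kappa> \<upsilon> K] in \<open>simp_all add: cmp_mk_hom Rep_HomD\<close>)
    qed
    ultimately show ?thesis by blast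
  qed
  ultimately show ?thesis using \<eta> \<kappa> by (auto simp: is_kernel_def)
qed

lemma Rep_kernel_exists:
  assumes FG [simp]: "F \<in> Obj R" "G \<in> Obj R" and \<eta>: "\<eta> \<in> Hom R F G"
  obtains K \<kappa> where "K \<in> Obj R" "\<kappa> \<in> Hom R K F"
    "\<And>i. i \<in> verts Q \<Longrightarrow> is_kernel C (at_vertex F i) (at_vertex G i) (\<eta> i) (at_vertex K i) (\<kappa> i)"
proof -
  note [simp] = Rep_HomD[OF \<eta>]
  have "\<exists>k. kernel (cmp F G \<eta> i) k" if "i \<in> verts Q" for i
    using kernel_exists[of "cmp F G \<eta> i"] that by auto
  then obtain k where k: "\<And>i. i \<in> verts Q \<Longrightarrow> kernel (cmp F G \<eta> i) (k i)" by metis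
  note [simp] = kernelD(2,4,5)[OF k] kernelD(5)[OF k, THEN reassoc]
  have "\<exists>u. arrow u \<and> Dom u = Dom (k (tail Q a)) \<and> Cod u = Dom (k (head Q a)) \<and>
      k (head Q a) \<odot> u = act F a \<odot> k (tail Q a)" if a: "a \<in> arcs Q" for a
    using kernel_lift[OF k[of "head Q a"], of "act F a \<odot> k (tail Q a)"] a by auto
  then obtain u where u: "\<And>a. a \<in> arcs Q \<Longrightarrow> arrow (u a) \<and> Dom (u a) = Dom (k (tail Q a)) \<and>
      Cod (u a) = Dom (k (head Q a)) \<and> k (head Q a) \<odot> u a = act F a \<odot> k (tail Q a)" by metis
  define K where "K = mk_rep (\<lambda>i. Dom (k i)) u"
  have K: "K \<in> Obj R" and [simp]: "\<And>a. a \<in> arcs Q \<Longrightarrow> act K a = u a"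
    "\<And>i. i \<in> verts Q \<Longrightarrow> at_vertex K i = Dom (k i)"
    using u by (auto simp: K_def act_mk_rep intro!: mk_rep_in_Obj)
  have "mk_hom k \<in> Hom R K F"
    using u K by (intro mk_hom_in_Hom) auto
  moreover have "is_kernel C (at_vertex F i) (at_vertex G i) (\<eta> i) (at_vertex K i) (mk_hom k i)"
    if i: "i \<in> verts Q" for i
    using pointwise_kernel_iff[OF FG i, of \<eta> K "mk_hom k"] k[OF i] cmp_mk_hom[of i k K F] i by simp
  ultimately show thesis using K that by blast
qed

text \<open>The vertexwise kernel is also a kernel in \<open>R\<close>. Comparison morphisms between
  it and the given kernel exist in \<open>R\<close>, and they transport the universal property at
  each vertex.\<close>

lemma Rep_is_kernelD:
  assumes FG [simp]: "F \<in> Obj R" "G \<in> Obj R" and ker: "is_kernel R F G \<eta> K \<kappa>" and i: "i \<in> verts Q"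
  shows "is_kernel C (at_vertex F i) (at_vertex G i) (\<eta> i) (at_vertex K i) (\<kappa> i)"
proof -
  interpret R: preadditive_category R by (rule preadditive_Rep)
  have \<kappa>: "K \<in> Obj R" "\<kappa> \<in> Hom R K F" and \<eta>: "\<eta> \<in> Hom R F G" using ker by (auto simp: is_kernel_def)
  obtain K' \<kappa>' where K': "K' \<in> Obj R" "\<kappa>' \<in> Hom R K' F" and pker:
    "\<And>i. i \<in> verts Q \<Longrightarrow> is_kernel C (at_vertex F i) (at_vertex G i) (\<eta> i) (at_vertex K' i) (\<kappa>' i)"
    using Rep_kernel_exists[OF FG \<eta>] by blast
  have ker': "is_kernel R F G \<eta> K' \<kappa>'" using Rep_kernelI FG K' \<eta> pker by blast
  have k: "R.kernel (Arr F \<eta> G) (Arr K \<kappa> F)"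
    using ker R.is_kernel_iff[OF FG] by auto
  have e: "kernel (cmp F G \<eta> i) (cmp K' F \<kappa>' i)"
    using pker[OF i] pointwise_kernel_iff[OF FG i] by simp
  have "\<exists>\<upsilon>\<in>Hom R K K'. \<kappa>' \<cdot>\<^bsub>R\<^esub> \<upsilon> = \<kappa>" "\<exists>\<upsilon>\<in>Hom R K' K. \<kappa> \<cdot>\<^bsub>R\<^esub> \<upsilon> = \<kappa>'"
    using ker ker' \<kappa> K' unfolding is_kernel_def by metis+
  then obtain \<upsilon> \<nu> where \<upsilon>: "\<upsilon> \<in> Hom R K K'" "\<kappa>' \<cdot>\<^bsub>R\<^esub> \<upsilon> = \<kappa>" and \<nu>: "\<nu> \<in> Hom R K' K" "\<kappa> \<cdot>\<^bsub>R\<^esub> \<nu> = \<kappa>'"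
    by blast
  have "(\<kappa> \<cdot>\<^bsub>R\<^esub> \<nu>) \<cdot>\<^bsub>R\<^esub> \<upsilon> = \<kappa>" using \<upsilon> \<nu> by simp
  then have "\<kappa> \<cdot>\<^bsub>R\<^esub> (\<nu> \<cdot>\<^bsub>R\<^esub> \<upsilon>) = \<kappa> \<cdot>\<^bsub>R\<^esub> Ide R K"
    using \<kappa> K' \<upsilon> \<nu> R.Comp_assoc[of K K' K F \<upsilon> \<nu> \<kappa>] R.Comp_Ide[of K F \<kappa>] by simp
  moreover have "is_mono R K F \<kappa>" using R.is_mono_iff \<kappa> R.kernelD(3)[OF k] by simp
  ultimately have \<nu>\<upsilon>: "\<nu> \<cdot>\<^bsub>R\<^esub> \<upsilon> = Ide R K"
    using \<kappa> K' \<upsilon> \<nu> unfolding is_mono_def by (meson R.Comp_in_Hom R.Ide_in_Hom)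
  note [simp] = Rep_HomD(1)[OF \<kappa>(2) \<kappa>(1) FG(1)] Rep_HomD(1)[OF \<upsilon>(1) \<kappa>(1) K'(1)]
    Rep_HomD(1)[OF \<nu>(1) K'(1) \<kappa>(1)] Rep_HomD(1)[OF K'(2) K'(1) FG(1)] Rep_HomD(1)[OF \<eta> FG]
  have eqs [simp]: "cmp K' F \<kappa>' i \<odot> cmp K K' \<upsilon> i = cmp K F \<kappa> i" "cmp K F \<kappa> i \<odot> cmp K' K \<nu> i = cmp K' F \<kappa>' i"
    "cmp K' K \<nu> i \<odot> cmp K K' \<upsilon> i = idn (at_vertex K i)"
    using \<upsilon>(2) \<nu>(2) \<nu>\<upsilon> i cmp_comp[of i K F \<kappa>' \<upsilon> K'] cmp_comp[of i K' F \<kappa> \<nu> K]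
      cmp_comp[of i K K \<nu> \<upsilon> K'] by simp_all
  note eqs' [simp] = eqs[THEN reassoc]
  have "kernel (cmp F G \<eta> i) (cmp K F \<kappa> i)" unfolding kernel_def
  proof (intro conjI allI impI)
    show "arrow (cmp F G \<eta> i)" using i by simp
    show "Cod (cmp K F \<kappa> i) = Dom (cmp F G \<eta> i)" by simp
    show "mono (cmp K F \<kappa> i)" unfolding mono_def
    proof (intro conjI allI impI)
      fix x assume x: "arrow x \<and> Cod x = Dom (cmp K F \<kappa> i) \<and> cmp K F \<kappa> i \<odot> x = nul (Dom x) (Cod (cmp K F \<kappa> i))"
      then have "cmp K' F \<kappa>' i \<odot> (cmp K K' \<upsilon> i \<odot> x) = nul (Dom x) (at_vertex F i)" using i by simp
      then have "cmp K K' \<upsilon> i \<odot> x = nul (Dom x) (at_vertex K' i)"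
        using monoD[OF kernelD(3)[OF e], of "cmp K K' \<upsilon> i \<odot> x"] x i by simp
      then have "cmp K' K \<nu> i \<odot> cmp K K' \<upsilon> i \<odot> x = cmp K' K \<nu> i \<odot> nul (Dom x) (at_vertex K' i)" by simp
      then show "x = nul (Dom x) (Dom (cmp K F \<kappa> i))" using x i K' by simp
    qed (use i in simp)
    have "cmp F G \<eta> i \<odot> cmp K' F \<kappa>' i \<odot> cmp K K' \<upsilon> i = nul (at_vertex K i) (at_vertex G i)"
      using reassoc[OF kernelD(5)[OF e], of "cmp K K' \<upsilon> i"] i by (simp del: eqs)
    then show "cmp F G \<eta> i \<odot> cmp K F \<kappa> i = nul (Dom (cmp K F \<kappa> i)) (Cod (cmp F G \<eta> i))" by simp
    fix t assume t: "arrow t \<and> Cod t = Dom (cmp F G \<eta> i) \<and> cmp F G \<eta> i \<odot> t = nul (Dom t) (Cod (cmp F G \<eta> i))"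
    then obtain w where w: "arrow w" "Dom w = Dom t" "Cod w = at_vertex K' i" "cmp K' F \<kappa>' i \<odot> w = t"
      using kernel_lift[OF e, of t] by auto
    then show "\<exists>u. arrow u \<and> Dom u = Dom t \<and> Cod u = Dom (cmp K F \<kappa> i) \<and> cmp K F \<kappa> i \<odot> u = t"
      using i by (intro exI[of _ "cmp K' K \<nu> i \<odot> w"]) simp
  qed
  then show ?thesis using pointwise_kernel_iff[OF FG i] by simp
qed

text \<open>A mono has zero kernel, and a kernel may be taken vertexwise; so each component has zero
  kernel.\<close>

lemma Rep_is_monoD:
  assumes FG [simp]: "F \<in> Obj R" "G \<in> Obj R" and mono: "is_mono R F G \<eta>" and i: "i \<in> verts Q"
  shows "is_mono C (at_vertex F i) (at_vertex G i) (\<eta> i)"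
proof -
  interpret R: preadditive_category R by (rule preadditive_Rep)
  have \<eta>: "\<eta> \<in> Hom R F G" using mono by (simp add: is_mono_def)
  obtain K \<kappa> where K: "K \<in> Obj R" "\<kappa> \<in> Hom R K F" and pker:
    "\<And>i. i \<in> verts Q \<Longrightarrow> is_kernel C (at_vertex F i) (at_vertex G i) (\<eta> i) (at_vertex K i) (\<kappa> i)"
    using Rep_kernel_exists[OF FG \<eta>] by blast
  have ker: "is_kernel R F G \<eta> K \<kappa>" using Rep_kernelI FG K \<eta> pker by blast
  have "R.mono (Arr F \<eta> G)" using R.is_mono_iff mono by simp
  then have "Arr K \<kappa> F = R.nul K F"
    using R.monoD[of "Arr F \<eta> G" "Arr K \<kappa> F"] R.kernelD[OF ker[unfolded R.is_kernel_iff[OF FG]]] by simp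
  then have "\<kappa> = Zero R K F" by (simp add: R.nul_def)
  then have "cmp K F \<kappa> i = nul (at_vertex K i) (at_vertex F i)" using i by simp
  then have ker0: "kernel (cmp F G \<eta> i) (nul (at_vertex K i) (at_vertex F i))"
    using pker[OF i] pointwise_kernel_iff[OF FG i] by simp
  have "mono (cmp F G \<eta> i)" unfolding mono_def
  proof (intro conjI allI impI)
    fix x assume x: "arrow x \<and> Cod x = Dom (cmp F G \<eta> i) \<and> cmp F G \<eta> i \<odot> x = nul (Dom x) (Cod (cmp F G \<eta> i))"
    then obtain u where "arrow u" "Dom u = Dom x" "Cod u = at_vertex K i"
      "nul (at_vertex K i) (at_vertex F i) \<odot> u = x"
      using kernel_lift[OF ker0, of x] by auto
    then show "x = nul (Dom x) (Dom (cmp F G \<eta> i))" using i by auto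
  qed (use kernelD[OF ker0] in simp)
  then show ?thesis using i by (simp add: is_mono_iff cmp_def)
qed

end

lemma (in quiver_rep) quiver_rep_op: "quiver_rep (opposite C) (rev_quiver Q)"
proof -
  interpret opp: abelian_category "opposite C" by (rule abelian_op)
  show ?thesis by unfold_locales auto
qed

section \<open>Cokernels by duality, and the abelian structure on representations\<close>

context quiver_rep
begin

lemma Rep_op_simps [simp]:
  "Obj (Rep (rev_quiver Q) (opposite C)) = Obj R"
  "Hom (Rep (rev_quiver Q) (opposite C)) F G = Hom R G F"
  "is_mono (Rep (rev_quiver Q) (opposite C)) F G \<eta> = is_epi R G F \<eta>"
  "is_kernel (Rep (rev_quiver Q) (opposite C)) F G \<eta> K \<kappa> = is_cokernel R G F \<eta> K \<kappa>"
  "is_cokernel (Rep (rev_quiver Q) (opposite C)) F G \<eta> K \<kappa> = is_kernel R G F \<eta> K \<kappa>"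
  unfolding op_Rep[symmetric] by simp_all

lemma Rep_cokernelI:
  assumes "F \<in> Obj R" "G \<in> Obj R" "K \<in> Obj R" "\<eta> \<in> Hom R F G" "\<kappa> \<in> Hom R G K"
    and "\<And>i. i \<in> verts Q \<Longrightarrow>
      is_cokernel C (at_vertex F i) (at_vertex G i) (\<eta> i) (at_vertex K i) (\<kappa> i)"
  shows "is_cokernel R F G \<eta> K \<kappa>"
  using quiver_rep.Rep_kernelI[OF quiver_rep_op, of G F K \<eta> \<kappa>] assms by simp

lemma Rep_cokernel_exists:
  assumes "F \<in> Obj R" "G \<in> Obj R" "\<eta> \<in> Hom R F G"
  obtains K \<kappa> where "K \<in> Obj R" "\<kappa> \<in> Hom R G K"
    "\<And>i. i \<in> verts Q \<Longrightarrow> is_cokernel C (at_vertex F i) (at_vertex G i) (\<eta> i) (at_vertex K i) (\<kappa> i)"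
  using quiver_rep.Rep_kernel_exists[OF quiver_rep_op, of G F \<eta>] assms by simp metis

lemma Rep_is_cokernelD:
  assumes "F \<in> Obj R" "G \<in> Obj R" "is_cokernel R F G \<eta> K \<kappa>" "i \<in> verts Q"
  shows "is_cokernel C (at_vertex F i) (at_vertex G i) (\<eta> i) (at_vertex K i) (\<kappa> i)"
  using quiver_rep.Rep_is_kernelD[OF quiver_rep_op, of G F \<eta> K \<kappa> i] assms by simp

text \<open>A mono of representations is mono at each vertex, hence there the kernel of its
  cokernel, and the vertexwise cokernel is a representation.\<close>

lemma Rep_mono_normal:
  assumes FG: "F \<in> Obj R" "G \<in> Obj R" and mono: "is_mono R F G \<eta>"
  shows "\<exists>D \<theta>. D \<in> Obj R \<and> is_kernel R G D \<theta> F \<eta>"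
proof -
  have \<eta>: "\<eta> \<in> Hom R F G" using mono by (simp add: is_mono_def)
  obtain D \<theta> where D: "D \<in> Obj R" "\<theta> \<in> Hom R G D" and pcok:
    "\<And>i. i \<in> verts Q \<Longrightarrow> is_cokernel C (at_vertex F i) (at_vertex G i) (\<eta> i) (at_vertex D i) (\<theta> i)"
    using Rep_cokernel_exists[OF FG \<eta>] by blast
  have "is_kernel C (at_vertex G i) (at_vertex D i) (\<theta> i) (at_vertex F i) (\<eta> i)" if i: "i \<in> verts Q" for i
  proof -
    have "mono (cmp F G \<eta> i)" using Rep_is_monoD[OF FG mono i] FG i by (simp add: is_mono_iff cmp_def)
    moreover have "cokernel (cmp F G \<eta> i) (cmp G D \<theta> i)" using pcok[OF i] pointwise_cokernel_iff FG i by simp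
    ultimately have "ses (cmp F G \<eta> i) (cmp G D \<theta> i)" by (rule mono_cokernel_ses)
    then show ?thesis using pointwise_kernel_iff[OF FG(2) D(1) i] by (simp add: ses_def)
  qed
  then show ?thesis using Rep_kernelI[OF FG(2) D(1) FG(1) D(2) \<eta>] D by blast
qed

lemma Rep_biproduct:
  assumes FG [simp]: "F \<in> Obj R" "G \<in> Obj R"
  shows "has_biproduct R F G"
proof -
  interpret R: preadditive_category R by (rule preadditive_Rep)
  have "\<exists>P i j p q. biproduct (at_vertex F v) (at_vertex G v) P i j p q" if "v \<in> verts Q" for v
    using biproduct_exists that FG Rep_ObjD(1) by blast
  then obtain P i j p q where bp:
    "\<And>v. v \<in> verts Q \<Longrightarrow> biproduct (at_vertex F v) (at_vertex G v) (P v) (i v) (j v) (p v) (q v)"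
    by metis
  note ty [simp] = biproductD(1-17)[OF bp] and sum = biproductD(18)[OF bp]
  note [simp] = ty(14-17)[THEN reassoc]
  define B where "B = mk_rep P (\<lambda>a. i (head Q a) \<odot> act F a \<odot> p (tail Q a) \<oplus> j (head Q a) \<odot> act G a \<odot> q (tail Q a))"
  have B [simp]: "B \<in> Obj R" unfolding B_def by (rule mk_rep_in_Obj) simp_all
  have [simp]: "at_vertex B v = P v" if "v \<in> verts Q" for v using that by (simp add: B_def)
  have [simp]: "act B a = i (head Q a) \<odot> act F a \<odot> p (tail Q a) \<oplus> j (head Q a) \<odot> act G a \<odot> q (tail Q a)"
    if "a \<in> arcs Q" for a using that by (simp add: B_def act_mk_rep)
  have homs [simp]: "mk_hom i \<in> Hom R F B" "mk_hom j \<in> Hom R G B" "mk_hom p \<in> Hom R B F" "mk_hom q \<in> Hom R B G"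
    by (rule mk_hom_in_Hom; simp)+
  have m: "mk_hom p \<cdot>\<^bsub>R\<^esub> mk_hom i \<in> Hom R F F" "mk_hom q \<cdot>\<^bsub>R\<^esub> mk_hom j \<in> Hom R G G"
    "mk_hom p \<cdot>\<^bsub>R\<^esub> mk_hom j \<in> Hom R G F" "mk_hom q \<cdot>\<^bsub>R\<^esub> mk_hom i \<in> Hom R F G"
    "Add R (mk_hom i \<cdot>\<^bsub>R\<^esub> mk_hom p) (mk_hom j \<cdot>\<^bsub>R\<^esub> mk_hom q) \<in> Hom R B B"
    using R.Comp_in_Hom[of F B F] R.Comp_in_Hom[of G B G] R.Comp_in_Hom[of G B F] R.Comp_in_Hom[of F B G]
      R.Comp_in_Hom[of B F B] R.Comp_in_Hom[of B G B] R.Add_in_Hom[of B B] by simp_all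
  have "mk_hom p \<cdot>\<^bsub>R\<^esub> mk_hom i = Ide R F"
    by (rule Rep_Hom_eqI[OF m(1)]) (simp_all add: R.Ide_in_Hom cmp_comp[of _ F F _ _ B] cmp_mk_hom)
  moreover have "mk_hom q \<cdot>\<^bsub>R\<^esub> mk_hom j = Ide R G"
    by (rule Rep_Hom_eqI[OF m(2)]) (simp_all add: R.Ide_in_Hom cmp_comp[of _ G G _ _ B] cmp_mk_hom)
  moreover have "mk_hom p \<cdot>\<^bsub>R\<^esub> mk_hom j = Zero R G F"
    by (rule Rep_Hom_eqI[OF m(3)]) (simp_all add: R.Zero_in_Hom cmp_comp[of _ G F _ _ B] cmp_mk_hom)
  moreover have "mk_hom q \<cdot>\<^bsub>R\<^esub> mk_hom i = Zero R F G"
    by (rule Rep_Hom_eqI[OF m(4)]) (simp_all add: R.Zero_in_Hom cmp_comp[of _ F G _ _ B] cmp_mk_hom)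
  moreover have "Add R (mk_hom i \<cdot>\<^bsub>R\<^esub> mk_hom p) (mk_hom j \<cdot>\<^bsub>R\<^esub> mk_hom q) = Ide R B"
    by (rule Rep_Hom_eqI[OF m(5)])
      (simp_all add: R.Ide_in_Hom cmp_comp[of _ B B "mk_hom i" _ F] cmp_comp[of _ B B "mk_hom j" _ G] cmp_mk_hom sum)
  ultimately show ?thesis unfolding has_biproduct_def using B homs by blast
qed

lemma zero_obj: "is_zero_object C (zero_obj C)"
  unfolding zero_obj_def using ex_zero_object by (rule someI_ex)

lemma zero_obj_in_Obj [simp]: "zero_obj C \<in> Obj C"
  using zero_obj by (simp add: is_zero_object_def)

lemma arrow_to_zero_obj:
  assumes "arrow f" "Cod f = zero_obj C" shows "f = nul (Dom f) (zero_obj C)"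
proof (cases f)
  case (Arr A g B)
  then show ?thesis using assms zero_obj Zero_in_Hom unfolding is_zero_object_def nul_def by auto
qed

lemma arrow_from_zero_obj:
  assumes "arrow f" "Dom f = zero_obj C" shows "f = nul (zero_obj C) (Cod f)"
proof (cases f)
  case (Arr A g B)
  then show ?thesis using assms zero_obj Zero_in_Hom unfolding is_zero_object_def nul_def by auto
qed

lemma Rep_zero: "\<exists>Z. is_zero_object R Z"
proof -
  interpret R: preadditive_category R by (rule preadditive_Rep)
  define Z where "Z = mk_rep (\<lambda>_. zero_obj C) (\<lambda>_. nul (zero_obj C) (zero_obj C))"
  have Z: "Z \<in> Obj R" unfolding Z_def by (rule mk_rep_in_Obj) simp_all
  have [simp]: "at_vertex Z i = zero_obj C" if "i \<in> verts Q" for i using that by (simp add: Z_def)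
  have "f = g" if "T \<in> Obj R" "f \<in> Hom R T Z" "g \<in> Hom R T Z" for T f g
  proof (rule Rep_Hom_eqI[OF that(2,3)])
    fix i assume "i \<in> verts Q"
    then show "cmp T Z f i = cmp T Z g i"
      using arrow_to_zero_obj[of "cmp T Z f i"] arrow_to_zero_obj[of "cmp T Z g i"] that Z by (simp add: Rep_HomD)
  qed
  moreover have "f = g" if "T \<in> Obj R" "f \<in> Hom R Z T" "g \<in> Hom R Z T" for T f g
  proof (rule Rep_Hom_eqI[OF that(2,3)])
    fix i assume "i \<in> verts Q"
    then show "cmp Z T f i = cmp Z T g i"
      using arrow_from_zero_obj[of "cmp Z T f i"] arrow_from_zero_obj[of "cmp Z T g i"] that Z by (simp add: Rep_HomD)
  qed
  ultimately have "is_zero_object R Z"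
    unfolding is_zero_object_def using Z R.Zero_in_Hom by blast
  then show ?thesis ..
qed

text \<open>Makes the calculus of extensions developed for \<open>C\<close> available in
  \<open>Rep Q C\<close>.\<close>

lemma abelian_Rep: "abelian_category R"
proof -
  interpret R: preadditive_category R by (rule preadditive_Rep)
  show ?thesis
  proof
    show "\<exists>Z. is_zero_object R Z" by (rule Rep_zero)
    fix F G \<eta> assume FG: "F \<in> Obj R" "G \<in> Obj R"
    show "has_biproduct R F G" using Rep_biproduct FG .
    show "\<exists>K \<kappa>. is_kernel R F G \<eta> K \<kappa>" if "\<eta> \<in> Hom R F G"
      using Rep_kernel_exists[OF FG that] Rep_kernelI[OF FG _ that] by metis
    show "\<exists>K \<kappa>. is_cokernel R F G \<eta> K \<kappa>" if "\<eta> \<in> Hom R F G"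
      using Rep_cokernel_exists[OF FG that] Rep_cokernelI[OF FG _ that] by metis
    show "\<exists>D \<theta>. D \<in> Obj R \<and> is_kernel R G D \<theta> F \<eta>" if "is_mono R F G \<eta>"
      using Rep_mono_normal FG that .
    show "\<exists>D \<theta>. D \<in> Obj R \<and> is_cokernel R D F \<theta> G \<eta>" if "is_epi R F G \<eta>"
      using quiver_rep.Rep_mono_normal[OF quiver_rep_op, of G F \<eta>] FG that by simp
  qed
qed

lemma Rep_short_exactD:
  assumes "short_exact R F E G \<phi> \<gamma>" "i \<in> verts Q"
  shows "ses (cmp F E \<phi> i) (cmp E G \<gamma> i)"
  using assms Rep_is_kernelD[of E G \<gamma> F \<phi> i] Rep_is_cokernelD[of F E \<phi> G \<gamma> i]
    pointwise_kernel_iff[of E G i \<gamma> F \<phi>] pointwise_cokernel_iff[of F E i \<phi> G \<gamma>]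
  by (simp add: short_exact_def ses_def)

lemma Rep_short_exactI:
  assumes "F \<in> Obj R" "E \<in> Obj R" "G \<in> Obj R" "\<phi> \<in> Hom R F E" "\<gamma> \<in> Hom R E G"
    "\<And>i. i \<in> verts Q \<Longrightarrow> ses (cmp F E \<phi> i) (cmp E G \<gamma> i)"
  shows "short_exact R F E G \<phi> \<gamma>"
  unfolding short_exact_def using assms
  by (auto simp: ses_def pointwise_kernel_iff pointwise_cokernel_iff intro!: Rep_kernelI Rep_cokernelI)

end

section \<open>Products and the right adjoints of evaluation\<close>

context preadditive_category
begin

definition has_product :: "'i set \<Rightarrow> ('i \<Rightarrow> 'o) \<Rightarrow> bool" where
  "has_product I X \<longleftrightarrow> X \<in> I \<rightarrow> Obj C \<and> (\<exists>P p. is_product C I X P p)"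

text \<open>\<open>AB3star\<close> speaks of index sets inside \<open>Field \<kappa>\<close>, but
  the products needed run over paths and outgoing arrows; an injection into
  \<open>Field \<kappa>\<close> reindexes them.\<close>

lemma AB3star_has_product:
  assumes AB: "AB3star C \<kappa>" and \<kappa>: "Card_order \<kappa>" and I: "|I| <o \<kappa>" and X: "X \<in> I \<rightarrow> Obj C"
  shows "has_product I X"
proof -
  have "|I| \<le>o |Field \<kappa>|"
    using I \<kappa> by (meson card_of_Field_ordIso ordIso_symmetric ordLeq_ordIso_trans ordLess_imp_ordLeq)
  then obtain f where f: "inj_on f I" "f ` I \<subseteq> Field \<kappa>"
    using card_of_ordLeq[of I "Field \<kappa>"] by blast
  define J where "J = f ` I"
  have "bij_betw f I J" using f by (simp add: J_def bij_betw_def)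
  then have "|J| <o \<kappa>"
    using I by (meson bij_betw_inv_into card_of_ordIsoI ordIso_ordLess_trans)
  moreover have "X \<circ> inv_into I f \<in> J \<rightarrow> Obj C"
    using X f by (auto simp: J_def)
  ultimately obtain P p where P: "is_product C J (X \<circ> inv_into I f) P p"
    using AB f unfolding AB3star_def J_def by metis
  have "is_product C I X P (p \<circ> f)"
    unfolding is_product_def
  proof (intro conjI ballI allI impI)
    show "P \<in> Obj C" using P by (simp add: is_product_def)
    show "(p \<circ> f) i \<in> Hom C P (X i)" if "i \<in> I" for i
      using P that f by (auto simp: is_product_def J_def)
    fix T g assume T: "T \<in> Obj C" and g: "\<forall>i\<in>I. g i \<in> Hom C T (X i)"
    have "(g \<circ> inv_into I f) j \<in> Hom C T ((X \<circ> inv_into I f) j)" if "j \<in> J" for j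
      using g f that by (auto simp: J_def)
    then have "\<exists>!h. h \<in> Hom C T P \<and> (\<forall>j\<in>J. p j \<cdot> h = (g \<circ> inv_into I f) j)"
      using P[unfolded is_product_def, THEN conjunct2, THEN conjunct2, rule_format, OF T] by blast
    moreover have "(\<forall>j\<in>J. p j \<cdot> h = (g \<circ> inv_into I f) j) \<longleftrightarrow> (\<forall>i\<in>I. (p \<circ> f) i \<cdot> h = g i)" for h
      using f by (auto simp: J_def)
    ultimately show "\<exists>!h. h \<in> Hom C T P \<and> (\<forall>i\<in>I. (p \<circ> f) i \<cdot> h = g i)" by simp
  qed
  then show ?thesis using X by (auto simp: has_product_def)
qed

definition pr :: "'i set \<Rightarrow> ('i \<Rightarrow> 'o) \<Rightarrow> 'i \<Rightarrow> ('o, 'm) arr" where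
  "pr I X i = Arr (Prod C I X) (proj C I X i) (X i)"

definition tup :: "'i set \<Rightarrow> ('i \<Rightarrow> 'o) \<Rightarrow> 'o \<Rightarrow> ('i \<Rightarrow> ('o, 'm) arr) \<Rightarrow> ('o, 'm) arr" where
  "tup I X T h = Arr T (tuple C I X T (\<lambda>i. mor (h i))) (Prod C I X)"

lemma pr_sel [simp]: "Dom (pr I X i) = Prod C I X" "Cod (pr I X i) = X i"
  by (simp_all add: pr_def)

lemma tup_sel [simp]: "Dom (tup I X T h) = T" "Cod (tup I X T h) = Prod C I X"
  by (simp_all add: tup_def)

lemma product_cone:
  assumes "has_product I X" shows "is_product C I X (Prod C I X) (proj C I X)"
proof -
  have "\<exists>c. case c of (P, p) \<Rightarrow> is_product C I X P p" using assms by (auto simp: has_product_def)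
  then show ?thesis unfolding Prod_def proj_def product_cone_def
    using someI_ex[of "\<lambda>c. case c of (P, p) \<Rightarrow> is_product C I X P p"] by (simp add: case_prod_unfold)
qed

lemma Prod_in_Obj [simp]: "has_product I X \<Longrightarrow> Prod C I X \<in> Obj C"
  using product_cone by (auto simp: is_product_def)

lemma arrow_pr [simp]: "\<lbrakk>has_product I X; i \<in> I\<rbrakk> \<Longrightarrow> arrow (pr I X i)"
  using product_cone[of I X] by (auto simp: is_product_def pr_def has_product_def)

lemma tuple_props:
  assumes X: "has_product I X" and T: "T \<in> Obj C" and h: "\<And>i. i \<in> I \<Longrightarrow> h i \<in> Hom C T (X i)"
  shows "tuple C I X T h \<in> Hom C T (Prod C I X)" "i \<in> I \<Longrightarrow> proj C I X i \<cdot> tuple C I X T h = h i"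
proof -
  have "\<exists>!f. f \<in> Hom C T (Prod C I X) \<and> (\<forall>i\<in>I. proj C I X i \<cdot> f = h i)"
    using product_cone[OF X] T h by (auto simp: is_product_def)
  from theI'[OF this, folded tuple_def]
  show "tuple C I X T h \<in> Hom C T (Prod C I X)" "i \<in> I \<Longrightarrow> proj C I X i \<cdot> tuple C I X T h = h i"
    by blast+
qed

lemma tup_props:
  assumes X: "has_product I X" and T: "T \<in> Obj C"
    and h: "\<And>i. i \<in> I \<Longrightarrow> arrow (h i) \<and> Dom (h i) = T \<and> Cod (h i) = X i"
  shows "arrow (tup I X T h)" "i \<in> I \<Longrightarrow> pr I X i \<odot> tup I X T h = h i"
proof -
  have h': "mor (h i) \<in> Hom C T (X i)" if "i \<in> I" for i
    using h[OF that] by (cases "h i") auto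
  show "arrow (tup I X T h)"
    using tuple_props(1)[OF X T h'] X T by (simp add: tup_def)
  show "pr I X i \<odot> tup I X T h = h i" if "i \<in> I"
    using tuple_props(2)[OF X T h'] h[OF that] that by (cases "h i") (simp add: tup_def pr_def comp_def)
qed

lemma product_eqI:
  assumes X: "has_product I X" and x: "arrow x" "Cod x = Prod C I X"
    and y: "arrow y" "Cod y = Prod C I X" "Dom x = Dom y"
    and eq: "\<And>i. i \<in> I \<Longrightarrow> pr I X i \<odot> x = pr I X i \<odot> y"
  shows "x = y"
proof -
  obtain T f where [simp]: "x = Arr T f (Prod C I X)" using x by (cases x) auto
  obtain g where [simp]: "y = Arr T g (Prod C I X)" using y by (cases y) auto
  have T: "T \<in> Obj C" and f: "f \<in> Hom C T (Prod C I X)" and g: "g \<in> Hom C T (Prod C I X)"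
    using x y by auto
  have pf: "proj C I X i \<cdot> f = proj C I X i \<cdot> g" if "i \<in> I" for i
    using eq[OF that] by (simp add: comp_def pr_def)
  have pg: "proj C I X i \<cdot> g \<in> Hom C T (X i)" if "i \<in> I" for i
    using arrow_pr[OF X that] T g unfolding pr_def by (auto intro: Comp_in_Hom)
  have "\<exists>!h. h \<in> Hom C T (Prod C I X) \<and> (\<forall>i\<in>I. proj C I X i \<cdot> h = proj C I X i \<cdot> g)"
    by (rule product_cone[OF X, unfolded is_product_def, THEN conjunct2, THEN conjunct2, rule_format, OF T])
      (rule pg)
  then have "f = g" using f g pf by blast
  then show ?thesis by simp
qed

end

section \<open>Closure of vanishing Ext under products and extensions\<close>

context abelian_category
begin

lemma ext_vanishesI:
  assumes "\<And>f g. \<lbrakk>ses f g; Dom f = Y; Cod g = X\<rbrakk> \<Longrightarrow>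
    \<exists>s. arrow s \<and> Dom s = X \<and> Cod s = Cod f \<and> g \<odot> s = idn X"
  shows "ext_vanishes C X Y"
  unfolding ext_vanishes_def
proof (intro allI impI)
  fix E f g assume "short_exact C Y E X f g"
  then have "ses (Arr Y f E) (Arr E g X)" by (simp add: short_exact_iff)
  then obtain s where s: "arrow s" "Dom s = X" "Cod s = E" "Arr E g X \<odot> s = idn X"
    using assms by fastforce
  then obtain s' where "s = Arr X s' E" by (cases s) auto
  then show "\<exists>s\<in>Hom C X E. g \<cdot> s = Ide C X" using s by (auto simp: comp_def idn_def)
qed

text \<open>The difference of the identity and \<open>f \<odot> r\<close> kills \<open>f\<close>, so
  it descends along \<open>g\<close> to a section.\<close>

lemma ext_vanishes_retractionI:
  assumes retr: "\<And>f g. \<lbrakk>ses f g; Dom f = Y; Cod g = X\<rbrakk> \<Longrightarrow>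
    \<exists>r. arrow r \<and> Dom r = Cod f \<and> Cod r = Y \<and> r \<odot> f = idn Y"
  shows "ext_vanishes C X Y"
proof (rule ext_vanishesI)
  fix f g assume fg: "ses f g" and Y: "Dom f = Y" and X: "Cod g = X"
  note [simp] = sesD(1-4)[OF fg]
  obtain r where r: "arrow r" "Dom r = Cod f" "Cod r = Dom f" and rf: "r \<odot> f = idn (Dom f)"
    using retr[OF fg Y X] Y by auto
  define e where "e = idn (Cod f) \<oplus> \<ominus>(f \<odot> r)"
  have e: "arrow e" "Dom e = Cod f" "Cod e = Cod f" "e \<odot> f = nul (Dom f) (Cod f)" "g \<odot> e = g"
    using r rf reassoc[OF sesD(4)[OF fg], of r] by (simp_all add: e_def)
  obtain s where s: "arrow s" "Dom s = Cod g" "Cod s = Cod f" "s \<odot> g = e"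
    using cokernel_lift[OF sesD(8)[OF fg], of e] e by auto
  have "g \<odot> s = idn (Cod g)"
    by (rule epi_cancel[OF sesD(6)[OF fg]]) (use s e in simp_all)
  then show "\<exists>s. arrow s \<and> Dom s = X \<and> Cod s = Cod f \<and> g \<odot> s = idn X"
    using s X by auto
qed

lemma ext_vanishes_retraction_HomI:
  assumes retr: "\<And>E f g. short_exact C Y E X f g \<Longrightarrow> \<exists>r\<in>Hom C E Y. r \<cdot> f = Ide C Y"
  shows "ext_vanishes C X Y"
proof (rule ext_vanishes_retractionI)
  fix f g assume fg: "ses f g" and Y: "Dom f = Y" and X: "Cod g = X"
  obtain f' E where f: "f = Arr Y f' E" using Y by (cases f) auto
  obtain g' where g: "g = Arr E g' X" using X f sesD(3)[OF fg] by (cases g) auto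
  obtain r where "r \<in> Hom C E Y" "r \<cdot> f' = Ide C Y"
    using retr[of E f' g'] fg unfolding short_exact_iff f g by blast
  then show "\<exists>r. arrow r \<and> Dom r = Cod f \<and> Cod r = Y \<and> r \<odot> f = idn Y"
    using sesD(1)[OF fg] by (intro exI[of _ "Arr E r Y"]) (simp add: f comp_def idn_def)
qed

text \<open>Each projection extends to the middle term, and the tuple of these extensions is a
  retraction.\<close>

lemma ext_vanishes_product:
  assumes P: "has_product I Y" and ext: "\<And>i. i \<in> I \<Longrightarrow> ext_vanishes C X (Y i)"
  shows "ext_vanishes C X (Prod C I Y)"
proof (rule ext_vanishes_retractionI)
  fix f g assume fg: "ses f g" and Y: "Dom f = Prod C I Y" and X: "Cod g = X"
  note [simp] = sesD(1-4)[OF fg]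
  have "\<exists>r. arrow r \<and> Dom r = Cod f \<and> Cod r = Y i \<and> r \<odot> f = pr I Y i" if "i \<in> I" for i
    using extend_along_mono[OF fg, of "pr I Y i"] ext[OF that] P that X Y by (metis arrow_pr pr_sel)
  then obtain r where r: "\<And>i. i \<in> I \<Longrightarrow> arrow (r i) \<and> Dom (r i) = Cod f \<and> Cod (r i) = Y i"
    and rf: "\<And>i. i \<in> I \<Longrightarrow> r i \<odot> f = pr I Y i" by metis
  have t: "arrow (tup I Y (Cod f) r)" "i \<in> I \<Longrightarrow> pr I Y i \<odot> tup I Y (Cod f) r = r i" for i
    using tup_props[OF P _ r] by simp_all
  have "tup I Y (Cod f) r \<odot> f = idn (Prod C I Y)"
    by (rule product_eqI[OF P]) (use P Y t rf reassoc[OF t(2)] in simp_all)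
  then show "\<exists>r. arrow r \<and> Dom r = Cod f \<and> Cod r = Prod C I Y \<and> r \<odot> f = idn (Prod C I Y)"
    using t by auto
qed

text \<open>Stands in for exactness of Ext^1 at the middle of \<open>k\<close> and \<open>p\<close>.
  For an extension of \<open>X\<close> by \<open>Cod k\<close>, the morphism \<open>p\<close>
  extends to the middle term, and a section exists already inside the kernel of this extended
  morphism.\<close>

lemma ext_vanishes_extension:
  assumes kp: "ses k p" and K: "ext_vanishes C X (Dom k)" and P: "ext_vanishes C X (Cod p)"
  shows "ext_vanishes C X (Cod k)"
proof (rule ext_vanishesI)
  fix f g assume fg: "ses f g" and Y: "Dom f = Cod k" and X: "Cod g = X"
  note [simp] = sesD(1-4)[OF fg] sesD(1-4)[OF kp]
  obtain u where u: "arrow u" "Dom u = Cod f" "Cod u = Cod p" "u \<odot> f = p"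
    using extend_along_mono[OF fg, of p] X Y P by auto
  have uf: "ses k (u \<odot> f)" and K': "ext_vanishes C (Cod g) (Dom k)" using kp K X u(4) by simp_all
  obtain s where "arrow s" "Dom s = Cod g" "Cod s = Cod f" "g \<odot> s = idn (Cod g)"
    using section_into_kernel[OF fg u(1,2) uf K'] .
  then show "\<exists>s. arrow s \<and> Dom s = X \<and> Cod s = Cod f \<and> g \<odot> s = idn X" using X by auto
qed

end

section \<open>Cardinal bounds that make the required products exist\<close>

lemma Card_order_csize:
  fixes R :: "'c rel set"
  assumes "\<forall>r\<in>R. Card_order r" shows "Card_order (csize R)"
  using csup_is_lub(1)[OF assms] by (simp add: csize_def cardSuc_Card_order card_of_Card_order)

text \<open>\<open>csize\<close> is the least cardinal strictly above all members, so a weak bound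
  on the supremum becomes the strict bound asked of index sets.\<close>

lemma lccn_ordLeqD:
  assumes "lccn Q \<le>o \<kappa>" "Card_order \<kappa>" "i \<in> verts Q" "j \<in> verts Q"
  shows "|paths Q j i| <o \<kappa>"
proof -
  let ?R = "\<lambda>i. (\<lambda>j. |paths Q j i| ) ` verts Q"
  have co: "\<forall>r\<in>(\<lambda>i. csize (?R i)) ` verts Q. Card_order r"
    by (auto intro!: Card_order_csize card_of_Card_order)
  have "csize (?R i) \<le>o lccn Q"
    unfolding lccn_def using assms(3) by (intro csup_is_lub(2)[OF co]) auto
  then have "csize (?R i) \<le>o \<kappa>" using assms(1) ordLeq_transitive by blast
  then show ?thesis using csize_ordLeq_iff[of "?R i" \<kappa>] assms by (auto simp: card_of_Card_order)
qed

lemma rmcn_ordLeqD: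
  assumes "rmcn Q \<le>o \<kappa>" "Card_order \<kappa>" "i \<in> verts Q"
  shows "|out_arcs Q i| <o \<kappa>"
  using csize_ordLeq_iff[of "(\<lambda>i. |out_arcs Q i| ) ` verts Q" \<kappa>] assms by (auto simp: rmcn_def card_of_Card_order)

section \<open>Paths, and the adjunction between evaluation at a vertex and
  \<open>g_obj\<close>\<close>

context quiver_rep
begin

lemma Nil_in_paths: "i \<in> verts Q \<Longrightarrow> [] \<in> paths Q i i"
  by (simp add: paths_def awalk_def)

lemma Cons_in_paths:
  "\<alpha> \<in> arcs Q \<Longrightarrow> \<alpha> # \<rho> \<in> paths Q (tail Q \<alpha>) i \<longleftrightarrow> \<rho> \<in> paths Q (head Q \<alpha>) i"
  by (auto simp: paths_def awalk_def)

lemma paths_cases: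
  assumes "\<rho> \<in> paths Q j i"
  obtains "\<rho> = []" "j = i" "i \<in> verts Q"
    | \<alpha> \<sigma> where "\<rho> = \<alpha> # \<sigma>" "\<alpha> \<in> arcs Q" "tail Q \<alpha> = j" "\<sigma> \<in> paths Q (head Q \<alpha>) i"
  using assms by (cases \<rho>) (auto simp: paths_def awalk_def)

primrec pact :: "('v, 'a, 'o, 'm) rep \<Rightarrow> 'v \<Rightarrow> 'a list \<Rightarrow> ('o, 'm) arr" where
  "pact F j [] = idn (at_vertex F j)"
| "pact F j (\<alpha> # \<rho>) = pact F (head Q \<alpha>) \<rho> \<odot> act F \<alpha>"

lemma pact_typing:
  assumes "F \<in> Obj R" "\<rho> \<in> paths Q j i"
  shows "arrow (pact F j \<rho>) \<and> Dom (pact F j \<rho>) = at_vertex F j \<and> Cod (pact F j \<rho>) = at_vertex F i"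
  using assms(2)
proof (induction \<rho> arbitrary: j)
  case Nil
  then show ?case using assms(1) by (auto elim: paths_cases)
next
  case (Cons \<alpha> \<rho>)
  then have "\<alpha> \<in> arcs Q" "tail Q \<alpha> = j" "\<rho> \<in> paths Q (head Q \<alpha>) i" by (auto elim: paths_cases)
  then show ?case using Cons.IH[of "head Q \<alpha>"] assms(1) by auto
qed

text \<open>Isolates what the cardinal bound provides, which keeps \<open>\<kappa>\<close> out of
  the adjunction.\<close>

definition paths_prod :: "'v \<Rightarrow> bool" where
  "paths_prod i \<longleftrightarrow> i \<in> verts Q \<and> (\<forall>j\<in>verts Q. \<forall>X\<in>Obj C. has_product (paths Q j i) (\<lambda>_. X))"

abbreviation gpr :: "'v \<Rightarrow> 'o \<Rightarrow> 'v \<Rightarrow> 'a list \<Rightarrow> ('o, 'm) arr" where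
  "gpr i X j \<equiv> pr (paths Q j i) (\<lambda>_. X)"

context
  fixes i assumes i: "paths_prod i"
begin

lemma i_vert [simp]: "i \<in> verts Q"
  using i by (simp add: paths_prod_def)

lemma gprod [simp]: "\<lbrakk>j \<in> verts Q; X \<in> Obj C\<rbrakk> \<Longrightarrow> has_product (paths Q j i) (\<lambda>_. X)"
  using i by (simp add: paths_prod_def)

lemma at_vertex_g [simp]: "j \<in> verts Q \<Longrightarrow> at_vertex (g_obj Q C i X) j = Prod C (paths Q j i) (\<lambda>_. X)"
  by (simp add: g_obj_def)

lemma act_g:
  assumes X: "X \<in> Obj C" and \<alpha>: "\<alpha> \<in> arcs Q"
  shows "arrow (act (g_obj Q C i X) \<alpha>)"
    "\<rho> \<in> paths Q (head Q \<alpha>) i \<Longrightarrow>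
       gpr i X (head Q \<alpha>) \<rho> \<odot> act (g_obj Q C i X) \<alpha> = gpr i X (tail Q \<alpha>) (\<alpha> # \<rho>)"
proof -
  let ?h = "\<lambda>\<rho>. gpr i X (tail Q \<alpha>) (\<alpha> # \<rho>)"
  have e: "act (g_obj Q C i X) \<alpha> = tup (paths Q (head Q \<alpha>) i) (\<lambda>_. X) (Prod C (paths Q (tail Q \<alpha>) i) (\<lambda>_. X)) ?h"
    using \<alpha> by (simp add: act_def tup_def g_obj_def pr_def)
  have h: "arrow (?h \<rho>) \<and> Dom (?h \<rho>) = Prod C (paths Q (tail Q \<alpha>) i) (\<lambda>_. X) \<and> Cod (?h \<rho>) = X"
    if "\<rho> \<in> paths Q (head Q \<alpha>) i" for \<rho>
    using that \<alpha> X Cons_in_paths by auto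
  show "arrow (act (g_obj Q C i X) \<alpha>)"
    unfolding e using \<alpha> X h by (intro tup_props(1)) auto
  show "\<rho> \<in> paths Q (head Q \<alpha>) i \<Longrightarrow>
       gpr i X (head Q \<alpha>) \<rho> \<odot> act (g_obj Q C i X) \<alpha> = gpr i X (tail Q \<alpha>) (\<alpha> # \<rho>)"
    unfolding e using \<alpha> X h tup_props(2)[of "paths Q (head Q \<alpha>) i" "\<lambda>_. X" _ ?h] by auto
qed

lemma g_obj_in_Obj [simp]: "X \<in> Obj C \<Longrightarrow> g_obj Q C i X \<in> Obj R"
  unfolding Rep_Obj_iff using act_g(1) by auto (simp_all add: g_obj_def)

text \<open>The functor \<open>g\<^sub>i\<close> is right adjoint to evaluation at \<open>i\<close>: a morphism \<open>F \<rightarrow> g\<^sub>i(X)\<close>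
  amounts to its component at \<open>i\<close> followed by the projection onto the factor of the trivial path.\<close>

lemma g_transpose_unique:
  assumes X: "X \<in> Obj C" and F: "F \<in> Obj R" and \<eta>: "\<eta> \<in> Hom R F (g_obj Q C i X)"
    and j: "j \<in> verts Q" and \<rho>: "\<rho> \<in> paths Q j i"
  shows "gpr i X j \<rho> \<odot> cmp F (g_obj Q C i X) \<eta> j =
    gpr i X i [] \<odot> cmp F (g_obj Q C i X) \<eta> i \<odot> pact F j \<rho>"
  using j \<rho>
proof (induction \<rho> arbitrary: j)
  case Nil
  then have "j = i" by (auto elim: paths_cases)
  then show ?case using X F \<eta> Nil_in_paths by (simp add: Rep_HomD)
next
  case (Cons \<alpha> \<rho>)
  let ?G = "g_obj Q C i X"
  have \<alpha>: "\<alpha> \<in> arcs Q" "tail Q \<alpha> = j" and \<rho>: "\<rho> \<in> paths Q (head Q \<alpha>) i"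
    using Cons.prems by (auto elim: paths_cases)
  note [simp] = Rep_HomD[OF \<eta> F g_obj_in_Obj[OF X]] pact_typing[OF F \<rho>] F X \<alpha>(1) \<rho>
  have nil: "[] \<in> paths Q i i" using Nil_in_paths by simp
  have c: "arrow (cmp F ?G \<eta> j)" using Cons.prems by simp
  \<comment> \<open>Peeling off the first arrow: its action on \<open>?G\<close> shifts the factor
    at \<open>\<alpha> # \<rho>\<close> to the one at \<open>\<rho>\<close>, and naturality then
    moves it over to \<open>F\<close>.\<close>
  have "gpr i X j (\<alpha> # \<rho>) \<odot> cmp F ?G \<eta> j = gpr i X (head Q \<alpha>) \<rho> \<odot> act ?G \<alpha> \<odot> cmp F ?G \<eta> j"
    using reassoc[OF act_g(2)[OF X \<alpha>(1) \<rho>], of "cmp F ?G \<eta> j"] act_g(1)[OF X \<alpha>(1)] c \<alpha>(2)[symmetric] by simp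
  also have "\<dots> = gpr i X (head Q \<alpha>) \<rho> \<odot> cmp F ?G \<eta> (head Q \<alpha>) \<odot> act F \<alpha>"
    using \<alpha>(2) by simp
  also have "\<dots> = (gpr i X i [] \<odot> cmp F ?G \<eta> i \<odot> pact F (head Q \<alpha>) \<rho>) \<odot> act F \<alpha>"
    using reassoc[OF Cons.IH[of "head Q \<alpha>"], of "act F \<alpha>"] by simp
  finally show ?case using nil by simp
qed

lemma g_transpose_eqI:
  assumes X: "X \<in> Obj C" and F: "F \<in> Obj R"
    and \<eta>: "\<eta> \<in> Hom R F (g_obj Q C i X)" and \<theta>: "\<theta> \<in> Hom R F (g_obj Q C i X)"
    and eq: "gpr i X i [] \<odot> cmp F (g_obj Q C i X) \<eta> i = gpr i X i [] \<odot> cmp F (g_obj Q C i X) \<theta> i"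
  shows "\<eta> = \<theta>"
proof (rule Rep_Hom_eqI[OF \<eta> \<theta>])
  fix j assume j: "j \<in> verts Q"
  let ?G = "g_obj Q C i X"
  note [simp] = Rep_HomD(1)[OF \<eta> F g_obj_in_Obj[OF X]] Rep_HomD(1)[OF \<theta> F g_obj_in_Obj[OF X]] X F
    Nil_in_paths[of i]
  show "cmp F ?G \<eta> j = cmp F ?G \<theta> j"
  proof (rule product_eqI[of "paths Q j i" "\<lambda>_. X"])
    fix \<rho> assume \<rho>: "\<rho> \<in> paths Q j i"
    then show "gpr i X j \<rho> \<odot> cmp F ?G \<eta> j = gpr i X j \<rho> \<odot> cmp F ?G \<theta> j"
      using g_transpose_unique[OF X F \<eta> j \<rho>] g_transpose_unique[OF X F \<theta> j \<rho>]
        reassoc[OF eq, of "pact F j \<rho>"] pact_typing[OF F \<rho>] by simp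
  qed (use j in simp_all)
qed

lemma g_transpose_exists:
  assumes F: "F \<in> Obj R" and h: "arrow h" "Dom h = at_vertex F i" "Cod h = X"
  obtains \<eta> where "\<eta> \<in> Hom R F (g_obj Q C i X)" "gpr i X i [] \<odot> cmp F (g_obj Q C i X) \<eta> i = h"
proof -
  let ?G = "g_obj Q C i X"
  have X: "X \<in> Obj C" using h by auto
  note [simp] = X F h Nil_in_paths[of i]
  \<comment> \<open>By \<open>g_transpose_unique\<close> the factor at \<open>\<rho>\<close> can
    only be \<open>h\<close> after the action of \<open>\<rho>\<close>.\<close>
  define u where "u j = tup (paths Q j i) (\<lambda>_. X) (at_vertex F j) (\<lambda>\<rho>. h \<odot> pact F j \<rho>)" for j
  have u: "arrow (u j)" "\<rho> \<in> paths Q j i \<Longrightarrow> gpr i X j \<rho> \<odot> u j = h \<odot> pact F j \<rho>"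
    if "j \<in> verts Q" for j \<rho>
    unfolding u_def using that pact_typing[OF F, of _ j i]
    by (auto intro!: tup_props)
  have [simp]: "Dom (u j) = at_vertex F j" "Cod (u j) = Prod C (paths Q j i) (\<lambda>_. X)" for j
    by (simp_all add: u_def)
  have nat: "u (head Q \<alpha>) \<odot> act F \<alpha> = act ?G \<alpha> \<odot> u (tail Q \<alpha>)" if \<alpha>: "\<alpha> \<in> arcs Q" for \<alpha>
  proof (rule product_eqI[of "paths Q (head Q \<alpha>) i" "\<lambda>_. X"])
    fix \<rho> assume \<rho>: "\<rho> \<in> paths Q (head Q \<alpha>) i"
    have "gpr i X (head Q \<alpha>) \<rho> \<odot> u (head Q \<alpha>) \<odot> act F \<alpha> = h \<odot> pact F (head Q \<alpha>) \<rho> \<odot> act F \<alpha>"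
      using reassoc[OF u(2)[OF _ \<rho>], of "act F \<alpha>"] \<alpha> \<rho> u(1) pact_typing[OF F \<rho>] by simp
    also have "\<dots> = gpr i X (tail Q \<alpha>) (\<alpha> # \<rho>) \<odot> u (tail Q \<alpha>)"
      using u(2)[of "tail Q \<alpha>" "\<alpha> # \<rho>"] Cons_in_paths \<alpha> \<rho> by simp
    also have "\<dots> = gpr i X (head Q \<alpha>) \<rho> \<odot> act ?G \<alpha> \<odot> u (tail Q \<alpha>)"
      using reassoc[OF act_g(2)[OF X \<alpha> \<rho>], of "u (tail Q \<alpha>)"] act_g(1)[OF X \<alpha>] u(1) \<alpha> \<rho> by simp
    finally show "gpr i X (head Q \<alpha>) \<rho> \<odot> u (head Q \<alpha>) \<odot> act F \<alpha> =
      gpr i X (head Q \<alpha>) \<rho> \<odot> act ?G \<alpha> \<odot> u (tail Q \<alpha>)" .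
  qed (use \<alpha> u(1) act_g(1)[OF X] in simp_all)
  have hom: "mk_hom u \<in> Hom R F ?G"
    by (rule mk_hom_in_Hom) (use nat u(1) in simp_all)
  have "cmp F ?G (mk_hom u) i = u i" by (rule cmp_mk_hom) simp_all
  moreover have "gpr i X i [] \<odot> u i = h" using u(2)[of i "[]"] by simp
  ultimately have "gpr i X i [] \<odot> cmp F ?G (mk_hom u) i = h" by metis
  with hom show thesis by (rule that)
qed

lemma cmp_g_mor:
  assumes f: "arrow f" "Dom f = X" "Cod f = Y" and j: "j \<in> verts Q"
  shows "arrow (cmp (g_obj Q C i X) (g_obj Q C i Y) (g_mor Q C i X Y (mor f)) j)"
    "\<rho> \<in> paths Q j i \<Longrightarrow> gpr i Y j \<rho> \<odot> cmp (g_obj Q C i X) (g_obj Q C i Y) (g_mor Q C i X Y (mor f)) j =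
      f \<odot> gpr i X j \<rho>"
proof -
  have XY: "X \<in> Obj C" "Y \<in> Obj C" using f by auto
  have e: "cmp (g_obj Q C i X) (g_obj Q C i Y) (g_mor Q C i X Y (mor f)) j =
      tup (paths Q j i) (\<lambda>_. Y) (Prod C (paths Q j i) (\<lambda>_. X)) (\<lambda>\<rho>. f \<odot> gpr i X j \<rho>)"
    using j by (simp add: cmp_def tup_def g_mor_def comp_def pr_def)
  show "arrow (cmp (g_obj Q C i X) (g_obj Q C i Y) (g_mor Q C i X Y (mor f)) j)"
    "\<rho> \<in> paths Q j i \<Longrightarrow> gpr i Y j \<rho> \<odot> cmp (g_obj Q C i X) (g_obj Q C i Y) (g_mor Q C i X Y (mor f)) j =
      f \<odot> gpr i X j \<rho>"
    unfolding e using XY f j by (auto intro!: tup_props)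
qed

lemma ext_vanishes_gI:
  assumes F: "F \<in> Obj R" and X: "X \<in> Obj C" and ext: "ext_vanishes C (at_vertex F i) X"
  shows "ext_vanishes R F (g_obj Q C i X)"
proof -
  interpret R: abelian_category R by (rule abelian_Rep)
  let ?G = "g_obj Q C i X"
  show ?thesis
  proof (rule R.ext_vanishes_retraction_HomI)
    fix E \<phi> \<gamma> assume se: "short_exact R ?G E F \<phi> \<gamma>"
    have E: "E \<in> Obj R" "\<phi> \<in> Hom R ?G E" using se by (auto simp: short_exact_def is_kernel_def)
    note [simp] = F X E(1) Nil_in_paths[of i] Rep_HomD(1)[OF E(2) g_obj_in_Obj[OF X] E(1)]
    have s: "ses (cmp ?G E \<phi> i) (cmp E F \<gamma> i)" using Rep_short_exactD[OF se] by simp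
    obtain r where r: "arrow r" "Dom r = at_vertex E i" "Cod r = X" "r \<odot> cmp ?G E \<phi> i = gpr i X i []"
      using extend_along_mono[OF s, of "gpr i X i []"] ext by auto
    obtain \<eta> where \<eta>: "\<eta> \<in> Hom R E ?G" "gpr i X i [] \<odot> cmp E ?G \<eta> i = r"
      using g_transpose_exists[OF E(1) r(1-3)] .
    note [simp] = Rep_HomD(1)[OF \<eta>(1) E(1) g_obj_in_Obj[OF X]]
    \<comment> \<open>By the adjunction, endomorphisms of \<open>?G\<close> agree once they agree on
      the trivial-path factor at \<open>i\<close>; there, \<open>r\<close> was chosen to extend the
      projection.\<close>
    have "\<eta> \<cdot>\<^bsub>R\<^esub> \<phi> = Ide R ?G"
    proof (rule g_transpose_eqI[OF X g_obj_in_Obj[OF X]])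
      show "\<eta> \<cdot>\<^bsub>R\<^esub> \<phi> \<in> Hom R ?G ?G" using R.Comp_in_Hom[of ?G E ?G] E \<eta> by simp
      show "Ide R ?G \<in> Hom R ?G ?G" using R.Ide_in_Hom by simp
      show "gpr i X i [] \<odot> cmp ?G ?G (\<eta> \<cdot>\<^bsub>R\<^esub> \<phi>) i = gpr i X i [] \<odot> cmp ?G ?G (Ide R ?G) i"
        using reassoc[OF \<eta>(2), of "cmp ?G E \<phi> i"] r by (simp add: cmp_comp[of i ?G ?G \<eta> \<phi> E])
    qed
    then show "\<exists>r\<in>Hom R E ?G. r \<cdot>\<^bsub>R\<^esub> \<phi> = Ide R ?G" using \<eta> by blast
  qed
qed

lemma ext_vanishes_gD:
  assumes exact: "exact_functor C R (g_obj Q C i) (g_mor Q C i)"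
    and F: "F \<in> Obj R" and X: "X \<in> Obj C" and ext: "ext_vanishes R F (g_obj Q C i X)"
  shows "ext_vanishes C (at_vertex F i) X"
proof (rule ext_vanishesI)
  interpret R: abelian_category R by (rule abelian_Rep)
  fix f g assume fg: "ses f g" and X': "Dom f = X" and Y: "Cod g = at_vertex F i"
  define E where "E = Cod f"
  let ?Y = "at_vertex F i" and ?G = "\<lambda>X. g_obj Q C i X"
  have d: "f = Arr X (mor f) E" "g = Arr E (mor g) ?Y"
    using X' Y sesD(3)[OF fg] by (cases f, simp add: E_def, cases g, simp add: E_def)
  have [simp]: "E \<in> Obj C" "?Y \<in> Obj C" "Dom g = E" using sesD[OF fg] F by (auto simp: E_def)
  have "short_exact C X E ?Y (mor f) (mor g)" unfolding short_exact_iff using fg d by simp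
  then have se: "short_exact R (?G X) (?G E) (?G ?Y) (g_mor Q C i X E (mor f)) (g_mor Q C i E ?Y (mor g))"
    using exact unfolding exact_functor_def by blast
  \<comment> \<open>This is the unit of the adjunction at \<open>F\<close>.\<close>
  obtain \<eta> where \<eta>: "\<eta> \<in> Hom R F (?G ?Y)" "gpr i ?Y i [] \<odot> cmp F (?G ?Y) \<eta> i = idn ?Y"
    using g_transpose_exists[OF F, of "idn ?Y" ?Y] by auto
  obtain \<theta> where \<theta>: "\<theta> \<in> Hom R F (?G E)" "g_mor Q C i E ?Y (mor g) \<cdot>\<^bsub>R\<^esub> \<theta> = \<eta>"
    using R.lift_Hom[OF se F \<eta>(1) ext] .
  note [simp] = Rep_HomD(1)[OF \<theta>(1) F g_obj_in_Obj] Nil_in_paths[of i] sesD(1,2)[OF fg]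
    cmp_g_mor(1)[of g E ?Y] Y
  \<comment> \<open>The transpose of the lift is the section sought: \<open>g\<close> commutes with
    the trivial-path projections, which turns the lift back into the unit, and the transpose of the
    unit is the identity.\<close>
  have "g \<odot> gpr i E i [] \<odot> cmp F (?G E) \<theta> i = idn ?Y"
    using cmp_comp[of i F "?G ?Y" "g_mor Q C i E ?Y (mor g)" \<theta> "?G E"] \<theta>(2) \<eta>(2)
      reassoc[OF cmp_g_mor(2)[of g E ?Y i "[]"], of "cmp F (?G E) \<theta> i"] by simp
  then show "\<exists>s. arrow s \<and> Dom s = at_vertex F i \<and> Cod s = Cod f \<and> g \<odot> s = idn (at_vertex F i)"
    by (intro exI[of _ "gpr i E i [] \<odot> cmp F (?G E) \<theta> i"]) (simp add: E_def[symmetric])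
qed

end

end

section \<open>Stalks and the class Psi\<close>

context quiver_rep
begin

lemma at_vertex_s [simp]:
  "j \<in> verts Q \<Longrightarrow> at_vertex (s_obj Q C i X) j = (if j = i then X else zero_obj C)"
  by (simp add: s_obj_def)

lemma act_s [simp]:
  "\<alpha> \<in> arcs Q \<Longrightarrow> act (s_obj Q C i X) \<alpha> =
     nul (at_vertex (s_obj Q C i X) (tail Q \<alpha>)) (at_vertex (s_obj Q C i X) (head Q \<alpha>))"
  by (simp add: act_def nul_def) (simp add: s_obj_def Let_def)

lemma s_obj_in_Obj [simp]: "X \<in> Obj C \<Longrightarrow> s_obj Q C i X \<in> Obj R"
  unfolding Rep_Obj_iff by (auto simp: act_s) (simp_all add: s_obj_def Let_def)

lemma nul_zero_obj: "nul (zero_obj C) (zero_obj C) = idn (zero_obj C)"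
  using arrow_to_zero_obj[of "idn (zero_obj C)"] by simp

text \<open>The shape of the stalk extension built in \<open>section_from_stalk\<close> at every
  vertex other than that of the stalk.\<close>

lemma ses_onto_zero_obj: "A \<in> Obj C \<Longrightarrow> ses (idn A) (nul A (zero_obj C))"
proof -
  assume A: "A \<in> Obj C"
  have "epi (nul A (zero_obj C))"
    using A arrow_from_zero_obj by (auto simp: epi_def)
  moreover have "kernel (nul A (zero_obj C)) (idn A)"
    using A by (auto simp: kernel_def mono_def)
  ultimately show ?thesis by (rule epi_kernel_ses)
qed

lemma ext_vanishes_zero_obj: "ext_vanishes C (zero_obj C) Y"
proof (rule ext_vanishesI)
  fix f g assume fg: "ses f g" "Cod g = zero_obj C"
  note [simp] = sesD(1-3)[OF fg(1)]
  show "\<exists>s. arrow s \<and> Dom s = zero_obj C \<and> Cod s = Cod f \<and> g \<odot> s = idn (zero_obj C)"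
    by (rule exI[of _ "nul (zero_obj C) (Cod f)"]) (simp add: fg(2) nul_zero_obj)
qed

abbreviation out_prod :: "('v, 'a, 'o, 'm) rep \<Rightarrow> 'v \<Rightarrow> 'o" where
  "out_prod F i \<equiv> Prod C (out_arcs Q i) (\<lambda>\<alpha>. at_vertex F (head Q \<alpha>))"

abbreviation out_pr :: "('v, 'a, 'o, 'm) rep \<Rightarrow> 'v \<Rightarrow> 'a \<Rightarrow> ('o, 'm) arr" where
  "out_pr F i \<equiv> pr (out_arcs Q i) (\<lambda>\<alpha>. at_vertex F (head Q \<alpha>))"

definition psi_arr :: "('v, 'a, 'o, 'm) rep \<Rightarrow> 'v \<Rightarrow> ('o, 'm) arr" where
  "psi_arr F i = Arr (at_vertex F i) (psi Q C F i) (out_prod F i)"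

lemma psi_arr_sel [simp]: "Dom (psi_arr F i) = at_vertex F i" "Cod (psi_arr F i) = out_prod F i"
  by (simp_all add: psi_arr_def)

text \<open>The counterpart of \<open>paths_prod\<close> for the codomains of
  \<open>psi_arr\<close>.\<close>

definition out_products :: bool where
  "out_products \<longleftrightarrow> (\<forall>i\<in>verts Q. \<forall>F\<in>Obj R. has_product (out_arcs Q i) (\<lambda>\<alpha>. at_vertex F (head Q \<alpha>)))"

context
  assumes out: out_products
begin

lemma out_has_product [simp]:
  "\<lbrakk>F \<in> Obj R; i \<in> verts Q\<rbrakk> \<Longrightarrow> has_product (out_arcs Q i) (\<lambda>\<alpha>. at_vertex F (head Q \<alpha>))"
  using out by (simp add: out_products_def)

lemma out_prod_in_Obj [simp]: "\<lbrakk>F \<in> Obj R; i \<in> verts Q\<rbrakk> \<Longrightarrow> out_prod F i \<in> Obj C"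
  by simp

lemma psi_arr_props:
  assumes F: "F \<in> Obj R" and i: "i \<in> verts Q"
  shows "arrow (psi_arr F i)" "\<lbrakk>\<alpha> \<in> arcs Q; tail Q \<alpha> = i\<rbrakk> \<Longrightarrow> out_pr F i \<alpha> \<odot> psi_arr F i = act F \<alpha>"
proof -
  have a: "arrow (act F \<alpha>) \<and> Dom (act F \<alpha>) = at_vertex F i \<and> Cod (act F \<alpha>) = at_vertex F (head Q \<alpha>)"
    if "\<alpha> \<in> out_arcs Q i" for \<alpha>
    using that F by auto
  have "psi_arr F i = tup (out_arcs Q i) (\<lambda>\<alpha>. at_vertex F (head Q \<alpha>)) (at_vertex F i) (act F)"
    by (simp add: psi_arr_def tup_def psi_def act_def)
  then show "arrow (psi_arr F i)"
    "\<lbrakk>\<alpha> \<in> arcs Q; tail Q \<alpha> = i\<rbrakk> \<Longrightarrow> out_pr F i \<alpha> \<odot> psi_arr F i = act F \<alpha>"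
    using tup_props[OF out_has_product[OF F i] Rep_ObjD(1)[OF F i] a] by auto
qed

lemma out_prod_eqI:
  assumes "F \<in> Obj R" "i \<in> verts Q" "arrow x" "Cod x = out_prod F i" "arrow y" "Cod y = out_prod F i" "Dom x = Dom y"
    "\<And>\<alpha>. \<lbrakk>\<alpha> \<in> arcs Q; tail Q \<alpha> = i\<rbrakk> \<Longrightarrow> out_pr F i \<alpha> \<odot> x = out_pr F i \<alpha> \<odot> y"
  shows "x = y"
  by (rule product_eqI[OF out_has_product[OF assms(1,2)]]) (use assms in auto)

lemma out_tuple_exists:
  assumes F: "F \<in> Obj R" and i: "i \<in> verts Q" and T: "T \<in> Obj C"
    and h: "\<And>\<alpha>. \<lbrakk>\<alpha> \<in> arcs Q; tail Q \<alpha> = i\<rbrakk> \<Longrightarrow> arrow (h \<alpha>) \<and> Dom (h \<alpha>) = T \<and> Cod (h \<alpha>) = at_vertex F (head Q \<alpha>)"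
  obtains u where "arrow u" "Dom u = T" "Cod u = out_prod F i"
    "\<And>\<alpha>. \<lbrakk>\<alpha> \<in> arcs Q; tail Q \<alpha> = i\<rbrakk> \<Longrightarrow> out_pr F i \<alpha> \<odot> u = h \<alpha>"
proof -
  have h': "arrow (h \<alpha>) \<and> Dom (h \<alpha>) = T \<and> Cod (h \<alpha>) = at_vertex F (head Q \<alpha>)" if "\<alpha> \<in> out_arcs Q i" for \<alpha>
    using h that by simp
  show thesis
    using tup_props[OF out_has_product[OF F i] T h']
    by (intro that[of "tup (out_arcs Q i) (\<lambda>\<alpha>. at_vertex F (head Q \<alpha>)) T h"]) auto
qed

lemma arrow_out_pr [simp]:
  "\<lbrakk>F \<in> Obj R; \<alpha> \<in> arcs Q; tail Q \<alpha> = i\<rbrakk> \<Longrightarrow> arrow (out_pr F i \<alpha>)"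
  by (rule arrow_pr) auto

lemma kernel_psi_Ker:
  assumes F: "F \<in> Obj R" and i: "i \<in> verts Q"
  obtains k where "kernel (psi_arr F i) (Arr (Ker C (at_vertex F i) (out_prod F i) (psi Q C F i)) k (at_vertex F i))"
proof -
  have "\<exists>K k. is_kernel C (at_vertex F i) (out_prod F i) (psi Q C F i) K k"
    using F i psi_arr_props(1)[OF F i] by (intro ex_kernel) (auto simp: psi_arr_def)
  then have "\<exists>k. is_kernel C (at_vertex F i) (out_prod F i) (psi Q C F i) (Ker C (at_vertex F i) (out_prod F i) (psi Q C F i)) k"
    unfolding Ker_def by (rule someI_ex)
  then show thesis using that F i by (auto simp: is_kernel_iff psi_arr_def)
qed

lemma PsiD:
  assumes F: "F \<in> Psi Q C \<X>" and i: "i \<in> verts Q"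
  obtains k where "ses k (psi_arr F i)" "Dom k \<in> \<X>"
proof -
  have FR: "F \<in> Obj R" and epi: "is_epi C (at_vertex F i) (out_prod F i) (psi Q C F i)"
    and K: "Ker C (at_vertex F i) (out_prod F i) (psi Q C F i) \<in> \<X>"
    using F i by (auto simp: Psi_def Let_def)
  obtain k where "kernel (psi_arr F i) (Arr (Ker C (at_vertex F i) (out_prod F i) (psi Q C F i)) k (at_vertex F i))"
    using kernel_psi_Ker[OF FR i] .
  moreover have "epi (psi_arr F i)" using epi FR i by (simp add: is_epi_iff psi_arr_def)
  ultimately show thesis using that epi_kernel_ses K by (metis arr.sel(1))
qed

text \<open>Asking for every kernel covers the one picked by \<open>Ker\<close>, so that its uses
  never deal with the choice.\<close>

lemma PsiI:
  assumes F: "F \<in> Obj R" and epi: "\<And>i. i \<in> verts Q \<Longrightarrow> epi (psi_arr F i)"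
    and ker: "\<And>i k. \<lbrakk>i \<in> verts Q; kernel (psi_arr F i) k\<rbrakk> \<Longrightarrow> Dom k \<in> \<X>"
  shows "F \<in> Psi Q C \<X>"
proof -
  have "is_epi C (at_vertex F i) (out_prod F i) (psi Q C F i)" if i: "i \<in> verts Q" for i
    using epi[OF i] F i by (simp add: is_epi_iff psi_arr_def)
  moreover have "Ker C (at_vertex F i) (out_prod F i) (psi Q C F i) \<in> \<X>" if i: "i \<in> verts Q" for i
  proof -
    obtain k where "kernel (psi_arr F i) (Arr (Ker C (at_vertex F i) (out_prod F i) (psi Q C F i)) k (at_vertex F i))"
      using kernel_psi_Ker[OF F i] .
    then show ?thesis using ker[OF i] by fastforce
  qed
  ultimately show ?thesis using F by (simp add: Psi_def Let_def)
qed

lemma ext_vanishes_stalk_Psi: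
  assumes F: "F \<in> Psi Q C \<B>" and i: "i \<in> verts Q" and A: "A \<in> Obj C"
    and ext: "\<And>B. B \<in> \<B> \<Longrightarrow> ext_vanishes C A B"
  shows "ext_vanishes R (s_obj Q C i A) F"
  unfolding ext_vanishes_def
proof (intro allI impI)
  interpret R: abelian_category R by (rule abelian_Rep)
  let ?S = "s_obj Q C i A"
  fix E \<phi> \<gamma> assume se: "short_exact R F E ?S \<phi> \<gamma>"
  have F' [simp]: "F \<in> Obj R" using F by (simp add: Psi_def)
  have E [simp]: "E \<in> Obj R" and \<phi>: "\<phi> \<in> Hom R F E" and \<gamma>: "\<gamma> \<in> Hom R E ?S"
    using se by (auto simp: short_exact_def is_kernel_def)
  have S [simp]: "?S \<in> Obj R" using A by simp
  note ses = Rep_short_exactD[OF se]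
  note [simp] = i A Rep_HomD(1)[OF \<phi> F' E] Rep_HomD(1)[OF \<gamma> E S]
  \<comment> \<open>The stalk acts by zero, also along loops at \<open>i\<close>, so an arrow
    leaving \<open>i\<close> maps the middle term into the kernel of \<open>\<gamma>\<close>, that
    is, into \<open>F\<close>. The tuple of these maps is the extension of \<psi> to the middle
    term.\<close>
  have "\<exists>u. arrow u \<and> Dom u = at_vertex E i \<and> Cod u = at_vertex F (head Q \<alpha>) \<and>
      cmp F E \<phi> (head Q \<alpha>) \<odot> u = act E \<alpha>" if \<alpha>: "\<alpha> \<in> arcs Q" "tail Q \<alpha> = i" for \<alpha>
  proof -
    have "cmp E ?S \<gamma> (head Q \<alpha>) \<odot> act E \<alpha> = nul (at_vertex E i) (at_vertex ?S (head Q \<alpha>))"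
      using \<alpha> by (simp add: Rep_HomD(2)[OF \<gamma> E S])
    then show ?thesis
      using kernel_lift[OF sesD(7)[OF ses[of "head Q \<alpha>"]], of "act E \<alpha>"] \<alpha> by auto
  qed
  then obtain h where h: "\<And>\<alpha>. \<lbrakk>\<alpha> \<in> arcs Q; tail Q \<alpha> = i\<rbrakk> \<Longrightarrow>
      arrow (h \<alpha>) \<and> Dom (h \<alpha>) = at_vertex E i \<and> Cod (h \<alpha>) = at_vertex F (head Q \<alpha>)"
    and \<phi>h: "\<And>\<alpha>. \<lbrakk>\<alpha> \<in> arcs Q; tail Q \<alpha> = i\<rbrakk> \<Longrightarrow> cmp F E \<phi> (head Q \<alpha>) \<odot> h \<alpha> = act E \<alpha>" by metis
  obtain u where u: "arrow u" "Dom u = at_vertex E i" "Cod u = out_prod F i"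
    and pu: "\<And>\<alpha>. \<lbrakk>\<alpha> \<in> arcs Q; tail Q \<alpha> = i\<rbrakk> \<Longrightarrow> out_pr F i \<alpha> \<odot> u = h \<alpha>"
    using out_tuple_exists[OF F' i, of "at_vertex E i" h] h by auto
  have u\<phi>: "u \<odot> cmp F E \<phi> i = psi_arr F i"
  proof (rule out_prod_eqI[OF F' i])
    fix \<alpha> assume \<alpha>: "\<alpha> \<in> arcs Q" "tail Q \<alpha> = i"
    have "h \<alpha> \<odot> cmp F E \<phi> i = act F \<alpha>"
    proof (rule mono_cancel[OF sesD(5)[OF ses[of "head Q \<alpha>"]]])
      show "cmp F E \<phi> (head Q \<alpha>) \<odot> h \<alpha> \<odot> cmp F E \<phi> i = cmp F E \<phi> (head Q \<alpha>) \<odot> act F \<alpha>"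
        using reassoc[OF \<phi>h[OF \<alpha>], of "cmp F E \<phi> i"] \<alpha> h[OF \<alpha>] by (simp add: Rep_HomD(2)[OF \<phi> F' E])
    qed (use \<alpha> h[OF \<alpha>] in auto)
    then show "out_pr F i \<alpha> \<odot> u \<odot> cmp F E \<phi> i = out_pr F i \<alpha> \<odot> psi_arr F i"
      using reassoc[OF pu[OF \<alpha>], of "cmp F E \<phi> i"] \<alpha> u psi_arr_props[OF F' i] by simp
  qed (use u psi_arr_props[OF F' i] in simp_all)
  obtain k where k: "ses k (u \<odot> cmp F E \<phi> i)" "Dom k \<in> \<B>" using PsiD[OF F i] unfolding u\<phi> .
  have "ext_vanishes C (Cod (cmp E ?S \<gamma> i)) (Dom k)" using ext k by simp
  then obtain s where s: "arrow s" "Dom s = A" "Cod s = at_vertex E i" "cmp E ?S \<gamma> i \<odot> s = idn A"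
    "u \<odot> s = nul A (out_prod F i)"
    using section_into_kernel[OF ses[OF i] u(1) _ k(1)] u by auto
  \<comment> \<open>\<open>u\<close> records all arrows leaving \<open>i\<close>, so a section
    killed by \<open>u\<close> is killed by each of them. Extended by zero, it is then a morphism of
    representations.\<close>
  have kill: "act E \<alpha> \<odot> s = nul A (at_vertex E (head Q \<alpha>))" if \<alpha>: "\<alpha> \<in> arcs Q" "tail Q \<alpha> = i" for \<alpha>
  proof -
    have hs: "h \<alpha> \<odot> s = nul A (at_vertex F (head Q \<alpha>))"
      using reassoc[OF pu[OF \<alpha>], of s] \<alpha> s u by simp
    have "act E \<alpha> \<odot> s = cmp F E \<phi> (head Q \<alpha>) \<odot> h \<alpha> \<odot> s"
      using reassoc[OF \<phi>h[OF \<alpha>], of s] \<alpha> s h[OF \<alpha>] by simp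
    then show ?thesis using \<alpha> by (simp add: hs)
  qed
  define \<sigma> where "\<sigma> j = (if j = i then s else nul (zero_obj C) (at_vertex E j))" for j
  have \<sigma>: "mk_hom \<sigma> \<in> Hom R ?S E"
    by (rule mk_hom_in_Hom) (use s kill in \<open>auto simp: \<sigma>_def\<close>)
  have "\<gamma> \<cdot>\<^bsub>R\<^esub> mk_hom \<sigma> = Ide R ?S"
  proof (rule Rep_Hom_eqI)
    show "\<gamma> \<cdot>\<^bsub>R\<^esub> mk_hom \<sigma> \<in> Hom R ?S ?S" using R.Comp_in_Hom[of ?S E ?S] \<sigma> \<gamma> by simp
    show "Ide R ?S \<in> Hom R ?S ?S" using R.Ide_in_Hom by simp
    fix j assume j: "j \<in> verts Q"
    have "cmp ?S E (mk_hom \<sigma>) j = \<sigma> j" by (rule cmp_mk_hom) (use j s in \<open>auto simp: \<sigma>_def\<close>)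
    then show "cmp ?S ?S (\<gamma> \<cdot>\<^bsub>R\<^esub> mk_hom \<sigma>) j = cmp ?S ?S (Ide R ?S) j"
      using j s by (auto simp: cmp_comp[of j ?S ?S \<gamma> "mk_hom \<sigma>" E] \<sigma>_def nul_zero_obj)
  qed
  then show "\<exists>s\<in>Hom R ?S E. \<gamma> \<cdot>\<^bsub>R\<^esub> s = Ide R ?S" using \<sigma> by blast
qed

text \<open>An extension of \<open>A\<close> by \<open>F\<^sub>i\<close> on which \<open>\<psi>\<^sub>i\<close> still lives is the component at \<open>i\<close> of an
  extension of the stalk of \<open>A\<close> by \<open>F\<close>.\<close>

lemma section_from_stalk:
  assumes F [simp]: "F \<in> Obj R" and i [simp]: "i \<in> verts Q" and ext: "ext_vanishes R (s_obj Q C i A) F"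
    and mp: "ses m p" and m [simp]: "Dom m = at_vertex F i" and p [simp]: "Cod p = A"
    and u [simp]: "arrow u" "Dom u = Cod m" "Cod u = out_prod F i" and um: "u \<odot> m = psi_arr F i"
  obtains s where "arrow s" "Dom s = A" "Cod s = Cod m" "p \<odot> s = idn A" "u \<odot> s = nul A (out_prod F i)"
proof -
  interpret R: abelian_category R by (rule abelian_Rep)
  let ?S = "s_obj Q C i A"
  note [simp] = sesD(1-4)[OF mp] sesD(4)[OF mp, THEN reassoc]
  have A [simp]: "A \<in> Obj C" using arr_typing(3)[OF sesD(2)[OF mp]] by simp
  define V where "V j = (if j = i then Cod m else at_vertex F j)" for j
  define M where "M j = (if j = i then m else idn (at_vertex F j))" for j
  define N where "N j = (if j = i then p else nul (at_vertex F j) (zero_obj C))" for j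
  \<comment> \<open>Arrows leaving \<open>i\<close> act through the components of \<open>u\<close>,
    all others as in \<open>F\<close>. The values stay in \<open>F\<close> and reach the new
    representation by composition with \<open>M\<close>, which settles loops at
    \<open>i\<close>.\<close>
  define U where "U \<alpha> = (if tail Q \<alpha> = i then out_pr F i \<alpha> \<odot> u else act F \<alpha>)" for \<alpha>
  have M [simp]: "arrow (M j)" "Dom (M j) = at_vertex F j" "Cod (M j) = V j" if "j \<in> verts Q" for j
    using that by (auto simp: M_def V_def)
  have N [simp]: "arrow (N j)" "Dom (N j) = V j" "Cod (N j) = at_vertex ?S j" if "j \<in> verts Q" for j
    using that by (auto simp: N_def V_def)
  have U [simp]: "arrow (U \<alpha>)" "Dom (U \<alpha>) = V (tail Q \<alpha>)" "Cod (U \<alpha>) = at_vertex F (head Q \<alpha>)"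
    if "\<alpha> \<in> arcs Q" for \<alpha>
    using that by (auto simp: U_def V_def)
  have MN: "ses (M j) (N j)" if "j \<in> verts Q" for j
    using that mp ses_onto_zero_obj by (auto simp: M_def N_def)
  note NM = sesD(4)[OF MN] sesD(4)[OF MN, THEN reassoc]
  have UM: "U \<alpha> \<odot> M (tail Q \<alpha>) = act F \<alpha>" if "\<alpha> \<in> arcs Q" for \<alpha>
    using that psi_arr_props(2)[OF F i, of \<alpha>] um by (auto simp: U_def M_def)
  define E where "E = mk_rep V (\<lambda>\<alpha>. M (head Q \<alpha>) \<odot> U \<alpha>)"
  have [simp]: "V j \<in> Obj C" if "j \<in> verts Q" for j using arr_typing(3)[OF M(1)[OF that]] that by simp
  have E [simp]: "E \<in> Obj R" unfolding E_def by (rule mk_rep_in_Obj) simp_all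
  have atE [simp]: "at_vertex E j = V j" if "j \<in> verts Q" for j using that by (simp add: E_def)
  have actE: "act E \<alpha> = M (head Q \<alpha>) \<odot> U \<alpha>" if "\<alpha> \<in> arcs Q" for \<alpha>
    using that by (simp add: E_def act_mk_rep)
  have \<phi>: "mk_hom M \<in> Hom R F E"
    by (rule mk_hom_in_Hom) (simp_all add: actE UM)
  \<comment> \<open>Each arrow of \<open>E\<close> factors through the component of \<open>M\<close>
    at its head, which \<open>N\<close> kills; this matches the zero action on the stalk.\<close>
  have \<gamma>: "mk_hom N \<in> Hom R E ?S"
    by (rule mk_hom_in_Hom) (simp_all add: actE NM)
  have cM: "cmp F E (mk_hom M) j = M j" and cN: "cmp E ?S (mk_hom N) j = N j" if "j \<in> verts Q" for j
    using that by (auto intro!: cmp_mk_hom)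
  have "short_exact R F E ?S (mk_hom M) (mk_hom N)"
    by (rule Rep_short_exactI) (use \<phi> \<gamma> MN in \<open>simp_all add: cM cN\<close>)
  then obtain \<sigma> where \<sigma>: "\<sigma> \<in> Hom R ?S E" "mk_hom N \<cdot>\<^bsub>R\<^esub> \<sigma> = Ide R ?S"
    using ext unfolding ext_vanishes_def by blast
  note \<sigma>D = Rep_HomD[OF \<sigma>(1) s_obj_in_Obj[OF A] E]
  define s where "s = cmp ?S E \<sigma> i"
  have s [simp]: "arrow s" "Dom s = A" "Cod s = Cod m" using \<sigma>D(1)[OF i] by (simp_all add: s_def V_def)
  have "N i \<odot> s = idn A"
    using cmp_comp[of i ?S ?S "mk_hom N" \<sigma> E] \<sigma>(2) cN[OF i] by (simp add: s_def)
  then have "p \<odot> s = idn A" by (simp add: N_def)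
  moreover have "u \<odot> s = nul A (out_prod F i)"
  proof (rule out_prod_eqI[OF F i])
    fix \<alpha> assume \<alpha>: "\<alpha> \<in> arcs Q" "tail Q \<alpha> = i"
    have [simp]: "Dom u = V i" by (simp add: V_def)
    \<comment> \<open>Naturality of \<open>\<sigma>\<close> along \<open>\<alpha>\<close>, where the
      stalk acts by zero.\<close>
    have "M (head Q \<alpha>) \<odot> U \<alpha> \<odot> s = nul A (V (head Q \<alpha>))"
      using \<sigma>D(2)[OF \<alpha>(1)] \<sigma>D(1)[of "head Q \<alpha>"] \<sigma>D(1)[OF i] \<alpha> by (simp add: actE s_def)
    then have "U \<alpha> \<odot> s = nul A (at_vertex F (head Q \<alpha>))"
      using monoD[OF sesD(5)[OF MN[of "head Q \<alpha>"]], of "U \<alpha> \<odot> s"] \<alpha> by (simp add: V_def)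
    then show "out_pr F i \<alpha> \<odot> u \<odot> s = out_pr F i \<alpha> \<odot> nul A (out_prod F i)"
      using \<alpha> by (simp add: U_def)
  qed simp_all
  ultimately show thesis using that s by blast
qed

text \<open>Up to sign, the epi \<open>e\<close> factors through \<open>psi_arr F i\<close>. In the
  application \<open>e\<close> comes from the generating class.\<close>

lemma epi_psi:
  assumes F [simp]: "F \<in> Obj R" and i [simp]: "i \<in> verts Q" and ext: "ext_vanishes R (s_obj Q C i A) F"
    and e: "epi e" "Dom e = A" "Cod e = out_prod F i"
  shows "epi (psi_arr F i)"
  unfolding epi_def
proof (intro conjI allI impI)
  show "arrow (psi_arr F i)" by (rule psi_arr_props(1)) simp_all
  note [simp] = this
  have [simp]: "arrow e" "Dom e = A" "Cod e = out_prod F i" using e by (simp_all add: epi_def)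
  have A [simp]: "A \<in> Obj C" using arr_typing(2)[of e] by simp
  obtain P a b p q where bp: "biproduct (at_vertex F i) A P a b p q"
    using biproduct_exists[of "at_vertex F i" A] by auto
  note [simp] = biproductD(1-17)[OF bp]
  note [simp] = biproductD(14-17)[OF bp, THEN reassoc]
  have pq: "ses a q" by (rule biproduct_ses[OF bp])
  define u where "u = psi_arr F i \<odot> p \<oplus> e \<odot> q"
  have u: "arrow u" "Dom u = P" "Cod u = out_prod F i" "u \<odot> a = psi_arr F i" by (simp_all add: u_def)
  obtain s where s: "arrow s" "Dom s = A" "Cod s = P" "q \<odot> s = idn A" "u \<odot> s = nul A (out_prod F i)"
    using section_from_stalk[OF F i ext pq, of u] u by auto
  fix x assume x: "arrow x \<and> Dom x = Cod (psi_arr F i) \<and> x \<odot> psi_arr F i = nul (Dom (psi_arr F i)) (Cod x)"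
  then have x1: "arrow x" "Dom x = out_prod F i" "x \<odot> psi_arr F i = nul (at_vertex F i) (Cod x)" by simp_all
  \<comment> \<open>The component of \<open>s\<close> in \<open>A\<close> is the identity and
    \<open>x\<close> kills the contribution of \<open>psi_arr F i\<close>, so what remains of this
    equation is that \<open>x\<close> kills \<open>e\<close>.\<close>
  have "x \<odot> u \<odot> s = nul A (Cod x)" using s(5) x1(1,2) by simp
  then have "x \<odot> e = nul A (Cod x)"
    using x1 s(1-4) reassoc[OF x1(3), of "p \<odot> s"] by (simp add: u_def)
  then show "x = nul (Cod (psi_arr F i)) (Cod x)" using epiD[OF e(1), of x] x1 by simp
qed

lemma ext_vanishes_ker_psi:
  assumes F [simp]: "F \<in> Obj R" and i [simp]: "i \<in> verts Q" and ext: "ext_vanishes R (s_obj Q C i A) F"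
    and k: "kernel (psi_arr F i) k"
  shows "ext_vanishes C A (Dom k)"
proof (rule ext_vanishes_retractionI)
  fix f g assume fg: "ses f g" and f: "Dom f = Dom k" and g: "Cod g = A"
  note [simp] = psi_arr_props(1)[OF F i] kernelD(2)[OF k]
  have kc [simp]: "Cod k = at_vertex F i" and k0: "psi_arr F i \<odot> k = nul (Dom k) (out_prod F i)"
    using kernelD[OF k] by simp_all
  note fgs [simp] = sesD(1-3)[OF fg]
  have A [simp]: "A \<in> Obj C" using arr_typing(3)[OF sesD(2)[OF fg]] g by simp
  obtain y h b where yh: "ses y h" "Dom y = Cod k" "Cod h = Cod g"
    and b: "arrow b" "Dom b = Cod f" "Cod b = Cod y" "h \<odot> b = g" "b \<odot> f = y \<odot> k"
    and univ: "\<And>v w. \<lbrakk>arrow v; arrow w; Dom v = Cod k; Dom w = Cod f; Cod v = Cod w; v \<odot> k = w \<odot> f\<rbrakk>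
       \<Longrightarrow> \<exists>u. arrow u \<and> Dom u = Cod y \<and> Cod u = Cod v \<and> u \<odot> y = v \<and> u \<odot> b = w"
    using pushout_ses[OF fg, of k] f kernelD(2)[OF k] by metis
  note [simp] = sesD(1-3)[OF yh(1)] yh(2,3) b(1-3)
  \<comment> \<open>The pushout carries a morphism that is \<psi> on the value of \<open>F\<close>
    at \<open>i\<close> and zero on the given middle term; the two prescriptions agree because
    \<open>psi_arr F i\<close> kills \<open>k\<close>.\<close>
  have "\<exists>u. arrow u \<and> Dom u = Cod y \<and> Cod u = Cod (psi_arr F i) \<and> u \<odot> y = psi_arr F i \<and>
      u \<odot> b = nul (Cod f) (out_prod F i)"
    by (rule univ) (use f k0 in simp_all)
  then obtain u where u: "arrow u" "Dom u = Cod y" "Cod u = out_prod F i" "u \<odot> y = psi_arr F i"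
    "u \<odot> b = nul (Cod f) (out_prod F i)" by auto
  obtain s where s: "arrow s" "Dom s = A" "Cod s = Cod y" "h \<odot> s = idn A" "u \<odot> s = nul A (out_prod F i)"
    using section_from_stalk[OF F i ext yh(1), of u] u g by auto
  \<comment> \<open>Both \<open>s \<odot> g\<close> and \<open>b\<close> lift \<open>g\<close> along
    \<open>h\<close>, and both are killed by \<open>u\<close>. Their difference therefore factors
    through \<open>k\<close>; composed with \<open>f\<close> it gives the negative of
    \<open>y \<odot> k\<close>, whence the sign in the retraction at the end.\<close>
  define c where "c = s \<odot> g \<oplus> \<ominus>b"
  have c: "arrow c" "Dom c = Cod f" "Cod c = Cod y" using s g by (simp_all add: c_def)
  have "h \<odot> c = nul (Cod f) A" using s g b(4) reassoc[OF s(4), of g] by (simp add: c_def)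
  then obtain w where w: "arrow w" "Dom w = Cod f" "Cod w = at_vertex F i" "y \<odot> w = c"
    using kernel_lift[OF sesD(7)[OF yh(1)], of c] c g by auto
  have "u \<odot> c = nul (Cod f) (out_prod F i)"
    using s u g reassoc[OF s(5), of g] by (simp add: c_def)
  then have "psi_arr F i \<odot> w = nul (Cod f) (out_prod F i)"
    using reassoc[OF u(4), of w] w u by simp
  then obtain v where v: "arrow v" "Dom v = Cod f" "Cod v = Dom k" "k \<odot> v = w"
    using kernel_lift[OF k, of w] w by auto
  have "y \<odot> k \<odot> v \<odot> f = c \<odot> f"
    using reassoc[OF v(4), of f] reassoc[OF w(4), of f] v w by simp
  also have "\<dots> = y \<odot> k \<odot> \<ominus>(idn (Dom k))"
    using s g f sesD(4)[OF fg] b(5) by (simp add: c_def)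
  finally have "k \<odot> v \<odot> f = k \<odot> \<ominus>(idn (Dom k))"
    by (intro mono_cancel[OF sesD(5)[OF yh(1)], of "k \<odot> v \<odot> f" "k \<odot> \<ominus>(idn (Dom k))"])
      (use v f in simp_all)
  then have vf: "v \<odot> f = \<ominus>(idn (Dom k))"
    by (intro mono_cancel[OF kernelD(3)[OF k], of "v \<odot> f" "\<ominus>(idn (Dom k))"]) (use v f in simp_all)
  then have "(\<ominus>v) \<odot> f = idn (Dom k)" using v f by simp
  then show "\<exists>r. arrow r \<and> Dom r = Cod f \<and> Cod r = Dom k \<and> r \<odot> f = idn (Dom k)"
    using v by (intro exI[of _ "\<ominus>v"]) simp
qed

section \<open>Well-founded induction and recursion along a right-rooted quiver\<close>

lemma right_rooted_wf:
  assumes "right_rooted Q" shows "wf {(head Q \<alpha>, tail Q \<alpha>) |\<alpha>. \<alpha> \<in> arcs Q}"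
  unfolding wf_iff_no_infinite_down_chain
proof
  assume "\<exists>f. \<forall>i. (f (Suc i), f i) \<in> {(head Q \<alpha>, tail Q \<alpha>) |\<alpha>. \<alpha> \<in> arcs Q}"
  then obtain f where f: "\<And>i. (f (Suc i), f i) \<in> {(head Q \<alpha>, tail Q \<alpha>) |\<alpha>. \<alpha> \<in> arcs Q}" by blast
  have "\<forall>i. \<exists>\<alpha>. \<alpha> \<in> arcs Q \<and> head Q \<alpha> = f (Suc i) \<and> tail Q \<alpha> = f i"
    using f unfolding mem_Collect_eq prod.inject by metis
  then obtain a where "\<forall>i. a i \<in> arcs Q \<and> head Q (a i) = f (Suc i) \<and> tail Q (a i) = f i" by metis
  then show False using assms unfolding right_rooted_def by metis
qed

text \<open>The value at \<open>i\<close> is an extension of the product of the values at its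
  successors by a kernel in \<open>\<B>\<close>, so induction carries the vanishing through products
  and extensions.\<close>

lemma Psi_pointwise:
  assumes rr: "right_rooted Q" and F: "F \<in> Psi Q C \<B>" and i: "i \<in> verts Q"
    and ext: "\<And>B. B \<in> \<B> \<Longrightarrow> ext_vanishes C A B"
  shows "ext_vanishes C A (at_vertex F i)"
  using right_rooted_wf[OF rr] i
proof (induction i rule: wf_induct_rule)
  case (less i)
  have F': "F \<in> Obj R" using F by (simp add: Psi_def)
  obtain k where k: "ses k (psi_arr F i)" "Dom k \<in> \<B>" using PsiD[OF F less.prems] .
  have "ext_vanishes C A (at_vertex F (head Q \<alpha>))" if "\<alpha> \<in> out_arcs Q i" for \<alpha>
    by (rule less.IH) (use that in auto)
  then have "ext_vanishes C A (out_prod F i)"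
    using ext_vanishes_product[OF out_has_product[OF F' less.prems]] by blast
  then show ?case
    using ext_vanishes_extension[OF k(1)] ext[OF k(2)] sesD(3)[OF k(1)] by simp
qed

lemma ext_vanishes_Psi:
  assumes rr: "right_rooted Q" and F: "F \<in> Psi Q C \<B>" and G: "G \<in> Obj R"
    and ext: "\<And>i B. \<lbrakk>i \<in> verts Q; B \<in> \<B>\<rbrakk> \<Longrightarrow> ext_vanishes C (at_vertex G i) B"
  shows "ext_vanishes R G F"
  unfolding ext_vanishes_def
proof (intro allI impI)
  interpret R: abelian_category R by (rule abelian_Rep)
  fix E \<phi> \<gamma> assume se: "short_exact R F E G \<phi> \<gamma>"
  have F' [simp]: "F \<in> Obj R" using F by (simp add: Psi_def)
  have E [simp]: "E \<in> Obj R" and \<phi>: "\<phi> \<in> Hom R F E" and \<gamma>: "\<gamma> \<in> Hom R E G"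
    using se by (auto simp: short_exact_def is_kernel_def)
  note ses = Rep_short_exactD[OF se]
  note [simp] = G Rep_HomD(1)[OF \<phi> F' E] Rep_HomD(1)[OF \<gamma> E G]
  let ?sec = "\<lambda>i r. arrow r \<and> Dom r = at_vertex G i \<and> Cod r = at_vertex E i \<and>
    cmp E G \<gamma> i \<odot> r = idn (at_vertex G i)"
  \<comment> \<open>The section at \<open>i\<close> is constrained by those at the heads of the
    arrows leaving \<open>i\<close>, so it is chosen after them. Outside \<open>verts Q\<close>
    nothing is required, as the recursion runs over the whole type.\<close>
  let ?P = "\<lambda>\<sigma> i r. i \<in> verts Q \<longrightarrow> ?sec i r \<and>
    (\<forall>\<alpha>\<in>arcs Q. tail Q \<alpha> = i \<longrightarrow> act E \<alpha> \<odot> r = \<sigma> (head Q \<alpha>) \<odot> act G \<alpha>)"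
  have "\<exists>\<sigma>. \<forall>i. ?P \<sigma> i (\<sigma> i)"
  proof (rule dependent_wf_choice[OF right_rooted_wf[OF rr]])
    fix \<sigma> \<sigma>' :: "'v \<Rightarrow> ('o, 'm) arr" and i r
    assume "\<And>z. (z, i) \<in> {(head Q \<alpha>, tail Q \<alpha>) |\<alpha>. \<alpha> \<in> arcs Q} \<Longrightarrow> \<sigma> z = \<sigma>' z"
    then have "\<sigma> (head Q \<alpha>) = \<sigma>' (head Q \<alpha>)" if "\<alpha> \<in> arcs Q" "tail Q \<alpha> = i" for \<alpha>
      using that by blast
    then show "?P \<sigma> i r = ?P \<sigma>' i r" by auto
  next
    fix i \<sigma> assume IH: "\<And>y. (y, i) \<in> {(head Q \<alpha>, tail Q \<alpha>) |\<alpha>. \<alpha> \<in> arcs Q} \<Longrightarrow> ?P \<sigma> y (\<sigma> y)"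
    show "\<exists>r. ?P \<sigma> i r"
    proof (cases "i \<in> verts Q")
      case i [simp]: True
      have \<sigma>: "?sec (head Q \<alpha>) (\<sigma> (head Q \<alpha>))" if "\<alpha> \<in> arcs Q" "tail Q \<alpha> = i" for \<alpha>
        using IH[of "head Q \<alpha>"] that by auto
      have "ext_vanishes C (at_vertex G i) (at_vertex F i)"
        using Psi_pointwise[OF rr F i] ext[OF i] by blast
      then obtain s where s: "arrow s" "Dom s = at_vertex G i" "Cod s = at_vertex E i"
        "cmp E G \<gamma> i \<odot> s = idn (at_vertex G i)"
        using ext_vanishesD[OF _ ses[OF i]] by auto
      \<comment> \<open>The failure of an arbitrary section \<open>s\<close> to be natural along
        \<open>\<alpha>\<close> is killed by \<open>\<gamma>\<close>, hence comes from
        \<open>F\<close>.\<close>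
      have "\<exists>x. arrow x \<and> Dom x = at_vertex G i \<and> Cod x = at_vertex F (head Q \<alpha>) \<and>
          cmp F E \<phi> (head Q \<alpha>) \<odot> x = act E \<alpha> \<odot> s \<oplus> \<ominus>(\<sigma> (head Q \<alpha>) \<odot> act G \<alpha>)"
        if \<alpha>: "\<alpha> \<in> arcs Q" "tail Q \<alpha> = i" for \<alpha>
      proof -
        let ?d = "act E \<alpha> \<odot> s \<oplus> \<ominus>(\<sigma> (head Q \<alpha>) \<odot> act G \<alpha>)"
        have "cmp E G \<gamma> (head Q \<alpha>) \<odot> ?d = nul (at_vertex G i) (at_vertex G (head Q \<alpha>))"
          using \<alpha> s \<sigma>[OF \<alpha>] reassoc[of "cmp E G \<gamma> (head Q \<alpha>)" "\<sigma> (head Q \<alpha>)" "idn (at_vertex G (head Q \<alpha>))" "act G \<alpha>"]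
          by (simp add: Rep_HomD(3)[OF \<gamma> E G])
        then show ?thesis
          using kernel_lift[OF sesD(7)[OF ses[of "head Q \<alpha>"]], of ?d] \<alpha> s \<sigma>[OF \<alpha>] by auto
      qed
      then obtain x where x: "\<And>\<alpha>. \<lbrakk>\<alpha> \<in> arcs Q; tail Q \<alpha> = i\<rbrakk> \<Longrightarrow>
          arrow (x \<alpha>) \<and> Dom (x \<alpha>) = at_vertex G i \<and> Cod (x \<alpha>) = at_vertex F (head Q \<alpha>)"
        and \<phi>x: "\<And>\<alpha>. \<lbrakk>\<alpha> \<in> arcs Q; tail Q \<alpha> = i\<rbrakk> \<Longrightarrow>
          cmp F E \<phi> (head Q \<alpha>) \<odot> x \<alpha> = act E \<alpha> \<odot> s \<oplus> \<ominus>(\<sigma> (head Q \<alpha>) \<odot> act G \<alpha>)"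
        by metis
      obtain u where u: "arrow u" "Dom u = at_vertex G i" "Cod u = out_prod F i"
        and pu: "\<And>\<alpha>. \<lbrakk>\<alpha> \<in> arcs Q; tail Q \<alpha> = i\<rbrakk> \<Longrightarrow> out_pr F i \<alpha> \<odot> u = x \<alpha>"
        using out_tuple_exists[OF F' i, of "at_vertex G i" x] x by auto
      obtain k where k: "ses k (psi_arr F i)" "Dom k \<in> \<B>" using PsiD[OF F i] .
      obtain y where y: "arrow y" "Dom y = at_vertex G i" "Cod y = at_vertex F i" "psi_arr F i \<odot> y = u"
        using lift_along_epi[OF k(1), of u] u ext[OF i k(2)] by auto
      \<comment> \<open>\<open>y\<close> lifts the tuple of all these defects along \<psi>.
        Subtracting it restores naturality along every arrow leaving \<open>i\<close> at once, and
        \<open>\<gamma>\<close> does not see the change.\<close>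
      define r where "r = s \<oplus> \<ominus>(cmp F E \<phi> i \<odot> y)"
      have "?sec i r"
        using s y reassoc[OF sesD(4)[OF ses[OF i]], of y] by (simp add: r_def)
      moreover have "act E \<alpha> \<odot> r = \<sigma> (head Q \<alpha>) \<odot> act G \<alpha>" if \<alpha>: "\<alpha> \<in> arcs Q" "tail Q \<alpha> = i" for \<alpha>
      proof -
        have "act F \<alpha> \<odot> y = x \<alpha>"
          using pu[OF \<alpha>] y psi_arr_props[OF F' i] reassoc[OF psi_arr_props(2)[OF F' i \<alpha>], of y] \<alpha> by simp
        then have "act E \<alpha> \<odot> cmp F E \<phi> i \<odot> y = act E \<alpha> \<odot> s \<oplus> \<ominus>(\<sigma> (head Q \<alpha>) \<odot> act G \<alpha>)"
          using Rep_HomD(3)[OF \<phi> F' E \<alpha>(1), of y] \<phi>x[OF \<alpha>] \<alpha> y by simp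
        moreover have "\<ominus>(a \<oplus> \<ominus>b) \<oplus> a = b"
          if "arrow a" "arrow b" "Dom a = Dom b" "Cod a = Cod b" for a b
        proof (rule plus_left_cancel[of "a \<oplus> \<ominus>b"])
          show "a \<oplus> \<ominus>b \<oplus> (\<ominus>(a \<oplus> \<ominus>b) \<oplus> a) = a \<oplus> \<ominus>b \<oplus> b"
            using that plus_assoc[of "a \<oplus> \<ominus>b" "\<ominus>(a \<oplus> \<ominus>b)" a] plus_assoc[of a "\<ominus>b" b] by simp
        qed (use that in simp_all)
        ultimately show ?thesis
          using \<alpha> s y \<sigma>[OF \<alpha>] plus_commute[of "act E \<alpha> \<odot> s" "\<ominus>(act E \<alpha> \<odot> s \<oplus> \<ominus>(\<sigma> (head Q \<alpha>) \<odot> act G \<alpha>))"]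
          by (simp add: r_def)
      qed
      ultimately show ?thesis by blast
    qed blast
  qed
  then obtain \<sigma> where sec: "\<And>i. i \<in> verts Q \<Longrightarrow> ?sec i (\<sigma> i)"
    and nat: "\<And>\<alpha>. \<alpha> \<in> arcs Q \<Longrightarrow> act E \<alpha> \<odot> \<sigma> (tail Q \<alpha>) = \<sigma> (head Q \<alpha>) \<odot> act G \<alpha>"
    by (metis tail_in_verts)
  have \<sigma>: "mk_hom \<sigma> \<in> Hom R G E"
    by (rule mk_hom_in_Hom) (use sec nat in simp_all)
  have "\<gamma> \<cdot>\<^bsub>R\<^esub> mk_hom \<sigma> = Ide R G"
  proof (rule Rep_Hom_eqI)
    show "\<gamma> \<cdot>\<^bsub>R\<^esub> mk_hom \<sigma> \<in> Hom R G G" using R.Comp_in_Hom[of G E G] \<sigma> \<gamma> by simp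
    show "Ide R G \<in> Hom R G G" using R.Ide_in_Hom by simp
    fix j assume j: "j \<in> verts Q"
    have "cmp G E (mk_hom \<sigma>) j = \<sigma> j" by (rule cmp_mk_hom) (use j sec in auto)
    then show "cmp G G (\<gamma> \<cdot>\<^bsub>R\<^esub> mk_hom \<sigma>) j = cmp G G (Ide R G) j"
      using j sec by (auto simp: cmp_comp[of j G G \<gamma> "mk_hom \<sigma>" E])
  qed
  then show "\<exists>s\<in>Hom R G E. \<gamma> \<cdot>\<^bsub>R\<^esub> s = Ide R G" using \<sigma> by blast
qed

end

end

lemma (in quiver_rep) cotorsion_perps:
  assumes \<kappa>: "Card_order \<kappa>" and AB: "AB3star C \<kappa>" and cp: "cotorsion_pair C \<A> \<B>"
  shows
    "((\<forall>i\<in>verts Q. exact_functor C (Rep Q C) (g_obj Q C i) (g_mor Q C i)) \<and> lccn Q \<le>o \<kappa> \<longrightarrow>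
        left_perp (Rep Q C) (g_star Q C \<B>) = Rep_in Q C \<A> \<and>
        g_star Q C \<B> \<subseteq> right_perp (Rep Q C) (s_star Q C \<A>)) \<and>
     (generating C \<A> \<and> rmcn Q \<le>o \<kappa> \<longrightarrow>
        Psi Q C \<B> = right_perp (Rep Q C) (s_star Q C \<A>)) \<and>
     (right_rooted Q \<and> rmcn Q \<le>o \<kappa> \<longrightarrow>
        Psi Q C \<B> \<subseteq> Rep_in Q C \<B> \<and>
        Rep_in Q C \<A> \<subseteq> left_perp (Rep Q C) (Psi Q C \<B>)) \<and>
     ((\<forall>i\<in>verts Q. exact_functor C (Rep Q C) (g_obj Q C i) (g_mor Q C i)) \<and>
      lccn Q \<le>o \<kappa> \<and> rmcn Q \<le>o \<kappa> \<and> right_rooted Q \<and> generating C \<A> \<longrightarrow>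
        Rep_in Q C \<A> = left_perp (Rep Q C) (Psi Q C \<B>))"
proof -
  interpret R: abelian_category R by (rule abelian_Rep)
  have A_def: "\<A> = left_perp C \<B>" and B_def: "\<B> = right_perp C \<A>"
    using cp unfolding cotorsion_pair_def by blast+
  \<comment> \<open>Perpendicular classes consist of objects by definition, which is what their
    translation to \<open>ext_vanishes\<close> asks for.\<close>
  have AO: "\<A> \<subseteq> Obj C" unfolding A_def left_perp_def by blast
  have BO: "\<B> \<subseteq> Obj C" unfolding B_def right_perp_def by blast
  have A_iff: "X \<in> \<A> \<longleftrightarrow> X \<in> Obj C \<and> (\<forall>B\<in>\<B>. ext_vanishes C X B)" for X
    using left_perp_iff[OF BO] A_def by blast
  have B_iff: "X \<in> \<B> \<longleftrightarrow> X \<in> Obj C \<and> (\<forall>A\<in>\<A>. ext_vanishes C A X)" for X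
    using right_perp_iff[OF AO] B_def by blast
  have sO: "s_star Q C \<A> \<subseteq> Obj R" using AO by (auto simp: s_star_def)
  have PO: "Psi Q C \<B> \<subseteq> Obj R" by (auto simp: Psi_def)
  have out: out_products if "rmcn Q \<le>o \<kappa>"
    unfolding out_products_def
    by (auto intro!: AB3star_has_product[OF AB \<kappa>] rmcn_ordLeqD[OF that \<kappa>])
  have pp: "paths_prod i" if "lccn Q \<le>o \<kappa>" "i \<in> verts Q" for i
    unfolding paths_prod_def
    using that(2) by (auto intro!: AB3star_has_product[OF AB \<kappa>] lccn_ordLeqD[OF that(1) \<kappa>])
  have a1: "left_perp R (g_star Q C \<B>) = Rep_in Q C \<A>"
    if ex: "\<forall>i\<in>verts Q. exact_functor C R (g_obj Q C i) (g_mor Q C i)" and l: "lccn Q \<le>o \<kappa>"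
  proof -
    have gO: "g_star Q C \<B> \<subseteq> Obj R"
      using BO g_obj_in_Obj[OF pp[OF l]] by (auto simp: g_star_def)
    have "F \<in> left_perp R (g_star Q C \<B>) \<longleftrightarrow> F \<in> Rep_in Q C \<A>" for F
    proof -
      have "ext_vanishes R F (g_obj Q C i B) \<longleftrightarrow> ext_vanishes C (at_vertex F i) B"
        if "F \<in> Obj R" "i \<in> verts Q" "B \<in> \<B>" for i B
        using ext_vanishes_gI[OF pp[OF l]] ext_vanishes_gD[OF pp[OF l]] ex BO that by blast
      moreover have "(\<forall>G\<in>g_star Q C \<B>. ext_vanishes R F G) \<longleftrightarrow>
          (\<forall>i\<in>verts Q. \<forall>B\<in>\<B>. ext_vanishes R F (g_obj Q C i B))"
        unfolding g_star_def by blast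
      ultimately show ?thesis
        unfolding R.left_perp_iff[OF gO] by (auto simp: Rep_in_def A_iff)
    qed
    then show ?thesis by blast
  qed
  have a2: "g_star Q C \<B> \<subseteq> right_perp R (s_star Q C \<A>)"
    if ex: "\<forall>i\<in>verts Q. exact_functor C R (g_obj Q C i) (g_mor Q C i)" and l: "lccn Q \<le>o \<kappa>"
  proof
    fix G assume G: "G \<in> g_star Q C \<B>"
    then obtain i B where iB: "i \<in> verts Q" "B \<in> \<B>" "G = g_obj Q C i B" by (auto simp: g_star_def)
    have "ext_vanishes R S G" if "S \<in> s_star Q C \<A>" for S
    proof -
      obtain j A where S: "S = s_obj Q C j A" "A \<in> \<A>" using \<open>S \<in> s_star Q C \<A>\<close> by (auto simp: s_star_def)
      \<comment> \<open>The value at \<open>i\<close> of a stalk at \<open>j\<close> is either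
        \<open>A\<close> itself or the zero object.\<close>
      have "ext_vanishes C (at_vertex S i) B"
        using iB S A_iff ext_vanishes_zero_obj by auto
      moreover have "S \<in> Obj R" using S AO by auto
      ultimately show ?thesis
        using ext_vanishes_gI[OF pp[OF l iB(1)]] iB BO by blast
    qed
    then show "G \<in> right_perp R (s_star Q C \<A>)"
      unfolding R.right_perp_iff[OF sO] using iB BO g_obj_in_Obj[OF pp[OF l]] by auto
  qed
  have b: "Psi Q C \<B> = right_perp R (s_star Q C \<A>)" if gen: "generating C \<A>" and r: "rmcn Q \<le>o \<kappa>"
  proof
    note o = out[OF r]
    show "Psi Q C \<B> \<subseteq> right_perp R (s_star Q C \<A>)"
    proof
      fix F assume F: "F \<in> Psi Q C \<B>"
      have "\<forall>S\<in>s_star Q C \<A>. ext_vanishes R S F"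
        unfolding s_star_def using ext_vanishes_stalk_Psi[OF o F] A_iff by blast
      then show "F \<in> right_perp R (s_star Q C \<A>)"
        using F PO R.right_perp_iff[OF sO] by blast
    qed
    show "right_perp R (s_star Q C \<A>) \<subseteq> Psi Q C \<B>"
    proof
      fix F assume "F \<in> right_perp R (s_star Q C \<A>)"
      then have F: "F \<in> Obj R" and perp: "\<forall>S\<in>s_star Q C \<A>. ext_vanishes R S F"
        unfolding R.right_perp_iff[OF sO] by blast+
      have ext: "ext_vanishes R (s_obj Q C i A) F" if "i \<in> verts Q" "A \<in> \<A>" for i A
        using perp that unfolding s_star_def by blast
      show "F \<in> Psi Q C \<B>"
      proof (rule PsiI[OF o F])
        fix i assume i: "i \<in> verts Q"
        \<comment> \<open>Generation is applied to the codomain of \<psi> at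
          \<open>i\<close>.\<close>
        obtain A e where A: "A \<in> \<A>" "is_epi C A (out_prod F i) e"
          using gen out_prod_in_Obj[OF o F i] unfolding generating_def by blast
        then have "epi (Arr A e (out_prod F i))"
          using is_epi_iff AO out_prod_in_Obj[OF o F i] by blast
        then show "epi (psi_arr F i)" using epi_psi[OF o F i ext[OF i A(1)]] by simp
        fix k assume k: "kernel (psi_arr F i) k"
        then show "Dom k \<in> \<B>"
          unfolding B_iff using ext_vanishes_ker_psi[OF o F i ext[OF i] k] kernelD(2)[OF k] by auto
      qed
    qed
  qed
  have c1: "Psi Q C \<B> \<subseteq> Rep_in Q C \<B>" if rr: "right_rooted Q" and r: "rmcn Q \<le>o \<kappa>"
  proof
    fix F assume F: "F \<in> Psi Q C \<B>"
    have "ext_vanishes C A (at_vertex F i)" if "i \<in> verts Q" "A \<in> \<A>" for A i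
      using Psi_pointwise[OF out[OF r] rr F that(1)] A_iff that(2) by blast
    then show "F \<in> Rep_in Q C \<B>" using F PO by (auto simp: Rep_in_def B_iff)
  qed
  have c2: "Rep_in Q C \<A> \<subseteq> left_perp R (Psi Q C \<B>)" if rr: "right_rooted Q" and r: "rmcn Q \<le>o \<kappa>"
    unfolding R.left_perp_iff[OF PO] subset_iff
    using ext_vanishes_Psi[OF out[OF r] rr] A_iff by (auto simp: Rep_in_def)
  have d: "left_perp R (Psi Q C \<B>) \<subseteq> Rep_in Q C \<A>"
    if "\<forall>i\<in>verts Q. exact_functor C R (g_obj Q C i) (g_mor Q C i)" "lccn Q \<le>o \<kappa>" "rmcn Q \<le>o \<kappa>" "generating C \<A>"
  proof -
    \<comment> \<open>The second half of (a) and the equality of (b) meet in the right perpendicular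
      class of the stalks. Passing to left perpendiculars reverses this inclusion, and (a)
      identifies the larger class.\<close>
    have "g_star Q C \<B> \<subseteq> Psi Q C \<B>" using a2[OF that(1,2)] b[OF that(4,3)] by simp
    then have "left_perp R (Psi Q C \<B>) \<subseteq> left_perp R (g_star Q C \<B>)"
      unfolding left_perp_def by (intro Collect_mono) (meson subsetD)
    then show ?thesis using a1[OF that(1,2)] by simp
  qed
  show ?thesis
    by (intro conjI impI; (elim conjE)?)
      (rule a1 a2 b c1 c2 subset_antisym[OF c2 d]; assumption)+
qed

theorem theorem4p9:
  fixes Q :: "('v, 'a) pre_digraph"
    and \<kappa> :: "'k rel"
    and C :: "('o, 'm) precat"
    and \<A> \<B> :: "'o set"
  assumes "wf_digraph Q"
    and "Card_order \<kappa>" and "infinite (Field \<kappa>)"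
    and "abelian_category C" and "AB3star C \<kappa>"
    and "cotorsion_pair C \<A> \<B>"
  shows
    "((\<forall>i\<in>verts Q. exact_functor C (Rep Q C) (g_obj Q C i) (g_mor Q C i)) \<and> lccn Q \<le>o \<kappa> \<longrightarrow>
        left_perp (Rep Q C) (g_star Q C \<B>) = Rep_in Q C \<A> \<and>
        g_star Q C \<B> \<subseteq> right_perp (Rep Q C) (s_star Q C \<A>)) \<and>
     (generating C \<A> \<and> rmcn Q \<le>o \<kappa> \<longrightarrow>
        Psi Q C \<B> = right_perp (Rep Q C) (s_star Q C \<A>)) \<and>
     (right_rooted Q \<and> rmcn Q \<le>o \<kappa> \<longrightarrow>
        Psi Q C \<B> \<subseteq> Rep_in Q C \<B> \<and>
        Rep_in Q C \<A> \<subseteq> left_perp (Rep Q C) (Psi Q C \<B>)) \<and>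
     ((\<forall>i\<in>verts Q. exact_functor C (Rep Q C) (g_obj Q C i) (g_mor Q C i)) \<and>
      lccn Q \<le>o \<kappa> \<and> rmcn Q \<le>o \<kappa> \<and> right_rooted Q \<and> generating C \<A> \<longrightarrow>
        Rep_in Q C \<A> = left_perp (Rep Q C) (Psi Q C \<B>))"
proof -
  interpret abelian_category C by fact
  interpret wf_digraph Q by fact
  have "quiver_rep C Q" ..
  from quiver_rep.cotorsion_perps[OF this assms(2,5,6)] show ?thesis .
qed

end
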